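(* Let $K$ be a number field of degree $n$ over $\mathbb{Q}$, let $B=\{\omega_1,\ldots,\omega_n\}$ be an integral basis for $K$, and let $\tau>1$ be a real number. Let $r_1$ be the number of real embeddings of $K$ into $\mathbb{C}$ and let $r_2$ be the number of conjugate pairs of complex embeddings of $K$ into $\mathbb{C}$. Let $$E(K,B,\tau)=\{x\in\mathbb{R}^n : |x-r/q|\le |q|^{-(\tau+1)} \text{ for infinitely many } (q,r)\in\mathbb{Z}^n\times\mathbb{Z}^n \text{ with } q\neq 0\}.$$ There exists a Borel probability measure $\mu$ on $\mathbb{R}^n$ with compact support contained in $E(K,B,\tau)$ such that $$\widehat{\mu}(\xi)=o\left(|\xi|^{-n/(1+\tau)}\exp\left(\frac{n\log|\xi|}{\log\log|\xi|}\right)\log^{r_1+r_2+1}|\xi|\right)\quad\text{as } |\xi|\to\infty,\ \xi\in\mathbb{R}^n.$$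
   Context: For $x\in\mathbb{R}^n$, $|x|=\max_{1\le i\le n}|x_i|$ is the max-norm. An integral basis of $K$ is a $\mathbb{Q}$-basis of $K$ that is also a $\mathbb{Z}$-basis of the ring of integers $\mathbb{Z}_K$. Using $B$, one identifies $q=(q_1,\ldots,q_n)\in\mathbb{Q}^n$ with $q=\sum_{i=1}^n q_i\omega_i\in K$; this identifies $\mathbb{Z}^n$ with $\mathbb{Z}_K$. For $q,r\in\mathbb{Z}^n$, $q\ne 0$, the quotient $r/q$ is computed in the field $K$ and then regarded as an element of $\mathbb{Q}^n\subseteq\mathbb{R}^n$; $|q|$ is the max-norm of the coordinate vector. For a finite Borel measure $\mu$ on $\mathbb{R}^n$, $\widehat{\mu}(\xi)=\int_{\mathbb{R}^n}e^{-2\pi i x\cdot\xi}\,d\mu(x)$. Here $\log^{k}t$ means $(\log t)^k$. *)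

theory Defs
  imports "HOL-Probability.Probability" "HOL-Library.Landau_Symbols"
    "HOL-Computational_Algebra.Polynomial"
begin

text \<open>
  A field is a type of class \<open>field_char_0\<close>, regarded as a vector space over the rationals and as
  a module over the integers. The two interpretations make the library notions of span, dependence,
  dimension and coordinates available.
\<close>

definition rat_scale :: "rat \<Rightarrow> 'k::field_char_0 \<Rightarrow> 'k" where
  "rat_scale a x = of_rat a * x"

definition int_scale :: "int \<Rightarrow> 'k::field_char_0 \<Rightarrow> 'k" where
  "int_scale a x = of_int a * x"

global_interpretation rat_vs: vector_space "rat_scale :: rat \<Rightarrow> 'k::field_char_0 \<Rightarrow> 'k"
  by unfold_locales (simp_all add: rat_scale_def algebra_simps of_rat_add of_rat_mult)

global_interpretation int_mod: module "int_scale :: int \<Rightarrow> 'k::field_char_0 \<Rightarrow> 'k"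
  by unfold_locales (simp_all add: int_scale_def algebra_simps)

definition number_field :: "'k::field_char_0 itself \<Rightarrow> bool" where
  "number_field _ \<longleftrightarrow> (\<exists>S :: 'k set. finite S \<and> rat_vs.span S = UNIV)"

definition field_degree :: "'k::field_char_0 itself \<Rightarrow> nat" where
  "field_degree _ = rat_vs.dim (UNIV :: 'k set)"

definition ring_of_integers :: "'k::field_char_0 set" where
  "ring_of_integers = {x. algebraic_int x}"

text \<open>
  A basis is given as an injective family indexed by a finite type; the index type of cardinality
  \<open>n\<close> replaces \<open>{1,\<dots>,n}\<close> and is also the index type of the coordinate vectors.
\<close>

definition integral_basis :: "('n::finite \<Rightarrow> 'k::field_char_0) \<Rightarrow> bool" where
  "integral_basis \<omega> \<longleftrightarrow>
     inj \<omega> \<and>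
     rat_vs.independent (range \<omega>) \<and> rat_vs.span (range \<omega>) = UNIV \<and>
     int_mod.independent (range \<omega>) \<and> int_mod.span (range \<omega>) = ring_of_integers"

definition of_coords :: "('n::finite \<Rightarrow> 'k::field_char_0) \<Rightarrow> int ^ 'n \<Rightarrow> 'k" where
  "of_coords \<omega> q = (\<Sum>i\<in>UNIV. of_int (q $ i) * \<omega> i)"

definition coords :: "('n::finite \<Rightarrow> 'k::field_char_0) \<Rightarrow> 'k \<Rightarrow> real ^ 'n" where
  "coords \<omega> x = (\<chi> i. real_of_rat (rat_vs.representation (range \<omega>) x (\<omega> i)))"

definition real_vec :: "int ^ 'n \<Rightarrow> real ^ 'n" where
  "real_vec q = (\<chi> i. real_of_int (q $ i))"

text \<open>Additivity and multiplicativity together with \<open>\<sigma> 1 = 1\<close> force injectivity on a field.\<close>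

definition complex_embeddings :: "('k::field_char_0 \<Rightarrow> complex) set" where
  "complex_embeddings =
     {\<sigma>. \<sigma> 1 = 1 \<and> (\<forall>x y. \<sigma> (x + y) = \<sigma> x + \<sigma> y) \<and> (\<forall>x y. \<sigma> (x * y) = \<sigma> x * \<sigma> y)}"

definition num_real_embeddings :: "'k::field_char_0 itself \<Rightarrow> nat" where
  "num_real_embeddings _ = card {\<sigma> \<in> (complex_embeddings :: ('k \<Rightarrow> complex) set). range \<sigma> \<subseteq> \<real>}"

definition num_complex_embedding_pairs :: "'k::field_char_0 itself \<Rightarrow> nat" where
  "num_complex_embedding_pairs _ =
     card ((\<lambda>\<sigma>. {\<sigma>, cnj \<circ> \<sigma>}) `
       {\<sigma> \<in> (complex_embeddings :: ('k \<Rightarrow> complex) set). \<not> range \<sigma> \<subseteq> \<real>})"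

text \<open>The max-norm is the library's \<^const>\<open>infnorm\<close>.\<close>

definition well_approximable :: "('n::finite \<Rightarrow> 'k::field_char_0) \<Rightarrow> real \<Rightarrow> (real ^ 'n) set" where
  "well_approximable \<omega> \<tau> =
     {x. infinite {(q, r). q \<noteq> 0 \<and>
            infnorm (x - coords \<omega> (of_coords \<omega> r / of_coords \<omega> q))
              \<le> infnorm (real_vec q) powr (- (\<tau> + 1))}}"

definition measure_support :: "'a::topological_space measure \<Rightarrow> 'a set" where
  "measure_support \<mu> = {x. \<forall>U. open U \<longrightarrow> x \<in> U \<longrightarrow> emeasure \<mu> U > 0}"

definition fourier_transform :: "(real ^ 'n::finite) measure \<Rightarrow> real ^ 'n \<Rightarrow> complex" where
  "fourier_transform \<mu> \<xi> = (LINT x|\<mu>. exp (- 2 * of_real pi * \<i> * of_real (x \<bullet> \<xi>)))"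

end

theory Submission
  imports Defs "HOL-Real_Asymp.Real_Asymp"
begin

text \<open>
  The measure is the law of the limit of a Markov chain. From \<open>x\<close> the chain moves to the point of
  the lattice of fractions with denominator \<open>q\<close> obtained by rounding \<open>q x\<close> down, plus a smooth
  perturbation of size about \<open>|q|\<close> to the power \<open>-(1 + \<tau>)\<close>, where \<open>q\<close> is uniform in a finite set of
  algebraic integers of size \<open>M\<close>, and \<open>M\<close> grows very fast along the chain. The moves are bounded by
  a rapidly decreasing sequence, so the chain converges almost surely and no weak
  compactness is needed.

  Expanding the rounding into characters of the torus, one step changes the Fourier transform at
  \<open>\<xi>\<close> by the sum of its values at \<open>\<xi> - s\<close>, weighted by the proportion of those \<open>q\<close> whose dual lattice
  contains the integral frequency \<open>s \<noteq> 0\<close>. Such \<open>q\<close> divide an algebraic integer \<open>a\<close> of size \<open>|s|\<close>.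
  The \<open>q\<close> are taken close to one rational integer, so boundedly many of them are associated
  (no unit theorem is needed), and congruent to \<open>1\<close> modulo \<open>Y!\<close> with \<open>Y\<close> slightly smaller than
  \<open>ln M\<close>, so only prime ideals of index more than \<open>Y\<close> occur; this costs a factor \<open>M\<close> to the power
  \<open>o(1 / ln ln M)\<close> in the number of \<open>q\<close>. Hence at most \<open>2 ^ (ln (N a) / ln Y)\<close> ideals are relevant,
  and since \<open>ln 2 < 1\<close> this is smaller than \<open>exp (n ln |\<xi>| / ln ln |\<xi>|)\<close> by more than any power of the
  logarithm.
\<close>

section \<open>Integrality\<close>

text \<open>The critical frequencies of one move have size R about \<open>kappa\<close> to the power
  1 + \<tau>, the reciprocal of the perturbation radius. There R to the power -n / (1 + \<tau>) is
  just \<open>kappa\<close> to the power -n, while a resonant frequency is met by about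
  \<open>2 ^ j\<close> of the \<open>h ^ n\<close> denominators. Both losses, \<open>kappa\<close>
  against \<open>h\<close> and the count \<open>2 ^ j\<close>, have to fit into exp (n ln R / ln ln
  R). With Y about (ln h) to the power 9/10 the first is negligible on this scale, and the second
  has exponent about n ln 2 / (9/10) times ln R / ln ln h, which leaves a margin. The little-o
  arises because each move is chosen after the current measure. Its transform decays to the order 4
  n with a constant that may be huge, and \<open>h\<close> is then taken so large that the move
  costs at most \<epsilon> times the target. Half of the order 4 n makes the sums over frequencies
  converge, the other half gives smallness away from resonance. The set E is not closed, so almost
  sure membership alone does not control the support; the limit is trapped in closed sets instead,
  one for each level.\<close>

definition int_coeffs :: "'a::ring_1 poly \<Rightarrow> bool" where
  "int_coeffs p \<longleftrightarrow> (\<forall>i. coeff p i \<in> \<int>)"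

lemma int_coeffs_diff_mult:
  fixes p q r s :: "'a::comm_ring_1 poly"
  assumes "int_coeffs p" "int_coeffs q" "int_coeffs r" "int_coeffs s"
  shows "int_coeffs (p * q - r * s)"
  using assms unfolding int_coeffs_def
  by (auto simp: coeff_mult intro!: Ints_diff Ints_sum Ints_mult)

text \<open>Fraction-free Gaussian elimination: eliminating the last unknown keeps the diagonal
  monic and of strictly dominant degree in every row.\<close>

lemma monic_annihilator:
  fixes x :: "'a::field" and g :: "nat \<Rightarrow> 'a" and m :: "nat \<Rightarrow> nat \<Rightarrow> 'a poly"
  assumes "\<And>i. i \<le> r \<Longrightarrow> (\<Sum>j\<le>r. poly (m i j) x * g j) = 0"
    and "\<And>i. i \<le> r \<Longrightarrow> lead_coeff (m i i) = 1"
    and "\<And>i j. i \<le> r \<Longrightarrow> j \<le> r \<Longrightarrow> i \<noteq> j \<Longrightarrow> degree (m i j) < degree (m i i)"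
    and "\<And>i j. i \<le> r \<Longrightarrow> j \<le> r \<Longrightarrow> int_coeffs (m i j)"
  shows "\<exists>p. int_coeffs p \<and> lead_coeff p = 1 \<and> poly p x * g 0 = 0"
  using assms
proof (induction r arbitrary: m)
  case 0
  then show ?case by (intro exI[of _ "m 0 0"]) auto
next
  case (Suc r)
  let ?s = "Suc r"
  define m' where "m' i j = m ?s ?s * m i j - m i ?s * m ?s j" for i j
  have nz: "m i i \<noteq> 0" if "i \<le> ?s" for i using Suc.prems(2)[OF that] by auto
  have lt: "degree (m i ?s * m ?s j) < degree (m ?s ?s) + degree (m i i)" if "i \<le> r" "j \<le> r" for i j
  proof -
    have "degree (m i ?s * m ?s j) \<le> degree (m i ?s) + degree (m ?s j)" by (rule degree_mult_le)
    also have "\<dots> < degree (m ?s ?s) + degree (m i i)"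
      using Suc.prems(3)[of i ?s] Suc.prems(3)[of ?s j] that by auto
    finally show ?thesis .
  qed
  have deg: "degree (m' i i) = degree (m ?s ?s) + degree (m i i)"
    and lead: "lead_coeff (m' i i) = 1" if "i \<le> r" for i
  proof -
    have e: "degree (m ?s ?s * m i i) = degree (m ?s ?s) + degree (m i i)"
      using nz[of ?s] nz[of i] that by (simp add: degree_mult_eq)
    show d: "degree (m' i i) = degree (m ?s ?s) + degree (m i i)"
    proof -
      have "degree (- (m i ?s * m ?s i)) < degree (m ?s ?s * m i i)"
        using lt[OF that that] e by simp
      then show ?thesis unfolding m'_def diff_conv_add_uminus e[symmetric]
        by (rule degree_add_eq_left)
    qed
    have "coeff (m i ?s * m ?s i) (degree (m ?s ?s) + degree (m i i)) = 0"
      using lt[OF that that] by (rule coeff_eq_0)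
    moreover have "coeff (m ?s ?s * m i i) (degree (m ?s ?s) + degree (m i i)) = 1"
      using Suc.prems(2)[of ?s] Suc.prems(2)[of i] that by (simp add: coeff_mult_degree_sum)
    ultimately show "lead_coeff (m' i i) = 1" unfolding d by (simp add: m'_def)
  qed
  show ?case
  proof (rule Suc.IH[of m'])
    fix i assume i: "i \<le> r"
    have row: "(\<Sum>j\<le>r. poly (m k j) x * g j) = - (poly (m k ?s) x * g ?s)" if "k \<le> ?s" for k
      using Suc.prems(1)[OF that] by (simp add: eq_neg_iff_add_eq_0)
    have "(\<Sum>j\<le>r. poly (m' i j) x * g j) =
        poly (m ?s ?s) x * (\<Sum>j\<le>r. poly (m i j) x * g j) - poly (m i ?s) x * (\<Sum>j\<le>r. poly (m ?s j) x * g j)"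
      by (simp add: m'_def algebra_simps sum_subtractf sum_distrib_left)
    also have "\<dots> = 0" using row[of i] row[of ?s] i by simp
    finally show "(\<Sum>j\<le>r. poly (m' i j) x * g j) = 0" .
  next
    fix i j assume ij: "i \<le> r" "j \<le> r" "i \<noteq> j"
    have "degree (m ?s ?s * m i j) \<le> degree (m ?s ?s) + degree (m i j)" by (rule degree_mult_le)
    also have "\<dots> < degree (m ?s ?s) + degree (m i i)" using Suc.prems(3)[of i j] ij by simp
    finally have "degree (m' i j) < degree (m ?s ?s) + degree (m i i)"
      unfolding m'_def using lt[OF ij(1,2)] by (rule degree_diff_less)
    then show "degree (m' i j) < degree (m' i i)" using deg ij by simp
  next
    fix i j assume "i \<le> r" "j \<le> r"
    then show "int_coeffs (m' i j)" unfolding m'_def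
      by (intro int_coeffs_diff_mult Suc.prems(4)) auto
  qed (use lead in auto)
qed

text \<open>The determinant trick: expressing each x g through the generators gives a linear system
  with a matrix X - C, monic of degree 1 on the diagonal and constant elsewhere. Elimination leaves
  a monic integral polynomial whose value at x annihilates \<open>g0\<close>, and a nonzero field
  element cancels.\<close>

lemma algebraic_int_if_stable:
  fixes x :: "'k::field_char_0"
  assumes "finite G" "g0 \<in> G" "g0 \<noteq> 0" and st: "\<And>g. g \<in> G \<Longrightarrow> x * g \<in> int_mod.span G"
  shows "algebraic_int x"
proof -
  obtain ys where ys: "set ys = G - {g0}" "distinct ys"
    using finite_distinct_list[of "G - {g0}"] assms(1) by auto
  \<comment> \<open>The elimination ends with the unknown of index 0, which must be the generator
    known to be nonzero.\<close>
  define xs where "xs = g0 # ys"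
  define r where "r = length ys"
  have xs: "set xs = G" "distinct xs" "length xs = Suc r"
    using ys assms(2) by (auto simp: xs_def r_def)
  have "\<exists>c. x * g = (\<Sum>h\<in>G. of_int (c h) * h)" if "g \<in> G" for g
    using st[OF that] unfolding int_mod.span_finite[OF assms(1)] by (auto simp: int_scale_def)
  then obtain c where c: "\<And>g. g \<in> G \<Longrightarrow> x * g = (\<Sum>h\<in>G. of_int (c g h) * h)" by metis
  have bij: "bij_betw (\<lambda>j. xs ! j) {..r} G"
    using bij_betw_nth[OF xs(2), of "{..r}" G] xs by (simp add: lessThan_Suc_atMost)
  define m where "m i j = (if i = j then [:- of_int (c (xs!i) (xs!i)), 1:] else [:- of_int (c (xs!i) (xs!j)):] :: 'k poly)" for i j
  have "\<exists>p. int_coeffs p \<and> lead_coeff p = 1 \<and> poly p x * xs ! 0 = 0"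
  proof (rule monic_annihilator[where m = m and r = r])
    fix i assume i: "i \<le> r"
    have iG: "xs ! i \<in> G" using bij i by (auto simp: bij_betw_def)
    have "(\<Sum>j\<le>r. poly (m i j) x * xs ! j) = (\<Sum>j\<le>r. (if i = j then x * xs ! i else 0) - of_int (c (xs!i) (xs!j)) * xs ! j)"
      by (intro sum.cong) (auto simp: m_def algebra_simps)
    also have "\<dots> = x * xs ! i - (\<Sum>j\<le>r. of_int (c (xs!i) (xs!j)) * xs ! j)"
      using i by (simp add: sum_subtractf)
    also have "(\<Sum>j\<le>r. of_int (c (xs!i) (xs!j)) * xs ! j) = (\<Sum>h\<in>G. of_int (c (xs!i) h) * h)"
      using sum.reindex_bij_betw[OF bij, of "\<lambda>h. of_int (c (xs!i) h) * h"] by simp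
    finally show "(\<Sum>j\<le>r. poly (m i j) x * xs ! j) = 0" using c[OF iG] by simp
  qed (auto simp: m_def int_coeffs_def coeff_pCons split: nat.splits)
  then obtain p where "int_coeffs p" "lead_coeff p = 1" "poly p x = 0"
    using assms(3) by (auto simp: xs_def)
  then show ?thesis unfolding int_coeffs_def by (auto intro: algebraic_int.intros)
qed

text \<open>A monic relation of degree d rewrites x ^ d, so the powers below d generate Z[x].
  Positivity of d keeps 1 among the generators; it is the nonzero element that the determinant trick
  asks for.\<close>

lemma span_power_algebraic_int:
  fixes x :: "'k::field_char_0"
  assumes "algebraic_int x"
  shows "\<exists>d>0. \<forall>u \<in> int_mod.span ((\<lambda>i. x ^ i) ` {..<d}). x * u \<in> int_mod.span ((\<lambda>i. x ^ i) ` {..<d})"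
proof -
  obtain p where p: "lead_coeff p = 1" "\<And>i. coeff p i \<in> \<int>" "poly p x = 0"
    using assms by (auto elim: algebraic_int.cases)
  define d where "d = degree p"
  let ?S = "int_mod.span ((\<lambda>i. x ^ i) ` {..<d})"
  have "d > 0"
  proof (rule ccontr)
    assume "\<not> d > 0"
    then obtain a where "p = [:a:]" using d_def by (metis degree_eq_zeroE gr0I)
    then show False using p by simp
  qed
  have xd: "x ^ d \<in> ?S"
  proof -
    have "0 = (\<Sum>i\<le>d. coeff p i * x ^ i)" using p(3) by (simp add: poly_altdef d_def)
    also have "\<dots> = (\<Sum>i<d. coeff p i * x ^ i) + x ^ d"
      using p(1) by (simp add: lessThan_Suc_atMost[symmetric] d_def)
    finally have "x ^ d = - (\<Sum>i<d. coeff p i * x ^ i)" by (simp add: eq_neg_iff_add_eq_0 add.commute)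
    moreover have "coeff p i * x ^ i \<in> ?S" if "i < d" for i
    proof -
      obtain k where "coeff p i = of_int k" using p(2)[of i] by (auto elim: Ints_cases)
      then show ?thesis using int_mod.span_scale[OF int_mod.span_base[of "x ^ i"], of _ k] that
        by (auto simp: int_scale_def)
    qed
    ultimately show ?thesis by (auto intro!: int_mod.span_neg int_mod.span_sum)
  qed
  have "x * u \<in> ?S" if "u \<in> ?S" for u
    using that
  proof (induction rule: int_mod.span_induct_alt)
    case base
    then show ?case by (simp add: int_mod.span_zero)
  next
    case (step c v w)
    then obtain i where i: "i < d" "v = x ^ i" by auto
    have "x * v \<in> ?S"
    proof (cases "Suc i < d")
      case True
      then show ?thesis using i by (intro int_mod.span_base) (auto intro!: image_eqI[of _ _ "Suc i"])
    next
      case False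
      then have "d = Suc i" using i by simp
      then show ?thesis using xd i by simp
    qed
    moreover have "x * (int_scale c v + w) = int_scale c (x * v) + x * w"
      by (simp add: int_scale_def algebra_simps)
    ultimately show ?case using int_mod.span_add[OF int_mod.span_scale step(2)] by metis
  qed
  then show ?thesis using \<open>d > 0\<close> by auto
qed

lemma int_span_mult:
  fixes u v :: "'k::field_char_0"
  assumes "u \<in> int_mod.span A" "v \<in> int_mod.span B"
  shows "u * v \<in> int_mod.span ((\<lambda>(a, b). a * b) ` (A \<times> B))" (is "_ \<in> ?S")
  using assms(1)
proof (induction rule: int_mod.span_induct_alt)
  case base
  then show ?case by (simp add: int_mod.span_zero)
next
  case (step c a w)
  have "a * v \<in> ?S" using assms(2)
  proof (induction rule: int_mod.span_induct_alt)
    case base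
    then show ?case by (simp add: int_mod.span_zero)
  next
    case (step c' b w')
    have "a * b \<in> ?S" using step(1) \<open>a \<in> A\<close> by (intro int_mod.span_base) auto
    moreover have "a * (int_scale c' b + w') = int_scale c' (a * b) + a * w'"
      by (simp add: int_scale_def algebra_simps)
    ultimately show ?case using int_mod.span_add[OF int_mod.span_scale step(2)] by metis
  qed
  moreover have "(int_scale c a + w) * v = int_scale c (a * v) + w * v"
    by (simp add: int_scale_def algebra_simps)
  ultimately show ?case using int_mod.span_add[OF int_mod.span_scale step(2)] by metis
qed

lemma algebraic_int_mult:
  fixes x y :: "'k::field_char_0"
  assumes "algebraic_int x" "algebraic_int y"
  shows "algebraic_int (x * y)"
proof -
  obtain d where d: "d > 0" "\<And>u. u \<in> int_mod.span ((\<lambda>i. x ^ i) ` {..<d}) \<Longrightarrow> x * u \<in> int_mod.span ((\<lambda>i. x ^ i) ` {..<d})"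
    using span_power_algebraic_int[OF assms(1)] by auto
  obtain e where e: "e > 0" "\<And>u. u \<in> int_mod.span ((\<lambda>i. y ^ i) ` {..<e}) \<Longrightarrow> y * u \<in> int_mod.span ((\<lambda>i. y ^ i) ` {..<e})"
    using span_power_algebraic_int[OF assms(2)] by auto
  define A where "A = (\<lambda>i. x ^ i) ` {..<d}"
  define B where "B = (\<lambda>i. y ^ i) ` {..<e}"
  show ?thesis
  proof (rule algebraic_int_if_stable)
    show "finite ((\<lambda>(a, b). a * b) ` (A \<times> B))" by (auto simp: A_def B_def)
    show "1 \<in> (\<lambda>(a, b). a * b) ` (A \<times> B)"
    proof (rule image_eqI[of _ _ "(1, 1)"])
      show "(1, 1) \<in> A \<times> B"
        using d(1) e(1) unfolding A_def B_def mem_Times_iff by (auto intro!: image_eqI[of _ _ 0])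
    qed simp
    show "(1::'k) \<noteq> 0" by simp
    fix g assume "g \<in> (\<lambda>(a, b). a * b) ` (A \<times> B)"
    then obtain a b where ab: "a \<in> A" "b \<in> B" "g = a * b" by auto
    have "(x * a) * (y * b) \<in> int_mod.span ((\<lambda>(a, b). a * b) ` (A \<times> B))"
      using ab d(2)[of a] e(2)[of b] by (intro int_span_mult) (auto simp: A_def B_def int_mod.span_base)
    then show "x * y * g \<in> int_mod.span ((\<lambda>(a, b). a * b) ` (A \<times> B))"
      by (simp add: ab algebra_simps)
  qed
qed

section \<open>Counting ideals\<close>

text \<open>What the count needs of a ring of integers: nonzero principal ideals have finite index,
  with \<open>N a\<close> an upper bound for the number of classes modulo a. The ring is a subset of
  a field, so quotients such as b / a and fractional ideals are ordinary elements and sets.\<close>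

locale finite_index_domain =
  fixes R :: "'k::field_char_0 set" and N :: "'k \<Rightarrow> nat"
  assumes one_mem: "1 \<in> R"
    and add_mem: "x \<in> R \<Longrightarrow> y \<in> R \<Longrightarrow> x + y \<in> R"
    and neg_mem: "x \<in> R \<Longrightarrow> - x \<in> R"
    and mult_mem: "x \<in> R \<Longrightarrow> y \<in> R \<Longrightarrow> x * y \<in> R"
    and residues: "a \<in> R \<Longrightarrow> a \<noteq> 0 \<Longrightarrow>
      \<exists>S. finite S \<and> S \<subseteq> R \<and> card S \<le> N a \<and> (\<forall>z\<in>R. \<exists>s\<in>S. \<exists>r\<in>R. z - s = a * r)"
begin

definition idl :: "'k set \<Rightarrow> bool" where
  "idl A \<longleftrightarrow> A \<subseteq> R \<and> 0 \<in> A \<and> (\<forall>x\<in>A. \<forall>y\<in>A. x + y \<in> A) \<and> (\<forall>r\<in>R. \<forall>x\<in>A. r * x \<in> A)"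

definition principal :: "'k \<Rightarrow> 'k set" where
  "principal a = (\<lambda>r. a * r) ` R"

lemma zero_mem: "0 \<in> R"
  using add_mem[OF one_mem neg_mem[OF one_mem]] by simp

lemma diff_mem: "x \<in> R \<Longrightarrow> y \<in> R \<Longrightarrow> x - y \<in> R"
  using add_mem[of x "- y"] neg_mem by simp

lemma pow_mem: "x \<in> R \<Longrightarrow> x ^ k \<in> R"
  by (induction k) (auto intro: one_mem mult_mem)

lemma of_nat_mem: "of_nat k \<in> R"
  by (induction k) (auto intro: zero_mem one_mem add_mem)

lemma idlI:
  assumes "A \<subseteq> R" "0 \<in> A" "\<And>x y. x \<in> A \<Longrightarrow> y \<in> A \<Longrightarrow> x + y \<in> A"
    "\<And>r x. r \<in> R \<Longrightarrow> x \<in> A \<Longrightarrow> r * x \<in> A"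
  shows "idl A"
  using assms by (auto simp: idl_def)

lemma idlD:
  assumes "idl A"
  shows "x \<in> A \<Longrightarrow> x \<in> R" "0 \<in> A" "x \<in> A \<Longrightarrow> y \<in> A \<Longrightarrow> x + y \<in> A"
    "r \<in> R \<Longrightarrow> x \<in> A \<Longrightarrow> r * x \<in> A" "x \<in> A \<Longrightarrow> r \<in> R \<Longrightarrow> x * r \<in> A"
    "x \<in> A \<Longrightarrow> - x \<in> A" "x \<in> A \<Longrightarrow> y \<in> A \<Longrightarrow> x - y \<in> A"
proof -
  show a: "x \<in> A \<Longrightarrow> x \<in> R" "0 \<in> A" "x \<in> A \<Longrightarrow> y \<in> A \<Longrightarrow> x + y \<in> A"
    "r \<in> R \<Longrightarrow> x \<in> A \<Longrightarrow> r * x \<in> A" for x y r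
    using assms by (auto simp: idl_def)
  show "x \<in> A \<Longrightarrow> r \<in> R \<Longrightarrow> x * r \<in> A" using a(4)[of r x] by (simp add: mult.commute)
  show n: "x \<in> A \<Longrightarrow> - x \<in> A" for x using a(4)[of "- 1" x] neg_mem[OF one_mem] by simp
  show "x \<in> A \<Longrightarrow> y \<in> A \<Longrightarrow> x - y \<in> A" using a(3)[of x "- y"] n[of y] by simp
qed

lemma idl_principal: "a \<in> R \<Longrightarrow> idl (principal a)"
proof (rule idlI)
  assume a: "a \<in> R"
  show "principal a \<subseteq> R" using a mult_mem by (auto simp: principal_def)
  show "0 \<in> principal a" using zero_mem by (auto simp: principal_def intro!: image_eqI[of _ _ 0])
  fix x y assume "x \<in> principal a" "y \<in> principal a"
  then show "x + y \<in> principal a"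
    by (auto simp: principal_def distrib_left[symmetric] add_mem)
next
  fix r x assume "r \<in> R" "x \<in> principal a"
  then obtain s where "x = a * s" "s \<in> R" "r \<in> R" by (auto simp: principal_def)
  then have "r * x = a * (r * s)" "r * s \<in> R" by (auto intro: mult_mem simp: mult.left_commute)
  then show "r * x \<in> principal a" unfolding principal_def by blast
qed

lemma self_mem_principal: "a \<in> principal a"
  using one_mem by (auto simp: principal_def intro!: image_eqI[of _ _ 1])

lemma principal_subset: "idl A \<Longrightarrow> a \<in> A \<Longrightarrow> principal a \<subseteq> A"
  by (auto simp: principal_def intro: idlD(5))

text \<open>An ideal containing a is a union of classes modulo a, hence is recovered from its trace
  on a finite set of representatives. This finiteness supplies the maximal elements in the arguments
  below.\<close>

lemma finite_ideals:
  assumes "a \<in> R" "a \<noteq> 0"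
  shows "finite {I. idl I \<and> a \<in> I}"
proof -
  obtain S where S: "finite S" "S \<subseteq> R" "\<forall>z\<in>R. \<exists>s\<in>S. \<exists>r\<in>R. z - s = a * r"
    using residues[OF assms] by auto
  have "inj_on (\<lambda>I. I \<inter> S) {I. idl I \<and> a \<in> I}"
  proof (rule inj_onI)
    have sub: "I \<subseteq> I'" if "idl I" "a \<in> I" "idl I'" "a \<in> I'" "I \<inter> S = I' \<inter> S" for I I'
    proof
      fix z assume z: "z \<in> I"
      have "z \<in> R" using idlD(1)[OF that(1) z] .
      then obtain s r where s: "s \<in> S" "r \<in> R" "z - s = a * r"
        using S(3) by blast
      have "s = z - a * r" using s by (metis diff_diff_eq2 add_diff_cancel_left')
      then have "s \<in> I" using z s(2) that(2) idlD(5,7)[OF that(1)] by simp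
      then have "s \<in> I'" using s that by auto
      moreover have "z = s + a * r" using s by (metis add.commute diff_add_cancel)
      ultimately show "z \<in> I'" using s(2) that(4) idlD(3,5)[OF that(3)] by simp
    qed
    fix I I' assume "I \<in> {I. idl I \<and> a \<in> I}" "I' \<in> {I. idl I \<and> a \<in> I}" "I \<inter> S = I' \<inter> S"
    then show "I = I'" using sub[of I I'] sub[of I' I] by auto
  qed
  moreover have "finite ((\<lambda>I. I \<inter> S) ` {I. idl I \<and> a \<in> I})"
    by (rule finite_subset[of _ "Pow S"]) (use S(1) in auto)
  ultimately show ?thesis by (rule finite_imageD[rotated])
qed

section \<open>Maximal ideals and their inverses\<close>

definition maximal_idl :: "'k set \<Rightarrow> bool" where
  "maximal_idl P \<longleftrightarrow> idl P \<and> 1 \<notin> P \<and> (\<forall>z\<in>R. z \<notin> P \<longrightarrow> (\<exists>r\<in>R. 1 - r * z \<in> P))"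

lemma ex_maximal_idl:
  assumes A: "idl A" "a \<in> A" "a \<noteq> 0" "1 \<notin> A"
  shows "\<exists>P. maximal_idl P \<and> A \<subseteq> P"
proof -
  let ?F = "{P. idl P \<and> A \<subseteq> P \<and> 1 \<notin> P}"
  have "finite ?F"
    using A(2) by (intro finite_subset[OF _ finite_ideals[OF idlD(1)[OF A(1,2)] A(3)]]) blast
  then obtain P where P: "idl P" "A \<subseteq> P" "1 \<notin> P" "\<And>P'. P' \<in> ?F \<Longrightarrow> P \<subseteq> P' \<Longrightarrow> P = P'"
    using finite_has_maximal2[of ?F A] A by auto
  \<comment> \<open>Maximality is recorded in its working form, that R / P is a field; adjoining z
    to P must produce 1.\<close>
  have "\<exists>r\<in>R. 1 - r * z \<in> P" if z: "z \<in> R" "z \<notin> P" for z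
  proof -
    define P' where "P' = {p + r * z |p r. p \<in> P \<and> r \<in> R}"
    have "idl P'"
    proof (rule idlI)
      show "P' \<subseteq> R" using z P(1) by (auto simp: P'_def intro!: add_mem mult_mem dest: idlD(1))
      show "0 \<in> P'" using idlD(2)[OF P(1)] zero_mem by (auto simp: P'_def intro!: exI[of _ 0])
    next
      fix x y assume "x \<in> P'" "y \<in> P'"
      then obtain p r p' r' where xy: "x = p + r * z" "y = p' + r' * z" "p \<in> P" "r \<in> R" "p' \<in> P" "r' \<in> R"
        by (auto simp: P'_def)
      have "x + y = (p + p') + (r + r') * z" by (simp add: xy algebra_simps)
      then show "x + y \<in> P'" unfolding P'_def using idlD(3)[OF P(1) xy(3,5)] add_mem[OF xy(4,6)] by blast
    next
      fix s x assume s: "s \<in> R" "x \<in> P'"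
      then obtain p r where x: "x = p + r * z" "p \<in> P" "r \<in> R" by (auto simp: P'_def)
      have "s * x = s * p + (s * r) * z" by (simp add: x algebra_simps)
      then show "s * x \<in> P'" unfolding P'_def using idlD(4)[OF P(1) s(1) x(2)] mult_mem[OF s(1) x(3)] by blast
    qed
    moreover have sub: "P \<subseteq> P'"
    proof
      fix p assume "p \<in> P"
      then have "p = p + 0 * z \<and> p \<in> P \<and> 0 \<in> R" using zero_mem by simp
      then show "p \<in> P'" unfolding P'_def by blast
    qed
    moreover have "z \<in> P'"
    proof -
      have "z = 0 + 1 * z \<and> 0 \<in> P \<and> 1 \<in> R" using one_mem idlD(2)[OF P(1)] by simp
      then show ?thesis unfolding P'_def by blast
    qed
    ultimately have "1 \<in> P'" using P(4)[of P'] P(2) z(2) by auto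
    then obtain p r where pr: "1 = p + r * z" "p \<in> P" "r \<in> R" unfolding P'_def by blast
    have "1 - r * z = p" unfolding pr(1) by simp
    then show ?thesis using pr by metis
  qed
  then show ?thesis using P by (auto simp: maximal_idl_def)
qed

lemma maximal_idl_prime:
  assumes P: "maximal_idl P" and "x \<in> R" "y \<in> R" "x * y \<in> P"
  shows "x \<in> P \<or> y \<in> P"
proof (rule ccontr)
  assume c: "\<not> ?thesis"
  have i: "idl P" using P by (simp add: maximal_idl_def)
  obtain r where r: "r \<in> R" "1 - r * x \<in> P" using P assms c by (auto simp: maximal_idl_def)
  have "y = (1 - r * x) * y + r * (x * y)" by (simp add: algebra_simps)
  moreover have "(1 - r * x) * y + r * (x * y) \<in> P"
    using r assms by (intro idlD(3)[OF i]) (auto intro: idlD(5)[OF i] idlD(4)[OF i])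
  ultimately show False using c by metis
qed

text \<open>A maximal annihilator among those contained in the maximal ideal is all of it.\<close>

lemma maximal_idl_annihilates:
  assumes P: "maximal_idl P" and a: "a \<in> P" "a \<noteq> 0"
  shows "\<exists>b\<in>R. b \<notin> principal a \<and> (\<forall>z\<in>P. z * b \<in> principal a)"
proof -
  have i: "idl P" using P by (simp add: maximal_idl_def)
  have aR: "a \<in> R" using idlD(1)[OF i a(1)] .
  note ia = idl_principal[OF aR]
  \<comment> \<open>The annihilator of the class of b modulo a.\<close>
  define J where "J b = {z \<in> R. z * b \<in> principal a}" for b
  have idlJ: "idl (J b)" if "b \<in> R" for b
  proof (rule idlI)
    show "J b \<subseteq> R" "0 \<in> J b" using idlD(2)[OF ia] zero_mem by (auto simp: J_def)
  next
    fix x y assume "x \<in> J b" "y \<in> J b"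
    then show "x + y \<in> J b" using idlD(3)[OF ia, of "x * b" "y * b"] add_mem
      by (simp add: J_def distrib_right)
  next
    fix r x assume "r \<in> R" "x \<in> J b"
    then show "r * x \<in> J b" using idlD(4)[OF ia, of r "x * b"] mult_mem
      by (simp add: J_def mult.assoc)
  qed
  have aJ: "a \<in> J b" if "b \<in> R" for b
    using that aR by (auto simp: J_def principal_def)
  let ?F = "J ` {b \<in> R. J b \<subseteq> P}"
  have finF: "finite ?F" using idlJ aJ by (intro finite_subset[OF _ finite_ideals[OF aR a(2)]]) blast
  have "J 1 \<subseteq> P" using principal_subset[OF i a(1)] by (auto simp: J_def)
  then have F1: "J 1 \<in> ?F" using one_mem by blast
  obtain m where "m \<in> ?F" and m: "\<forall>m'\<in>?F. m \<subseteq> m' \<longrightarrow> m = m'"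
    using finite_has_maximal2[OF finF F1] by (elim bexE conjE) (rule that)
  then obtain b where b: "b \<in> R" "J b \<subseteq> P" "m = J b" by auto
  have bmax: "J b' = J b" if "b' \<in> R" "J b \<subseteq> J b'" "J b' \<subseteq> P" for b'
    using bspec[OF m, of "J b'"] that unfolding b(3) by blast
  have "z \<in> J b" if z: "z \<in> P" for z
  proof (rule ccontr)
    assume zJ: "z \<notin> J b"
    have zR: "z \<in> R" using idlD(1)[OF i z] .
    \<comment> \<open>Multiplication by z can only enlarge the annihilator, and the enlarged one
      still lies in P; maximality then leaves no room for growth.\<close>
    have eq: "J (z ^ k * b) = J b" for k
    proof (induction k)
      case 0 then show ?case by simp
    next
      case (Suc k)
      let ?b = "z ^ k * b"
      have bR: "?b \<in> R" "z ^ Suc k * b \<in> R" using mult_mem[OF pow_mem[OF zR] b(1)] by blast+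
      have sub: "J b \<subseteq> J (z ^ Suc k * b)"
      proof
        fix s assume "s \<in> J b"
        then have s: "s \<in> R" "s * ?b \<in> principal a" unfolding Suc[symmetric] by (auto simp: J_def)
        have e: "s * (z ^ Suc k * b) = z * (s * ?b)" by (simp add: algebra_simps)
        show "s \<in> J (z ^ Suc k * b)" unfolding J_def mem_Collect_eq e using s(1) idlD(4)[OF ia zR s(2)] ..
      qed
      moreover have "J (z ^ Suc k * b) \<subseteq> P"
      proof (rule ccontr)
        assume "\<not> ?thesis"
        then obtain t where t: "t \<in> R" "t * (z ^ Suc k * b) \<in> principal a" "t \<notin> P" by (auto simp: J_def)
        \<comment> \<open>The annihilator of \<open>?c\<close> contains that of \<open>?b\<close>,
          and it lies in P because P is prime and t is outside P. By maximality the two agree,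
          although z kills \<open>?c\<close> and not \<open>?b\<close>.\<close>
        let ?c = "t * ?b"
        have c: "?c \<in> R" using mult_mem[OF t(1) bR(1)] .
        have 1: "J b \<subseteq> J ?c"
        proof
          fix s assume "s \<in> J b"
          then have s: "s \<in> R" "s * ?b \<in> principal a" unfolding Suc[symmetric] by (auto simp: J_def)
          have e: "s * ?c = t * (s * ?b)" by (simp add: algebra_simps)
          show "s \<in> J ?c" unfolding J_def mem_Collect_eq e using s(1) idlD(4)[OF ia t(1) s(2)] ..
        qed
        have 2: "J ?c \<subseteq> P"
        proof
          fix s assume s: "s \<in> J ?c"
          then have "s * t \<in> J ?b" using t(1) mult_mem by (simp add: J_def mult.assoc)
          then have "s * t \<in> P" using Suc b(2) by auto
          then show "s \<in> P" using maximal_idl_prime[OF P, of s t] s t by (auto simp: J_def)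
        qed
        have e: "z * ?c = t * (z ^ Suc k * b)" by (simp add: algebra_simps)
        have "z \<in> J ?c" unfolding J_def mem_Collect_eq e using zR t(2) ..
        then show False using bmax[OF c 1 2] zJ by simp
      qed
      ultimately show ?case using bmax[OF bR(2)] by blast
    qed
    obtain S where S: "finite S" "\<forall>z\<in>R. \<exists>s\<in>S. \<exists>r\<in>R. z - s = a * r"
      using residues[OF aR a(2)] by blast
    have mem: "z ^ k * b \<in> R" for k using zR b(1) by (intro mult_mem pow_mem)
    have "\<forall>k. \<exists>s. s \<in> S \<and> z ^ k * b - s \<in> principal a"
      using S(2) mem unfolding principal_def by blast
    then obtain f where f: "\<And>k. f k \<in> S" "\<And>k. z ^ k * b - f k \<in> principal a" by metis
    \<comment> \<open>Pigeonhole on the classes modulo a: z ^ k * b and z ^ l * b are congruent for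
      some k < l, so 1 - z ^ (l - k) annihilates z ^ k * b and lies in P. Since z ^ (l - k) lies in
      P too, so would 1.\<close>
    have "\<not> inj_on f (UNIV :: nat set)"
      using S(1) f(1) finite_imageD[of f UNIV] finite_subset[of "range f" S] by auto
    then obtain k l where kl: "k < l" "f k = f l" by (metis inj_onI linorder_neqE_nat)
    have "(z ^ k * b - f k) - (z ^ l * b - f l) \<in> principal a" using idlD(7)[OF ia f(2) f(2)] .
    moreover have "(z ^ k * b - f k) - (z ^ l * b - f l) = (1 - z ^ (l - k)) * (z ^ k * b)"
      using kl by (simp add: algebra_simps flip: power_add)
    ultimately have "1 - z ^ (l - k) \<in> J b"
      unfolding eq[of k, symmetric] using one_mem zR by (auto simp: J_def intro!: diff_mem pow_mem)
    then have "1 - z ^ (l - k) \<in> P" using b by auto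
    moreover have "z ^ (l - k) \<in> P"
    proof -
      have "z ^ (l - k) = z * z ^ (l - k - 1)" using kl power_minus_mult[of "l - k" z] by (simp add: mult.commute)
      then show ?thesis using idlD(5)[OF i z pow_mem[OF zR]] by metis
    qed
    ultimately have "1 - z ^ (l - k) + z ^ (l - k) \<in> P" by (rule idlD(3)[OF i])
    then show False using P by (simp add: maximal_idl_def)
  qed
  moreover have "b \<notin> principal a"
  proof
    assume "b \<in> principal a"
    then have "1 \<in> J b" using one_mem by (auto simp: J_def)
    then show False using b P by (auto simp: maximal_idl_def)
  qed
  ultimately show ?thesis using b(1) by (auto simp: J_def)
qed

end

text \<open>The last assumption is integral closedness, in the form given by the determinant argument.\<close>

locale dedekind_order = finite_index_domain R N
  for R :: "'k::field_char_0 set" and N :: "'k \<Rightarrow> nat" +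
  assumes integrally_closed: "idl A \<Longrightarrow> a \<in> A \<Longrightarrow> a \<noteq> 0 \<Longrightarrow> (\<And>z. z \<in> A \<Longrightarrow> x * z \<in> A) \<Longrightarrow> x \<in> R"
begin

text \<open>A single element \<open>x\<close> of the inverse of \<open>P\<close> suffices, as \<open>P + x P\<close> is an ideal
  strictly above \<open>P\<close>.\<close>

lemma maximal_idl_invertible:
  assumes P: "maximal_idl P" and a: "a \<in> P" "a \<noteq> 0"
  obtains x u v where "x \<notin> R" "\<And>z. z \<in> P \<Longrightarrow> x * z \<in> R" "u \<in> P" "v \<in> P" "x * u + v = 1"
proof -
  have i: "idl P" using P by (simp add: maximal_idl_def)
  have aR: "a \<in> R" using idlD(1)[OF i a(1)] .
  obtain b where b: "b \<in> R" "b \<notin> principal a" "\<And>z. z \<in> P \<Longrightarrow> z * b \<in> principal a"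
    using maximal_idl_annihilates[OF P a] by auto
  \<comment> \<open>An element of the inverse of P that is outside R.\<close>
  define x where "x = b / a"
  have xR: "x \<notin> R"
    using b(2) a(2) by (auto simp: x_def principal_def image_iff)
  have xP: "x * z \<in> R" if "z \<in> P" for z
    using b(3)[OF that] a(2) by (auto simp: x_def principal_def field_simps)
  \<comment> \<open>If x mapped P into itself it would be integral. As R / P is a field, x w has an
    inverse r modulo P; then u = r w and v = 1 - r x w.\<close>
  obtain w where w: "w \<in> P" "x * w \<notin> P"
    using integrally_closed[OF i a, of x] xR by auto
  obtain r where r: "r \<in> R" "1 - r * (x * w) \<in> P"
    using P xP[OF w(1)] w(2) by (auto simp: maximal_idl_def)
  show ?thesis
  proof (rule that[OF xR xP])
    show "r * w \<in> P" using idlD(4)[OF i r(1) w(1)] .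
    show "1 - r * (x * w) \<in> P" by (rule r)
  qed (auto simp: algebra_simps)
qed

section \<open>Ideals coprime to W above a given ideal\<close>

definition separated :: "'k set \<Rightarrow> 'k set \<Rightarrow> bool" where
  "separated A S \<longleftrightarrow> S \<subseteq> R \<and> finite S \<and> (\<forall>s\<in>S. \<forall>t\<in>S. s \<noteq> t \<longrightarrow> s - t \<notin> A)"

text \<open>A bound for the index of A in R, tested on finite sets of pairwise incongruent
  elements.\<close>

definition index_le :: "'k set \<Rightarrow> nat \<Rightarrow> bool" where
  "index_le A M \<longleftrightarrow> (\<forall>S. separated A S \<longrightarrow> card S \<le> M)"

text \<open>The ideal quotient of A by all powers of W, which strips A of the factors shared with W.
  For W = Y! the quotient of R by it has no k-torsion for 1 \<le> k \<le> Y, and this is what makes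
  the index drop quickly.\<close>

definition saturation :: "'k \<Rightarrow> 'k set \<Rightarrow> 'k set" where
  "saturation W A = {z \<in> R. \<exists>k. W ^ k * z \<in> A}"

definition coprime_ideals :: "'k \<Rightarrow> 'k set \<Rightarrow> 'k set set" where
  "coprime_ideals W A = {I. idl I \<and> A \<subseteq> I \<and> (\<exists>w\<in>R. 1 - W * w \<in> I)}"

lemma idl_saturation:
  assumes "idl A" "W \<in> R"
  shows "idl (saturation W A)"
proof (rule idlI)
  show "saturation W A \<subseteq> R" "0 \<in> saturation W A"
    using idlD(2)[OF assms(1)] zero_mem by (auto simp: saturation_def)
next
  fix x y assume "x \<in> saturation W A" "y \<in> saturation W A"
  then obtain k l where kl: "x \<in> R" "y \<in> R" "W ^ k * x \<in> A" "W ^ l * y \<in> A"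
    by (auto simp: saturation_def)
  have "W ^ (k + l) * (x + y) = W ^ l * (W ^ k * x) + W ^ k * (W ^ l * y)"
    by (simp add: power_add algebra_simps)
  moreover have "W ^ l * (W ^ k * x) + W ^ k * (W ^ l * y) \<in> A"
    using kl assms by (intro idlD(3)[OF assms(1)]) (auto intro: idlD(4)[OF assms(1)] pow_mem)
  ultimately have "W ^ (k + l) * (x + y) \<in> A" by metis
  then show "x + y \<in> saturation W A" using kl by (auto simp: saturation_def intro: add_mem)
next
  fix r x assume rx: "r \<in> R" "x \<in> saturation W A"
  then obtain k where k: "x \<in> R" "W ^ k * x \<in> A" by (auto simp: saturation_def)
  have "W ^ k * (r * x) \<in> A" using idlD(4)[OF assms(1) rx(1) k(2)] by (simp add: mult.left_commute)
  then show "r * x \<in> saturation W A" using rx k by (auto simp: saturation_def intro: mult_mem)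
qed

lemma subset_saturation: "idl A \<Longrightarrow> A \<subseteq> saturation W A"
  by (auto simp: saturation_def dest: idlD(1) intro!: exI[of _ 0])

lemma saturation_saturated:
  assumes "z \<in> R" "W * z \<in> saturation W A"
  shows "z \<in> saturation W A"
proof -
  obtain k where "W ^ k * (W * z) \<in> A" using assms by (auto simp: saturation_def)
  then have "W ^ Suc k * z \<in> A" by (simp add: algebra_simps)
  then show ?thesis using assms unfolding saturation_def by blast
qed

text \<open>Modulo I the element W is a unit and can be cancelled, so replacing A by its saturation
  loses no ideal coprime to W.\<close>

lemma saturation_subset:
  assumes "I \<in> coprime_ideals W A" "W \<in> R"
  shows "saturation W A \<subseteq> I"
proof
  obtain w where I: "idl I" "A \<subseteq> I" "w \<in> R" "1 - W * w \<in> I"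
    using assms by (auto simp: coprime_ideals_def)
  have step: "z \<in> I" if "z \<in> R" "W * z \<in> I" for z
  proof -
    have "z = (1 - W * w) * z + w * (W * z)" by (simp add: algebra_simps)
    moreover have "(1 - W * w) * z + w * (W * z) \<in> I"
      using idlD(3)[OF I(1) idlD(5)[OF I(1) I(4) that(1)] idlD(4)[OF I(1) I(3) that(2)]] .
    ultimately show ?thesis by metis
  qed
  have "z \<in> I" if "z \<in> R" "W ^ k * z \<in> I" for z k
    using that
  proof (induction k arbitrary: z)
    case (Suc k)
    then show ?case using step[of "W ^ k * z"] assms by (auto simp: mult.assoc intro: mult_mem pow_mem)
  qed simp
  then show "z \<in> I" if "z \<in> saturation W A" for z
    using that I by (auto simp: saturation_def)
qed

text \<open>Each class modulo B splits into at least Y + 1 classes modulo A: the translates by 0,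
  \<beta>, ..., Y \<beta> are incongruent, because the difference of two of them is k \<beta> up to
  sign with 1 \<le> k \<le> Y.\<close>

lemma index_le_extend:
  assumes A: "idl A" and B: "idl B" "A \<subseteq> B" and \<beta>: "\<beta> \<in> B"
    and tf: "\<And>k. 1 \<le> k \<Longrightarrow> k \<le> Y \<Longrightarrow> of_nat k * \<beta> \<notin> A"
    and M: "index_le A M"
  shows "index_le B (M div (Y + 1))"
  unfolding index_le_def
proof (intro allI impI)
  fix S assume S: "separated B S"
  have \<beta>R: "\<beta> \<in> R" using B \<beta> by (auto dest: idlD(1))
  let ?f = "\<lambda>(s, k). s + of_nat k * \<beta>"
  have key: "s = t \<and> k = l"
    if "s \<in> S" "t \<in> S" "k \<le> Y" "l \<le> Y" "(s + of_nat k * \<beta>) - (t + of_nat l * \<beta>) \<in> A" for s t k l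
  proof -
    have "s - t = ((s + of_nat k * \<beta>) - (t + of_nat l * \<beta>)) + (of_nat l * \<beta> - of_nat k * \<beta>)" by simp
    also have "\<dots> \<in> B"
      using idlD(3)[OF B(1) subsetD[OF B(2) that(5)]
        idlD(7)[OF B(1) idlD(4)[OF B(1) of_nat_mem \<beta>] idlD(4)[OF B(1) of_nat_mem \<beta>]]] .
    finally have st: "s = t" using S that by (auto simp: separated_def)
    then have d: "of_nat k * \<beta> - of_nat l * \<beta> \<in> A" using that by simp
    have False if "k < l"
      using tf[of "l - k"] that \<open>l \<le> Y\<close> idlD(6)[OF A d] by (simp add: of_nat_diff algebra_simps)
    moreover have False if "l < k"
      using tf[of "k - l"] that \<open>k \<le> Y\<close> d by (simp add: of_nat_diff algebra_simps)
    ultimately show ?thesis using st by (meson linorder_neqE_nat)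
  qed
  have inj: "inj_on ?f (S \<times> {..Y})"
  proof (rule inj_onI)
    fix p p' assume p: "p \<in> S \<times> {..Y}" "p' \<in> S \<times> {..Y}" "?f p = ?f p'"
    obtain s k t l where e: "p = (s, k)" "p' = (t, l)" by fastforce
    show "p = p'" using key[of s t k l] p idlD(2)[OF A] unfolding e by simp
  qed
  have "separated A (?f ` (S \<times> {..Y}))"
    unfolding separated_def
  proof (intro conjI ballI impI)
    show "?f ` (S \<times> {..Y}) \<subseteq> R"
    proof
      fix y assume "y \<in> ?f ` (S \<times> {..Y})"
      then obtain s k where y: "y = s + of_nat k * \<beta>" "s \<in> S" by auto
      have "s \<in> R" using S y by (auto simp: separated_def)
      then show "y \<in> R" unfolding y by (intro add_mem mult_mem of_nat_mem \<beta>R)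
    qed
    show "finite (?f ` (S \<times> {..Y}))" using S by (simp add: separated_def)
    fix y z assume "y \<in> ?f ` (S \<times> {..Y})" "z \<in> ?f ` (S \<times> {..Y})" and ne: "y \<noteq> z"
    then obtain s k t l where e: "y = s + of_nat k * \<beta>" "z = t + of_nat l * \<beta>"
      "s \<in> S" "t \<in> S" "k \<le> Y" "l \<le> Y" by auto
    show "y - z \<notin> A" using key[OF e(3-6)] ne unfolding e(1,2) by auto
  qed
  then have "card (?f ` (S \<times> {..Y})) \<le> M" using M by (auto simp: index_le_def)
  then have "card S * (Y + 1) \<le> M" using inj by (simp add: card_image card_cartesian_product)
  then show "card S \<le> M div (Y + 1)" by (simp add: less_eq_div_iff_mult_less_eq)
qed

text \<open>Dividing \<open>A\<close> by a maximal ideal at most halves the number of ideals above \<open>A\<close>, whereas the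
  index drops by more than a factor \<open>Y\<close>.\<close>

lemma card_coprime_ideals:
  fixes Y :: nat
  defines "W \<equiv> of_nat (fact Y)"
  assumes "idl A" "a \<in> A" "a \<noteq> 0" "index_le A M" "M < (Y + 1) ^ j"
    "\<And>z. z \<in> R \<Longrightarrow> W * z \<in> A \<Longrightarrow> z \<in> A"
  shows "card (coprime_ideals W A) \<le> 2 ^ j"
  using assms(2-)
proof (induction j arbitrary: A M)
  case 0
  \<comment> \<open>The case is vacuous: the index would have to be 0, but one class always
    exists.\<close>
  then have "separated A {0}" using zero_mem by (auto simp: separated_def)
  then show ?case using 0 by (auto simp: index_le_def)
next
  case (Suc j)
  note A = Suc.prems(1)
  have WR: "W \<in> R" unfolding W_def by (rule of_nat_mem)
  have fin: "finite (coprime_ideals W A)" if "a \<in> A" "A \<subseteq> R" for A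
    by (rule finite_subset[OF _ finite_ideals[of a]]) (use that Suc.prems in \<open>auto simp: coprime_ideals_def\<close>)
  show ?case
  proof (cases "1 \<in> A")
    case True
    have "I = R" if "I \<in> coprime_ideals W A" for I
    proof -
      have I: "idl I" "1 \<in> I" using that True by (auto simp: coprime_ideals_def)
      have "r \<in> I" if "r \<in> R" for r using idlD(4)[OF I(1) that I(2)] by simp
      then show ?thesis using idlD(1)[OF I(1)] by auto
    qed
    then have "coprime_ideals W A \<subseteq> {R}" by auto
    then have "card (coprime_ideals W A) \<le> card {R}" by (intro card_mono) auto
    also have "\<dots> \<le> 2 ^ Suc j" using one_le_power[of "2::nat" "Suc j"] by simp
    finally show ?thesis .
  next
    case False
    obtain P where P: "maximal_idl P" "A \<subseteq> P"
      using ex_maximal_idl[OF A Suc.prems(2,3) False] by auto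
    have iP: "idl P" using P by (simp add: maximal_idl_def)
    have aP: "a \<in> P" using P Suc.prems by auto
    obtain x u v where x: "x \<notin> R" "\<And>z. z \<in> P \<Longrightarrow> x * z \<in> R" "u \<in> P" "v \<in> P" "x * u + v = 1"
      using maximal_idl_invertible[OF P(1) aP Suc.prems(3)] by blast
    \<comment> \<open>\<open>E I\<close> is I divided by P: the inverse of P is R + x R, because P
      (R + x R) is inside R and contains x u + v = 1.\<close>
    define E where "E I = {z + x * w |z w. z \<in> I \<and> w \<in> I}" for I
    have EI: "z + x * w \<in> E I" if "z \<in> I" "w \<in> I" for z w I
      using that unfolding E_def by blast
    have idlE: "idl (E I)" and subE: "I \<subseteq> E I" and xE: "\<And>w. w \<in> I \<Longrightarrow> x * w \<in> E I"
      if "idl I" "I \<subseteq> P" for I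
    proof -
      note i0 = idlD(2)[OF that(1)]
      show sub: "I \<subseteq> E I" using EI[OF _ i0] by force
      show "x * w \<in> E I" if "w \<in> I" for w using EI[OF i0 that] by simp
      show "idl (E I)"
      proof (rule idlI)
        show "E I \<subseteq> R" using that x(2) by (auto simp: E_def intro!: add_mem dest: idlD(1))
        show "0 \<in> E I" using sub i0 by auto
      next
        fix y y' assume "y \<in> E I" "y' \<in> E I"
        then obtain z w z' w' where y: "y = z + x * w" "y' = z' + x * w'" "z \<in> I" "w \<in> I" "z' \<in> I" "w' \<in> I"
          by (auto simp: E_def)
        have "y + y' = (z + z') + x * (w + w')" by (simp add: y algebra_simps)
        then show "y + y' \<in> E I" using EI[of "z + z'" I "w + w'"] idlD(3)[OF that(1)] y by metis
      next
        fix r y assume "r \<in> R" "y \<in> E I"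
        then obtain z w where y: "y = z + x * w" "z \<in> I" "w \<in> I" "r \<in> R" by (auto simp: E_def)
        have "r * y = r * z + x * (r * w)" by (simp add: y algebra_simps)
        then show "r * y \<in> E I" using EI[of "r * z" I "r * w"] idlD(4)[OF that(1)] y by metis
      qed
    qed
    \<comment> \<open>The induction hypothesis asks for a saturated ideal, which \<open>E A\<close>
      need not be; enlarging it keeps the gain in the index.\<close>
    define B where "B = saturation W (E A)"
    have iE: "idl (E A)" using idlE[OF A P(2)] .
    have iB: "idl B" unfolding B_def using idl_saturation[OF iE WR] .
    have EB: "E A \<subseteq> B" unfolding B_def by (rule subset_saturation[OF iE])
    have AB: "A \<subseteq> B" using subE[OF A P(2)] EB by auto
    obtain w where w: "w \<in> A" "x * w \<notin> A"
      using integrally_closed[OF A Suc.prems(2,3), of x] x(1) by auto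
    have \<beta>: "x * w \<in> B" "x * w \<in> R" using xE[OF A P(2) w(1)] EB iB by (auto dest: idlD(1))
    \<comment> \<open>Here the saturation of A enters: k divides Y!, so k x w in A would put Y! x w,
      and then x w, into A.\<close>
    have tf: "of_nat k * (x * w) \<notin> A" if k1: "1 \<le> k" "k \<le> Y" for k
    proof
      assume k: "of_nat k * (x * w) \<in> A"
      have "k dvd fact Y" by (rule dvd_fact) (use k1 in auto)
      then obtain l where l: "fact Y = k * l" by (elim dvdE)
      have "W * (x * w) = of_nat l * (of_nat k * (x * w))" unfolding W_def l by simp
      then have "W * (x * w) \<in> A" using idlD(4)[OF A of_nat_mem k] by metis
      then show False using Suc.prems(6) \<beta>(2) w(2) by blast
    qed
    have "index_le B (M div (Y + 1))"
      using index_le_extend[OF A iB AB \<beta>(1) tf Suc.prems(4)] .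
    moreover have "M div (Y + 1) < (Y + 1) ^ j"
      using Suc.prems(5) by (intro less_mult_imp_div_less) (simp add: algebra_simps)
    moreover have "z \<in> B" if "z \<in> R" "W * z \<in> B" for z
      using saturation_saturated that unfolding B_def by auto
    ultimately have IH: "card (coprime_ideals W B) \<le> 2 ^ j"
      using Suc.IH[OF iB, of "M div (Y + 1)"] Suc.prems(2,3) AB by auto
    \<comment> \<open>Multiplication by P, undoing \<open>E\<close>; the two elements u and v of P
      suffice because x u + v = 1.\<close>
    define \<psi> where "\<psi> J = {u * y + v * y' |y y'. y \<in> J \<and> y' \<in> J}" for J
    \<comment> \<open>An ideal above A that is not inside P is comaximal with P, so it lies above
      \<open>E A\<close> already. One inside P is recovered from \<open>E I\<close>. Both kinds are
      counted by ideals above B, whence the factor 2.\<close>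
    have "coprime_ideals W A \<subseteq> coprime_ideals W B \<union> \<psi> ` coprime_ideals W B"
    proof
      fix I assume IA: "I \<in> coprime_ideals W A"
      then have I: "idl I" "A \<subseteq> I" by (auto simp: coprime_ideals_def)
      show "I \<in> coprime_ideals W B \<union> \<psi> ` coprime_ideals W B"
      proof (cases "I \<subseteq> P")
        case False
        then obtain z where z: "z \<in> I" "z \<notin> P" "z \<in> R" using I by (auto dest: idlD(1))
        obtain r where r: "r \<in> R" "1 - r * z \<in> P" using P(1) z by (auto simp: maximal_idl_def)
        have "E A \<subseteq> I"
        proof
          fix y assume y: "y \<in> E A"
          then obtain s t where st: "y = s + x * t" "s \<in> A" "t \<in> A" by (auto simp: E_def)
          have "y = (r * y) * z + ((1 - r * z) * s + (x * (1 - r * z)) * t)"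
            by (simp add: st algebra_simps)
          moreover have "(1 - r * z) * s + (x * (1 - r * z)) * t \<in> A"
            using idlD(3)[OF A idlD(4)[OF A idlD(1)[OF iP r(2)] st(2)] idlD(4)[OF A x(2)[OF r(2)] st(3)]] .
          moreover have "(r * y) * z \<in> I"
            using idlD(4)[OF I(1) mult_mem[OF r(1) idlD(1)[OF iE y]] z(1)] .
          ultimately show "y \<in> I" using I(2) idlD(3)[OF I(1)] by (metis subsetD)
        qed
        then have "I \<in> coprime_ideals W (E A)" using IA by (auto simp: coprime_ideals_def)
        then have "B \<subseteq> I" unfolding B_def by (rule saturation_subset[OF _ WR])
        then show ?thesis using IA by (auto simp: coprime_ideals_def)
      next
        case True
        let ?J = "E I"
        have iJ: "idl ?J" using idlE[OF I(1) True] .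
        have IJ: "I \<subseteq> ?J" using subE[OF I(1) True] .
        have "E A \<subseteq> ?J" using I(2) unfolding E_def by blast
        then have "?J \<in> coprime_ideals W (E A)" using IA IJ iJ by (auto simp: coprime_ideals_def)
        then have "B \<subseteq> ?J" unfolding B_def by (rule saturation_subset[OF _ WR])
        then have JB: "?J \<in> coprime_ideals W B" using IA IJ iJ by (auto simp: coprime_ideals_def)
        have mul: "p * y \<in> I" if p: "p \<in> P" and y: "y \<in> ?J" for p y
        proof -
          obtain z w where zw: "y = z + x * w" "z \<in> I" "w \<in> I" using y by (auto simp: E_def)
          have "p * y = p * z + (x * p) * w" by (simp add: zw algebra_simps)
          also have "\<dots> \<in> I"
            using idlD(3)[OF I(1) idlD(4)[OF I(1) idlD(1)[OF iP p] zw(2)] idlD(4)[OF I(1) x(2)[OF p] zw(3)]] .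
          finally show ?thesis .
        qed
        have "\<psi> ?J = I"
        proof
          show "\<psi> ?J \<subseteq> I" using mul x(3,4) idlD(3)[OF I(1)] by (auto simp: \<psi>_def)
          show "I \<subseteq> \<psi> ?J"
          proof
            fix z assume z: "z \<in> I"
            have "z = (x * u + v) * z" using x(5) by simp
            then have "z = u * (x * z) + v * z" by (simp add: algebra_simps)
            then show "z \<in> \<psi> ?J" unfolding \<psi>_def using xE[OF I(1) True z] IJ z by blast
          qed
        qed
        then show ?thesis using JB by blast
      qed
    qed
    moreover have finB: "finite (coprime_ideals W B)"
      using fin[of B] AB Suc.prems(2) iB by (auto dest: idlD(1))
    ultimately have "card (coprime_ideals W A) \<le> card (coprime_ideals W B \<union> \<psi> ` coprime_ideals W B)"
      by (intro card_mono) auto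
    also have "\<dots> \<le> card (coprime_ideals W B) + card (\<psi> ` coprime_ideals W B)" by (rule card_Un_le)
    also have "\<dots> \<le> 2 ^ j + 2 ^ j"
      using IH card_image_le[OF finB, of \<psi>] by linarith
    finally show ?thesis by simp
  qed
qed

text \<open>Since q is 1 modulo Y!, the ideal (q) is coprime to W and therefore still contains the
  saturation of (a), whose index is at most \<open>N a\<close>. Only ideals are counted here;
  associated q are separated in \<open>ex_dual_count\<close>.\<close>

lemma card_divisor_ideals:
  assumes a: "a \<in> R" "a \<noteq> 0" and j: "N a < (Y + 1) ^ j"
    and Q: "\<And>q. q \<in> Q \<Longrightarrow> q \<in> R \<and> (\<exists>w\<in>R. q = 1 + of_nat (fact Y) * w) \<and> a \<in> principal q"
  shows "finite (principal ` Q) \<and> card (principal ` Q) \<le> 2 ^ j"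
proof -
  define W :: 'k where "W = of_nat (fact Y)"
  have WR: "W \<in> R" unfolding W_def by (rule of_nat_mem)
  define A where "A = saturation W (principal a)"
  note ia = idl_principal[OF a(1)]
  have iA: "idl A" unfolding A_def by (rule idl_saturation[OF ia WR])
  have sub: "principal a \<subseteq> A" unfolding A_def by (rule subset_saturation[OF ia])
  have aA: "a \<in> A" using sub self_mem_principal by auto
  obtain S where S: "finite S" "S \<subseteq> R" "card S \<le> N a" "\<forall>z\<in>R. \<exists>s\<in>S. \<exists>r\<in>R. z - s = a * r"
    using residues[OF a] by (elim exE conjE) (rule that)
  have "index_le A (N a)" unfolding index_le_def
  proof (intro allI impI)
    fix T assume T: "separated A T"
    have "\<exists>s. s \<in> S \<and> z - s \<in> principal a" if z: "z \<in> T" for z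
    proof -
      have "z \<in> R" using T z by (auto simp: separated_def)
      then obtain s r where "s \<in> S" "r \<in> R" "z - s = a * r" using S(4) by blast
      then show ?thesis by (auto simp: principal_def)
    qed
    then obtain f where f: "\<And>z. z \<in> T \<Longrightarrow> f z \<in> S" "\<And>z. z \<in> T \<Longrightarrow> z - f z \<in> principal a" by metis
    have "inj_on f T"
    proof (rule inj_onI, rule ccontr)
      fix y z assume yz: "y \<in> T" "z \<in> T" "f y = f z" "y \<noteq> z"
      have "(y - f y) - (z - f z) \<in> A"
        using idlD(7)[OF iA subsetD[OF sub f(2)[OF yz(1)]] subsetD[OF sub f(2)[OF yz(2)]]] .
      then show False using T yz by (auto simp: separated_def)
    qed
    then have "card T \<le> card S" using f S(1) by (intro card_inj_on_le[of f]) auto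
    then show "card T \<le> N a" using S by simp
  qed
  then have "card (coprime_ideals W A) \<le> 2 ^ j"
    using card_coprime_ideals[OF iA aA a(2) _ j] saturation_saturated unfolding W_def A_def by blast
  moreover have sub2: "principal ` Q \<subseteq> coprime_ideals W A"
  proof
    fix I assume "I \<in> principal ` Q"
    then obtain q where "q \<in> Q" and "I = principal q" by blast
    then obtain w where q: "I = principal q" "q \<in> R" "w \<in> R" "q = 1 + W * w" "a \<in> principal q"
      using Q[of q] unfolding W_def by blast
    have "1 - W * (- w) \<in> principal q" using self_mem_principal[of q] q by simp
    then have Ia: "I \<in> coprime_ideals W (principal a)"
      unfolding coprime_ideals_def q(1)
      using idl_principal[OF q(2)] principal_subset[OF idl_principal[OF q(2)] q(5)] neg_mem[OF q(3)] by blast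
    then have "A \<subseteq> I" unfolding A_def by (rule saturation_subset[OF _ WR])
    then show "I \<in> coprime_ideals W A" using Ia
      by (auto simp: coprime_ideals_def)
  qed
  moreover have fin: "finite (coprime_ideals W A)"
    by (rule finite_subset[OF _ finite_ideals[OF a]]) (use aA in \<open>auto simp: coprime_ideals_def\<close>)
  ultimately show ?thesis using card_mono[OF fin sub2] finite_subset[OF sub2 fin] by linarith
qed

end

section \<open>Coordinates\<close>

lemma infnorm_le_iff:
  fixes x :: "real ^ 'n::finite"
  shows "infnorm x \<le> c \<longleftrightarrow> (\<forall>i. \<bar>x $ i\<bar> \<le> c)"
proof
  assume "infnorm x \<le> c"
  then show "\<forall>i. \<bar>x $ i\<bar> \<le> c" using component_le_infnorm_cart[of x] order_trans by blast
next
  assume "\<forall>i. \<bar>x $ i\<bar> \<le> c"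
  then show "infnorm x \<le> c" unfolding infnorm_cart by (intro cSup_least) auto
qed

lemma card_int_box:
  fixes A :: "int set"
  assumes "finite A"
  shows "finite {q :: int ^ 'n::finite. \<forall>i. q $ i \<in> A}"
    and "card {q :: int ^ 'n. \<forall>i. q $ i \<in> A} = card A ^ CARD('n)"
proof -
  have bij: "bij_betw (\<lambda>f. \<chi> i. f i) (UNIV \<rightarrow>\<^sub>E A) {q :: int ^ 'n. \<forall>i. q $ i \<in> A}"
    by (rule bij_betwI[where g = vec_nth]) auto
  show "finite {q :: int ^ 'n. \<forall>i. q $ i \<in> A}"
    using bij_betw_finite[OF bij] assms by (simp add: finite_PiE)
  show "card {q :: int ^ 'n. \<forall>i. q $ i \<in> A} = card A ^ CARD('n)"
    using bij_betw_same_card[OF bij] by (simp add: card_PiE)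
qed

lemma real_vec_nth [simp]: "real_vec q $ i = real_of_int (q $ i)"
  by (simp add: real_vec_def)

lemma real_vec_eq_iff [simp]: "real_vec p = real_vec q \<longleftrightarrow> p = q"
  by (auto simp: vec_eq_iff)

locale number_basis =
  fixes \<omega> :: "'n::finite \<Rightarrow> 'k::field_char_0"
  assumes basis: "integral_basis \<omega>"
begin

definition rc :: "'k \<Rightarrow> 'n \<Rightarrow> rat" where
  "rc x i = rat_vs.representation (range \<omega>) x (\<omega> i)"

lemma indep: "rat_vs.independent (range \<omega>)" and span: "rat_vs.span (range \<omega>) = UNIV"
  and inj: "inj \<omega>"
  using basis by (auto simp: integral_basis_def)

lemma rc_sum: "(\<Sum>i\<in>UNIV. of_rat (rc x i) * \<omega> i) = x"
proof -
  have "(\<Sum>b\<in>range \<omega>. rat_scale (rat_vs.representation (range \<omega>) x b) b) = x"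
    by (rule rat_vs.sum_representation_eq[OF indep]) (auto simp: span)
  then show ?thesis
    by (simp add: sum.reindex[OF inj] o_def rat_scale_def rc_def)
qed

lemma rc_add: "rc (x + y) i = rc x i + rc y i"
  using rat_vs.representation_add[OF indep, of y x] span by (simp add: rc_def add.commute)

lemma rc_scale: "rc (of_rat a * x) i = a * rc x i"
  using rat_vs.representation_scale[OF indep, of x a] span by (simp add: rc_def rat_scale_def)

lemma rc_scale_int: "rc (of_int a * x) i = of_int a * rc x i"
  using rc_scale[of "of_int a" x i] by simp

lemma rc_zero [simp]: "rc 0 i = 0"
  using rc_scale[of 0 0 i] by simp

lemma rc_minus: "rc (- x) i = - rc x i"
  using rc_scale[of "- 1" x i] by simp

lemma rc_diff: "rc (x - y) i = rc x i - rc y i"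
  using rc_add[of x "- y" i] by (simp add: rc_minus)

lemma rc_sum_dist: "rc (sum f A) i = (\<Sum>a\<in>A. rc (f a) i)"
  by (induction A rule: infinite_finite_induct) (auto simp: rc_add)

lemma rc_basis: "rc (\<omega> j) i = (if i = j then 1 else 0)"
  using rat_vs.representation_basis[OF indep, of "\<omega> j"] inj by (auto simp: rc_def inj_eq)

lemma rc_expand: "rc (x * y) i = (\<Sum>k\<in>UNIV. rc y k * rc (x * \<omega> k) i)"
proof -
  have "x * y = (\<Sum>k\<in>UNIV. of_rat (rc y k) * (x * \<omega> k))"
    by (subst rc_sum[of y, symmetric]) (simp add: sum_distrib_left algebra_simps)
  then have "rc (x * y) i = rc (\<Sum>k\<in>UNIV. of_rat (rc y k) * (x * \<omega> k)) i" by (rule arg_cong)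
  then show ?thesis by (simp only: rc_sum_dist rc_scale)
qed

lemma rc_eq_0: "(\<And>i. rc x i = 0) \<Longrightarrow> x = 0"
  using rc_sum[of x] by simp

lemma coords_nth: "coords \<omega> x $ i = real_of_rat (rc x i)"
  by (simp add: coords_def rc_def)

lemma coords_diff: "coords \<omega> (x - y) = coords \<omega> x - coords \<omega> y"
  by (simp add: vec_eq_iff coords_nth rc_diff of_rat_diff)

lemma coords_eq_0_iff: "coords \<omega> x = 0 \<longleftrightarrow> x = 0"
proof
  assume "coords \<omega> x = 0"
  then have "rc x i = 0" for i by (metis coords_nth zero_index of_rat_eq_0_iff)
  then show "x = 0" by (rule rc_eq_0)
qed (simp add: vec_eq_iff coords_nth)

text \<open>The regular representation: multiplication by x in the coordinates of the basis.\<close>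

definition mm :: "'k \<Rightarrow> real ^ 'n ^ 'n" where
  "mm x = (\<chi> i j. coords \<omega> (x * \<omega> j) $ i)"

lemma coords_mult: "coords \<omega> (x * y) = mm x *v coords \<omega> y"
proof -
  have "coords \<omega> (x * y) $ i = (mm x *v coords \<omega> y) $ i" for i
    unfolding coords_nth rc_expand[of x y i]
    by (simp add: matrix_vector_mult_def mm_def coords_nth of_rat_sum of_rat_mult mult.commute)
  then show ?thesis by (simp add: vec_eq_iff)
qed

lemma mm_nth: "mm x $ i $ j = (\<Sum>k\<in>UNIV. coords \<omega> x $ k * coords \<omega> (\<omega> j * \<omega> k) $ i)"
  unfolding mm_def vec_lambda_beta mult.commute[of x] coords_nth rc_expand[of "\<omega> j" x i]
  by (simp add: of_rat_sum of_rat_mult)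

text \<open>Dominates the sum of the absolute values of all structure constants of the
  basis.\<close>

definition struct_bound :: real where
  "struct_bound = 1 + (\<Sum>i\<in>UNIV. \<Sum>j\<in>UNIV. \<Sum>k\<in>UNIV. \<bar>coords \<omega> (\<omega> j * \<omega> k) $ i\<bar>)"

lemma struct_bound_ge_1: "struct_bound \<ge> 1"
  by (simp add: struct_bound_def sum_nonneg)

lemma mm_bound: "\<bar>mm x $ i $ j\<bar> \<le> struct_bound * infnorm (coords \<omega> x)"
proof -
  have "\<bar>mm x $ i $ j\<bar> \<le> (\<Sum>k\<in>UNIV. \<bar>coords \<omega> x $ k * coords \<omega> (\<omega> j * \<omega> k) $ i\<bar>)"
    unfolding mm_nth by (rule sum_abs)
  also have "\<dots> \<le> (\<Sum>k\<in>UNIV. infnorm (coords \<omega> x) * \<bar>coords \<omega> (\<omega> j * \<omega> k) $ i\<bar>)"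
    by (intro sum_mono) (auto simp: abs_mult intro!: mult_right_mono component_le_infnorm_cart)
  also have "\<dots> = infnorm (coords \<omega> x) * (\<Sum>k\<in>UNIV. \<bar>coords \<omega> (\<omega> j * \<omega> k) $ i\<bar>)"
    by (simp add: sum_distrib_left)
  also have "\<dots> \<le> infnorm (coords \<omega> x) * struct_bound"
  proof (intro mult_left_mono infnorm_pos_le)
    have "(\<Sum>k\<in>UNIV. \<bar>coords \<omega> (\<omega> j * \<omega> k) $ i\<bar>) \<le> (\<Sum>j\<in>UNIV. \<Sum>k\<in>UNIV. \<bar>coords \<omega> (\<omega> j * \<omega> k) $ i\<bar>)"
      by (rule member_le_sum) (auto intro: sum_nonneg)
    also have "\<dots> \<le> (\<Sum>i\<in>UNIV. \<Sum>j\<in>UNIV. \<Sum>k\<in>UNIV. \<bar>coords \<omega> (\<omega> j * \<omega> k) $ i\<bar>)"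
      by (rule member_le_sum[where f = "\<lambda>i. \<Sum>j\<in>UNIV. \<Sum>k\<in>UNIV. \<bar>coords \<omega> (\<omega> j * \<omega> k) $ i\<bar>"])
        (auto intro!: sum_nonneg)
    finally show "(\<Sum>k\<in>UNIV. \<bar>coords \<omega> (\<omega> j * \<omega> k) $ i\<bar>) \<le> struct_bound"
      by (simp add: struct_bound_def)
  qed
  finally show ?thesis by (simp add: mult.commute)
qed

abbreviation "OK \<equiv> (ring_of_integers :: 'k set)"

lemma OK_eq: "OK = range (of_coords \<omega>)"
proof -
  have "OK = int_mod.span (range \<omega>)" using basis by (simp add: integral_basis_def)
  also have "\<dots> = range (\<lambda>u. \<Sum>v\<in>range \<omega>. int_scale (u v) v)" by (rule int_mod.span_finite) simp
  also have "\<dots> = range (of_coords \<omega>)"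
  proof (intro equalityI subsetI)
    fix x assume "x \<in> range (\<lambda>u. \<Sum>v\<in>range \<omega>. int_scale (u v) v)"
    then obtain u where "x = (\<Sum>v\<in>range \<omega>. int_scale (u v) v)" by auto
    then have "x = of_coords \<omega> (\<chi> i. u (\<omega> i))"
      by (simp add: of_coords_def sum.reindex[OF inj] int_scale_def)
    then show "x \<in> range (of_coords \<omega>)" by blast
  next
    fix x assume "x \<in> range (of_coords \<omega>)"
    then obtain q where "x = of_coords \<omega> q" by auto
    then have "x = (\<Sum>v\<in>range \<omega>. int_scale ((\<lambda>v. q $ (inv \<omega> v)) v) v)"
      by (simp add: of_coords_def sum.reindex[OF inj] int_scale_def inv_f_f[OF inj])
    then show "x \<in> range (\<lambda>u. \<Sum>v\<in>range \<omega>. int_scale (u v) v)"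
      by (rule image_eqI[where x = "\<lambda>v. q $ (inv \<omega> v)"]) simp
  qed
  finally show ?thesis .
qed

lemma coords_of_coords: "coords \<omega> (of_coords \<omega> q) = real_vec q"
proof -
  have "rc (of_coords \<omega> q) i = of_int (q $ i)" for i
  proof -
    have "rc (of_coords \<omega> q) i = (\<Sum>j\<in>UNIV. if i = j then of_int (q $ j) else 0)"
      unfolding of_coords_def rc_sum_dist rc_scale_int rc_basis by (intro sum.cong) auto
    then show ?thesis by simp
  qed
  then show ?thesis by (simp add: vec_eq_iff coords_nth)
qed

lemma basis_mem_OK: "\<omega> j \<in> OK"
  using basis int_mod.span_base[of "\<omega> j" "range \<omega>"] by (auto simp: integral_basis_def)

lemma mult_mem_OK: "x \<in> OK \<Longrightarrow> y \<in> OK \<Longrightarrow> x * y \<in> OK"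
  by (simp add: ring_of_integers_def algebraic_int_mult)

lemma coords_Ints: "x \<in> OK \<Longrightarrow> coords \<omega> x $ i \<in> \<int>"
  by (auto simp: OK_eq coords_of_coords)

lemma mm_Ints: "x \<in> OK \<Longrightarrow> mm x $ i $ j \<in> \<int>"
  by (simp add: mm_def coords_Ints mult_mem_OK basis_mem_OK)

lemma abs_matrix_mult_le:
  fixes A :: "real ^ 'n ^ 'n"
  assumes "\<And>j. \<bar>A $ i $ j\<bar> \<le> c" "\<And>j. \<bar>v $ j\<bar> \<le> d"
  shows "\<bar>(A *v v) $ i\<bar> \<le> real CARD('n) * c * d"
proof -
  have "\<bar>(A *v v) $ i\<bar> \<le> (\<Sum>j\<in>UNIV. \<bar>A $ i $ j * v $ j\<bar>)"
    unfolding matrix_vector_mult_def vec_lambda_beta by (rule sum_abs)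
  also have "\<dots> \<le> (\<Sum>j\<in>(UNIV :: 'n set). c * d)"
  proof (rule sum_mono)
    fix j
    have "0 \<le> c" using assms(1)[of j] by linarith
    then show "\<bar>A $ i $ j * v $ j\<bar> \<le> c * d"
      unfolding abs_mult using assms by (intro mult_mono) auto
  qed
  finally show ?thesis by simp
qed

section \<open>Division with remainder in the ring of integers\<close>

definition res_bound :: "'k \<Rightarrow> nat" where
  "res_bound a = nat \<lfloor>real CARD('n) * struct_bound * infnorm (coords \<omega> a)\<rfloor>"

definition OK_ball :: "nat \<Rightarrow> 'k set" where
  "OK_ball m = of_coords \<omega> ` {q. \<forall>i. q $ i \<in> {- int m..int m}}"

lemma OK_ball: "finite (OK_ball m)" "OK_ball m \<subseteq> OK" "card (OK_ball m) \<le> (2 * m + 1) ^ CARD('n)"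
proof -
  have c: "card {- int m..int m} = 2 * m + 1" by simp
  show "finite (OK_ball m)" unfolding OK_ball_def by (intro finite_imageI card_int_box) simp
  show "OK_ball m \<subseteq> OK" by (auto simp: OK_ball_def OK_eq)
  have "card (OK_ball m) \<le> card {q :: int ^ 'n. \<forall>i. q $ i \<in> {- int m..int m}}"
    unfolding OK_ball_def by (intro card_image_le card_int_box) simp
  then show "card (OK_ball m) \<le> (2 * m + 1) ^ CARD('n)"
    using card_int_box(2)[of "{- int m..int m}", where 'n = 'n] c by simp
qed

lemma mem_OK_ballI:
  assumes "z \<in> OK" "\<And>i. \<bar>coords \<omega> z $ i\<bar> \<le> c" "m = nat \<lfloor>c\<rfloor>"
  shows "z \<in> OK_ball m"
proof -
  obtain q where q: "z = of_coords \<omega> q" using assms(1) by (auto simp: OK_eq)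
  have "q $ i \<in> {- int m..int m}" for i
  proof -
    have "\<bar>real_of_int (q $ i)\<bar> \<le> c" using assms(2)[of i] by (simp add: q coords_of_coords)
    then have le: "\<bar>q $ i\<bar> \<le> \<lfloor>c\<rfloor>" by (simp add: le_floor_iff)
    then have "0 \<le> \<lfloor>c\<rfloor>" by linarith
    then have "int m = \<lfloor>c\<rfloor>" unfolding assms(3) by (rule nat_0_le)
    then show ?thesis using le by auto
  qed
  then show ?thesis by (auto simp: OK_ball_def q)
qed

text \<open>Subtracting from z / a its coordinatewise floor leaves coordinates between 0 and 1,
  which multiplication by a enlarges to at most \<open>res_bound a\<close>. So a box of side
  proportional to the size of a represents all classes, and the bound on their number is of order
  |a| ^ n, which is all that the divisor estimate needs.\<close>

lemma OK_residues:
  assumes "a \<in> OK" "a \<noteq> 0" "z \<in> OK"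
  shows "\<exists>s\<in>OK_ball (res_bound a). \<exists>r\<in>OK. z - s = a * r"
proof -
  define w :: "int ^ 'n" where "w = (\<chi> i. \<lfloor>rc (z / a) i\<rfloor>)"
  define r where "r = of_coords \<omega> w"
  have r: "r \<in> OK" by (auto simp: r_def OK_eq)
  have "z - a * r = a * (z / a - r)" using assms(2) by (simp add: algebra_simps)
  then have c: "coords \<omega> (z - a * r) = mm a *v coords \<omega> (z / a - r)" by (simp only: coords_mult)
  have "\<bar>coords \<omega> (z / a - r) $ i\<bar> \<le> 1" for i
  proof -
    have "coords \<omega> (z / a - r) $ i = real_of_rat (rc (z / a) i) - real_of_int \<lfloor>rc (z / a) i\<rfloor>"
      by (simp add: coords_diff coords_nth[of "z/a"] r_def coords_of_coords w_def)
    also have "\<dots> = real_of_rat (frac (rc (z / a) i))" by (simp add: frac_def of_rat_diff)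
    finally have e: "coords \<omega> (z / a - r) $ i = real_of_rat (frac (rc (z / a) i))" .
    have "0 \<le> real_of_rat (frac (rc (z / a) i))" by simp
    moreover have "real_of_rat (frac (rc (z / a) i)) \<le> 1"
      using frac_lt_1[of "rc (z / a) i"] by (metis less_imp_le of_rat_1 of_rat_less_eq)
    ultimately show ?thesis unfolding e by linarith
  qed
  then have "\<bar>coords \<omega> (z - a * r) $ i\<bar> \<le> real CARD('n) * (struct_bound * infnorm (coords \<omega> a)) * 1" for i
    unfolding c by (intro abs_matrix_mult_le mm_bound)
  then have "z - a * r \<in> OK_ball (res_bound a)"
    using assms r int_mod.span_diff[of z "range \<omega>" "a * r"] basis mult_mem_OK[OF assms(1) r]
    by (intro mem_OK_ballI[OF _ _ res_bound_def]) (auto simp: integral_basis_def mult.assoc)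
  then show ?thesis using r by (intro bexI[of _ "z - a * r"] bexI[of _ r]) auto
qed

sublocale finite_index_domain OK "\<lambda>a. (2 * res_bound a + 1) ^ CARD('n)"
proof
  show "1 \<in> OK" by (simp add: ring_of_integers_def)
  show "x + y \<in> OK" if "x \<in> OK" "y \<in> OK" for x y
    using that int_mod.span_add[of x "range \<omega>" y] basis by (simp add: integral_basis_def)
  show "- x \<in> OK" if "x \<in> OK" for x
    using that by (simp add: ring_of_integers_def)
  show "x * y \<in> OK" if "x \<in> OK" "y \<in> OK" for x y
    using that by (rule mult_mem_OK)
  show "\<exists>S. finite S \<and> S \<subseteq> OK \<and> card S \<le> (2 * res_bound a + 1) ^ CARD('n) \<and> (\<forall>z\<in>OK. \<exists>s\<in>S. \<exists>r\<in>OK. z - s = a * r)"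
    if "a \<in> OK" "a \<noteq> 0" for a
    using OK_residues[OF that] OK_ball[of "res_bound a"] by (intro exI[of _ "OK_ball (res_bound a)"]) blast
qed

text \<open>An ideal containing a is generated over the integers by the a \<omega>_j and by its
  finitely many elements in the residue box. If x maps the ideal into itself, it stabilises a
  finitely generated module.\<close>

sublocale dedekind_order OK "\<lambda>a. (2 * res_bound a + 1) ^ CARD('n)"
proof
  fix A a x assume A: "idl A" "a \<in> A" "a \<noteq> 0" "\<And>z. z \<in> A \<Longrightarrow> x * z \<in> A"
  have aR: "a \<in> OK" using idlD(1)[OF A(1,2)] .
  define G where "G = insert a ((A \<inter> OK_ball (res_bound a)) \<union> range (\<lambda>j. a * \<omega> j))"
  have GA: "G \<subseteq> A" using A(2) idlD(5)[OF A(1,2) basis_mem_OK] by (auto simp: G_def)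
  have AG: "z \<in> int_mod.span G" if z: "z \<in> A" for z
  proof -
    obtain s r where s: "s \<in> OK_ball (res_bound a)" "r \<in> OK" "z - s = a * r"
      using OK_residues[OF aR A(3) idlD(1)[OF A(1) z]] by blast
    have "s = z - a * r" using s(3) by (simp add: algebra_simps)
    then have "s \<in> A" using idlD(7)[OF A(1) z idlD(5)[OF A(1,2) s(2)]] by simp
    then have "s \<in> int_mod.span G" using s(1) by (intro int_mod.span_base) (auto simp: G_def)
    moreover have "a * r \<in> int_mod.span G"
    proof -
      obtain q where q: "r = of_coords \<omega> q" using s(2) by (auto simp: OK_eq)
      have "a * r = (\<Sum>i\<in>UNIV. int_scale (q $ i) (a * \<omega> i))"
        by (simp add: q of_coords_def int_scale_def sum_distrib_left algebra_simps)
      also have "\<dots> \<in> int_mod.span G"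
        by (intro int_mod.span_sum int_mod.span_scale int_mod.span_base) (auto simp: G_def)
      finally show ?thesis .
    qed
    ultimately have "s + a * r \<in> int_mod.span G" by (rule int_mod.span_add)
    moreover have "z = s + a * r" using s(3) by (simp add: algebra_simps)
    ultimately show ?thesis by simp
  qed
  have "algebraic_int x"
  proof (rule algebraic_int_if_stable)
    show "finite G" using OK_ball(1) by (simp add: G_def)
    show "a \<in> G" by (simp add: G_def)
    show "x * g \<in> int_mod.span G" if "g \<in> G" for g using that GA A(4) AG by blast
  qed (rule A(3))
  then show "x \<in> OK" by (simp add: ring_of_integers_def)
qed

lemma of_coords_mem_OK: "of_coords \<omega> q \<in> OK"
  by (auto simp: OK_eq)

end

section \<open>The family of denominators\<close>

context number_basis
begin

lemma ex_int_multiple_OK: "\<exists>d>0. of_int d * x \<in> OK"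
proof -
  define D where "D = (\<Prod>i\<in>UNIV. snd (quotient_of (rc x i)))"
  have pos: "D > 0" unfolding D_def by (intro prod_pos) (simp add: quotient_of_denom_pos')
  have "\<exists>m. of_int D * rc x i = of_int m" for i
  proof -
    obtain a b where ab: "quotient_of (rc x i) = (a, b)" by fastforce
    have "D = b * (\<Prod>i\<in>UNIV - {i}. snd (quotient_of (rc x i)))"
      unfolding D_def by (subst prod.remove[of _ i]) (auto simp: ab)
    moreover have "rc x i = of_int a / of_int b" by (rule quotient_of_div[OF ab])
    moreover have "b \<noteq> 0" using quotient_of_denom_pos[OF ab] by simp
    ultimately have "of_int D * rc x i = of_int ((\<Prod>i\<in>UNIV - {i}. snd (quotient_of (rc x i))) * a)"
      by (simp add: field_simps)
    then show ?thesis by blast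
  qed
  then obtain m where m: "\<And>i. of_int D * rc x i = of_int (m i)" by metis
  have "of_int D * x = of_coords \<omega> (\<chi> i. m i)"
  proof -
    have "of_int D * x = (\<Sum>i\<in>UNIV. of_rat (of_int D * rc x i) * \<omega> i)"
      by (subst rc_sum[of x, symmetric]) (simp add: sum_distrib_left of_rat_mult algebra_simps)
    then show ?thesis by (simp only: m of_coords_def of_rat_of_int_eq vec_lambda_beta)
  qed
  then show ?thesis using pos of_coords_mem_OK by (intro exI[of _ D]) simp
qed

text \<open>Multiplication by \<open>q\<close> has transpose multiplication by \<open>q\<close> on the dual module, and the dual
  module embeds into the ring of integers. Hence \<open>s\<close> lies in the dual lattice of \<open>q\<close> only if
  \<open>q\<close> divides the algebraic integer attached to \<open>s\<close>.\<close>

lemma ex_dual_embedding: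
  obtains (dual) C and \<beta> :: "int ^ 'n \<Rightarrow> 'k" where "C \<ge> 1" "\<And>s. \<beta> s \<in> OK" "\<And>s. s \<noteq> 0 \<Longrightarrow> \<beta> s \<noteq> 0"
    "\<And>s. infnorm (coords \<omega> (\<beta> s)) \<le> C * infnorm (real_vec s)"
    "\<And>q s t. real_vec s = transpose (mm q) *v real_vec t \<Longrightarrow> \<beta> s = q * \<beta> t"
proof -
  \<comment> \<open>A fixed coordinate functional \<theta> plays the part of the trace. The pairing
    \<theta> (x y) is nondegenerate because division by b \<noteq> 0 reaches \<omega>_i0, where
    \<theta> is 1.\<close>
  define i0 :: 'n where "i0 = undefined"
  define \<theta> where "\<theta> x = rc x i0" for x
  have \<theta>_mult: "\<theta> (x * y) = (\<Sum>k\<in>UNIV. rc y k * \<theta> (x * \<omega> k))" for x y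
    unfolding \<theta>_def by (rule rc_expand)
  have nondeg: "b = 0" if b0: "\<And>k. \<theta> (b * \<omega> k) = 0" for b
  proof (rule ccontr)
    assume b: "b \<noteq> 0"
    have "\<theta> (\<omega> i0) = \<theta> (b * (\<omega> i0 / b))" using b by simp
    also have "\<dots> = 0" using \<theta>_mult[of b "\<omega> i0 / b"] b0 by simp
    finally show False by (simp add: \<theta>_def rc_basis)
  qed
  define T :: "rat ^ 'n ^ 'n" where "T = (\<chi> i j. \<theta> (\<omega> j * \<omega> i))"
  have "\<forall>v. T *v v = 0 \<longrightarrow> v = 0"
  proof (intro allI impI)
    fix v assume v: "T *v v = 0"
    define b where "b = (\<Sum>i\<in>UNIV. of_rat (v $ i) * \<omega> i)"
    have rcb: "rc b i = v $ i" for i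
    proof -
      have "rc b i = (\<Sum>j\<in>UNIV. if i = j then v $ j else 0)"
        unfolding b_def rc_sum_dist rc_scale rc_basis by (intro sum.cong) auto
      then show ?thesis by simp
    qed
    have "\<theta> (b * \<omega> k) = 0" for k
    proof -
      have "\<theta> (b * \<omega> k) = (T *v v) $ k"
        unfolding mult.commute[of b] \<theta>_mult[of "\<omega> k" b] rcb
        by (simp add: matrix_vector_mult_def T_def mult.commute)
      then show ?thesis by (simp add: v)
    qed
    then have "b = 0" by (rule nondeg)
    then show "v = 0" using rcb by (simp add: vec_eq_iff)
  qed
  then have "\<exists>B. B ** T = mat 1" by (simp only: matrix_left_invertible_ker)
  then obtain B where "B ** T = mat 1" ..
  then have BT: "T ** B = mat 1" by (simp add: matrix_left_right_inverse)
  \<comment> \<open>The dual basis for this pairing, from the inverse of the Gram matrix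
    \<open>T\<close>; the factor \<Delta> below clears its denominators.\<close>
  define b' where "b' i = (\<Sum>j\<in>UNIV. of_rat (B $ j $ i) * \<omega> j)" for i
  have \<theta>b': "\<theta> (b' i * \<omega> k) = (if k = i then 1 else 0)" for i k
  proof -
    have "\<theta> (b' i * \<omega> k) = (\<Sum>j\<in>UNIV. T $ k $ j * B $ j $ i)"
    proof -
      have "b' i * \<omega> k = (\<Sum>j\<in>UNIV. of_rat (B $ j $ i) * (\<omega> j * \<omega> k))"
        by (simp add: b'_def sum_distrib_right mult.assoc)
      then have "\<theta> (b' i * \<omega> k) = (\<Sum>j\<in>UNIV. B $ j $ i * \<theta> (\<omega> j * \<omega> k))"
        by (simp only: \<theta>_def rc_sum_dist rc_scale)
      then show ?thesis by (simp add: T_def mult.commute)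
    qed
    also have "\<dots> = (T ** B) $ k $ i" by (simp add: matrix_matrix_mult_def)
    finally show ?thesis by (simp add: BT mat_def)
  qed
  have "\<exists>d. \<forall>i. d i > 0 \<and> of_int (d i) * b' i \<in> OK"
    by (intro choice allI ex_int_multiple_OK)
  then obtain d where d: "\<And>i. d i > 0" "\<And>i. of_int (d i) * b' i \<in> OK" by blast
  define \<Delta> where "\<Delta> = (\<Prod>i\<in>UNIV. d i)"
  have \<Delta>: "\<Delta> > 0" unfolding \<Delta>_def using d by (intro prod_pos) auto
  have ofint: "of_int m \<in> OK" for m
    by (simp add: ring_of_integers_def int_imp_algebraic_int)
  define b where "b i = of_int \<Delta> * b' i" for i
  have bO: "b i \<in> OK" for i
  proof -
    have "\<Delta> = (\<Prod>j\<in>UNIV - {i}. d j) * d i"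
      unfolding \<Delta>_def by (subst prod.remove[of _ i]) (auto simp: mult.commute)
    then have "b i = of_int (\<Prod>j\<in>UNIV - {i}. d j) * (of_int (d i) * b' i)"
      by (simp add: b_def mult.assoc)
    then show ?thesis using mult_mem_OK[OF ofint d(2)] by metis
  qed
  \<comment> \<open>\<open>\<beta> s\<close> represents, through \<theta>, the functional on
    coordinates with coefficients \<Delta> s. Transposed matrices therefore act on these elements as
    multiplication.\<close>
  define \<beta> where "\<beta> s = (\<Sum>i\<in>UNIV. of_int (s $ i) * b i)" for s :: "int ^ 'n"
  have \<beta>O: "\<beta> s \<in> OK" for s
  proof -
    have "(\<Sum>i\<in>A. of_int (s $ i) * b i) \<in> OK" if "finite A" for A
      using that
    proof induction
      case empty
      then show ?case using ofint[of 0] by simp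
    next
      case (insert x F)
      then show ?case using add_mem mult_mem_OK[OF ofint bO] by simp
    qed
    then show ?thesis by (simp add: \<beta>_def)
  qed
  have \<theta>\<beta>: "\<theta> (\<beta> s * x) = of_int \<Delta> * (\<Sum>i\<in>UNIV. of_int (s $ i) * rc x i)" for s x
  proof -
    have bi: "\<theta> (b' i * x) = rc x i" for i
      unfolding \<theta>_mult[of "b' i" x] \<theta>b' by (simp add: if_distrib cong: if_cong)
    have "\<beta> s * x = (\<Sum>i\<in>UNIV. of_int (s $ i * \<Delta>) * (b' i * x))"
      by (simp add: \<beta>_def b_def sum_distrib_right mult.assoc)
    then have "\<theta> (\<beta> s * x) = (\<Sum>i\<in>UNIV. of_int (s $ i * \<Delta>) * \<theta> (b' i * x))"
      by (simp only: \<theta>_def rc_sum_dist rc_scale_int)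
    then show ?thesis unfolding bi by (simp add: sum_distrib_left mult_ac)
  qed
  have \<theta>\<beta>k: "\<theta> (\<beta> s * \<omega> k) = of_int (\<Delta> * s $ k)" for s k
    unfolding \<theta>\<beta> rc_basis by (simp add: if_distrib cong: if_cong)
  have nz: "\<beta> s \<noteq> 0" if "s \<noteq> 0" for s
  proof
    assume "\<beta> s = 0"
    then have "s $ k = 0" for k using \<theta>\<beta>k[of s k] \<Delta> by (simp add: \<theta>_def)
    then show False using that by (simp add: vec_eq_iff)
  qed
  define C where "C = 1 + (\<Sum>i\<in>UNIV. infnorm (coords \<omega> (b i)))"
  have bound: "infnorm (coords \<omega> (\<beta> s)) \<le> C * infnorm (real_vec s)" for s
    unfolding infnorm_le_iff
  proof
    fix l
    have "coords \<omega> (\<beta> s) $ l = (\<Sum>i\<in>UNIV. real_of_int (s $ i) * coords \<omega> (b i) $ l)"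
      unfolding coords_nth \<beta>_def rc_sum_dist rc_scale_int by (simp add: of_rat_sum of_rat_mult)
    then have "\<bar>coords \<omega> (\<beta> s) $ l\<bar> \<le> (\<Sum>i\<in>UNIV. \<bar>real_vec s $ i\<bar> * \<bar>coords \<omega> (b i) $ l\<bar>)"
      by (metis (no_types, lifting) abs_mult real_vec_nth sum.cong sum_abs)
    also have "\<dots> \<le> (\<Sum>i\<in>UNIV. infnorm (real_vec s) * infnorm (coords \<omega> (b i)))"
      by (intro sum_mono mult_mono component_le_infnorm_cart infnorm_pos_le abs_ge_zero)
    also have "\<dots> = infnorm (real_vec s) * (\<Sum>i\<in>UNIV. infnorm (coords \<omega> (b i)))"
      by (simp add: sum_distrib_left)
    also have "\<dots> \<le> C * infnorm (real_vec s)"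
      unfolding C_def using infnorm_pos_le[of "real_vec s"] by (simp add: algebra_simps)
    finally show "\<bar>coords \<omega> (\<beta> s) $ l\<bar> \<le> C * infnorm (real_vec s)" .
  qed
  have "C \<ge> 1" by (simp add: C_def sum_nonneg infnorm_pos_le)
  moreover have "\<beta> s = q * \<beta> t" if st: "real_vec s = transpose (mm q) *v real_vec t" for q s t
  proof -
    have "\<theta> ((\<beta> s - q * \<beta> t) * \<omega> k) = 0" for k
    proof -
      have "real_of_int (s $ k) = (\<Sum>i\<in>UNIV. mm q $ i $ k * real_of_int (t $ i))"
        using arg_cong[OF st, of "\<lambda>v. v $ k"] by (simp add: matrix_vector_mult_def transpose_def)
      also have "\<dots> = real_of_rat (\<Sum>i\<in>UNIV. of_int (t $ i) * rc (q * \<omega> k) i)"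
        by (simp add: mm_def coords_nth of_rat_sum of_rat_mult mult.commute)
      finally have e: "of_int (s $ k) = (\<Sum>i\<in>UNIV. of_int (t $ i) * rc (q * \<omega> k) i)"
        by (metis of_rat_eq_iff of_rat_of_int_eq)
      have "(\<beta> s - q * \<beta> t) * \<omega> k = \<beta> s * \<omega> k - \<beta> t * (q * \<omega> k)" by (simp add: algebra_simps)
      then have "\<theta> ((\<beta> s - q * \<beta> t) * \<omega> k) = \<theta> (\<beta> s * \<omega> k) - \<theta> (\<beta> t * (q * \<omega> k))"
        by (simp only: \<theta>_def rc_diff)
      also have "\<dots> = 0" unfolding \<theta>\<beta>k \<theta>\<beta>[of t] by (simp add: e)
      finally show ?thesis .
    qed
    then have "\<beta> s - q * \<beta> t = 0" by (rule nondeg)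
    then show ?thesis by simp
  qed
  ultimately show thesis using dual[OF _ \<beta>O nz bound] by blast
qed

text \<open>Chosen so that Y! times a point of \<open>box h\<close> changes each matrix entry of the
  scalar \<open>kappa Y h\<close> by at most a fraction 1 / (2 n).\<close>

definition slope :: nat where
  "slope = nat \<lceil>2 * real CARD('n) * struct_bound\<rceil>"

definition kappa :: "nat \<Rightarrow> nat \<Rightarrow> nat" where
  "kappa Y h = 1 + fact Y * (slope * h)"

definition box :: "nat \<Rightarrow> (int ^ 'n) set" where
  "box h = {u. \<forall>i. u $ i \<in> {0..<int h}}"

text \<open>All denominators are \<open>1\<close> modulo \<open>Y!\<close>, so they have no small prime factors, and all are close
  to the integer \<open>kappa Y h\<close>, so only boundedly many of them are associated.\<close>

definition denom :: "nat \<Rightarrow> nat \<Rightarrow> int ^ 'n \<Rightarrow> 'k" where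
  "denom Y h u = of_nat (kappa Y h) + of_nat (fact Y) * of_coords \<omega> u"

lemma slope_ge: "2 * real CARD('n) * struct_bound \<le> real slope" and slope_pos: "slope > 0"
proof -
  have "0 < 2 * real CARD('n) * struct_bound" using struct_bound_ge_1 by simp
  then show "2 * real CARD('n) * struct_bound \<le> real slope" "slope > 0"
    unfolding slope_def by linarith+
qed

lemma finite_box: "finite (box h)" and card_box: "card (box h) = h ^ CARD('n)"
  using card_int_box[of "{0..<int h}", where 'n = 'n] by (auto simp: box_def)

lemma mm_of_nat_add: "mm (of_nat m + x) $ i $ j = (if i = j then real m else 0) + mm x $ i $ j"
  using rc_scale_int[of "int m" "\<omega> j" i] by (simp add: mm_def coords_nth distrib_right rc_add rc_basis of_rat_add)

lemma denom_dev:
  assumes u: "u \<in> box h"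
  shows "\<bar>mm (denom Y h u) $ i $ j - (if i = j then real (kappa Y h) else 0)\<bar> \<le> real (kappa Y h) / (2 * real CARD('n))"
proof -
  have f: "real_of_rat (fact Y) = fact Y" by (metis of_nat_fact of_rat_of_nat_eq)
  have 1: "mm (denom Y h u) $ i $ j - (if i = j then real (kappa Y h) else 0) = real (fact Y) * mm (of_coords \<omega> u) $ i $ j"
    using rc_scale_int[of "int (fact Y)" "of_coords \<omega> u * \<omega> j" i]
    by (simp add: denom_def mm_of_nat_add) (simp add: mm_def coords_nth of_rat_mult mult.assoc f)
  have "infnorm (coords \<omega> (of_coords \<omega> u)) \<le> real h"
    unfolding infnorm_le_iff coords_of_coords
  proof
    fix l
    have "0 \<le> u $ l \<and> u $ l < int h" using u by (simp add: box_def)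
    then show "\<bar>real_vec u $ l\<bar> \<le> real h" by simp
  qed
  then have "\<bar>mm (of_coords \<omega> u) $ i $ j\<bar> \<le> struct_bound * real h"
    using mm_bound[of "of_coords \<omega> u" i j] struct_bound_ge_1
    by (meson mult_left_mono order_trans zero_le_one)
  also have "\<dots> \<le> real slope / (2 * real CARD('n)) * real h"
    using slope_ge by (intro mult_right_mono) (auto simp: field_simps)
  finally have "real (fact Y) * \<bar>mm (of_coords \<omega> u) $ i $ j\<bar> \<le> real (fact Y) * (real slope / (2 * real CARD('n)) * real h)"
    by (intro mult_left_mono) auto
  also have "\<dots> \<le> real (kappa Y h) / (2 * real CARD('n))"
    by (simp add: kappa_def field_simps)
  finally show ?thesis unfolding 1 by (simp add: abs_mult)
qed

end

text \<open>The deviation from the scalar matrix has row sums at most \<kappa> / 2. Hence all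
  denominators, and their transposes, stretch the max-norm by comparable factors, whatever h and Y
  are.\<close>

lemma near_scalar_matrix_bounds:
  fixes A :: "real ^ 'n::finite ^ 'n"
  assumes "\<And>i j. \<bar>A $ i $ j - (if i = j then \<kappa> else 0)\<bar> \<le> \<kappa> / (2 * real CARD('n))"
  shows "\<kappa> / 2 * infnorm v \<le> infnorm (A *v v)" "infnorm (A *v v) \<le> 3 * \<kappa> / 2 * infnorm v"
proof -
  have dev: "infnorm (A *v v - \<kappa> *\<^sub>R v) \<le> \<kappa> / 2 * infnorm v"
    unfolding infnorm_le_iff
  proof
    fix i
    have "(A *v v - \<kappa> *\<^sub>R v) $ i = (\<Sum>j\<in>UNIV. (A $ i $ j - (if i = j then \<kappa> else 0)) * v $ j)"
      by (simp add: matrix_vector_mult_def left_diff_distrib sum_subtractf if_distrib[of "\<lambda>x. x * _"] cong: if_cong)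
    then have "\<bar>(A *v v - \<kappa> *\<^sub>R v) $ i\<bar> \<le> (\<Sum>j\<in>UNIV. \<bar>(A $ i $ j - (if i = j then \<kappa> else 0)) * v $ j\<bar>)"
      by simp
    also have "\<dots> \<le> (\<Sum>j\<in>(UNIV::'n set). \<kappa> / (2 * real CARD('n)) * infnorm v)"
    proof (rule sum_mono)
      fix j
      have "0 \<le> \<kappa> / (2 * real CARD('n))" using assms[of i j] by linarith
      then show "\<bar>(A $ i $ j - (if i = j then \<kappa> else 0)) * v $ j\<bar> \<le> \<kappa> / (2 * real CARD('n)) * infnorm v"
        unfolding abs_mult by (intro mult_mono assms component_le_infnorm_cart) auto
    qed
    also have "\<dots> = \<kappa> / 2 * infnorm v" by simp
    finally show "\<bar>(A *v v - \<kappa> *\<^sub>R v) $ i\<bar> \<le> \<kappa> / 2 * infnorm v" .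
  qed
  have "0 \<le> \<kappa> / (2 * real CARD('n))" using assms[of undefined undefined] by linarith
  then have \<kappa>: "0 \<le> \<kappa>" by (simp add: field_simps zero_le_mult_iff)
  have "\<bar>infnorm (A *v v) - infnorm (\<kappa> *\<^sub>R v)\<bar> \<le> \<kappa> / 2 * infnorm v"
    using absdiff_infnorm dev order_trans by blast
  then show "\<kappa> / 2 * infnorm v \<le> infnorm (A *v v)" "infnorm (A *v v) \<le> 3 * \<kappa> / 2 * infnorm v"
    using \<kappa> unfolding infnorm_mul abs_le_iff by (simp_all add: algebra_simps)
qed

context number_basis
begin

lemma denom_bounds:
  assumes "u \<in> box h"
  shows "real (kappa Y h) / 2 * infnorm v \<le> infnorm (mm (denom Y h u) *v v)"
    "infnorm (mm (denom Y h u) *v v) \<le> 3 * real (kappa Y h) / 2 * infnorm v"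
    "real (kappa Y h) / 2 * infnorm v \<le> infnorm (transpose (mm (denom Y h u)) *v v)"
proof -
  show "real (kappa Y h) / 2 * infnorm v \<le> infnorm (mm (denom Y h u) *v v)"
    "infnorm (mm (denom Y h u) *v v) \<le> 3 * real (kappa Y h) / 2 * infnorm v"
    using near_scalar_matrix_bounds[OF denom_dev[OF assms], of Y v] by auto
  have "\<bar>transpose (mm (denom Y h u)) $ i $ j - (if i = j then real (kappa Y h) else 0)\<bar> \<le> real (kappa Y h) / (2 * real CARD('n))" for i j
    using denom_dev[OF assms, of Y j i] by (simp add: transpose_def eq_commute[of i j])
  from near_scalar_matrix_bounds(1)[OF this]
  show "real (kappa Y h) / 2 * infnorm v \<le> infnorm (transpose (mm (denom Y h u)) *v v)" .
qed

lemma denom_mem_OK: "denom Y h u \<in> OK"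
  unfolding denom_def by (intro add_mem mult_mem of_nat_mem of_coords_mem_OK)

lemma kappa_pos: "kappa Y h > 0"
  by (simp add: kappa_def)

lemma coords_one_pos: "infnorm (coords \<omega> 1) > 0"
  by (simp add: infnorm_pos_lt coords_eq_0_iff)

lemma denom_coords:
  assumes "u \<in> box h"
  shows "real (kappa Y h) / 2 * infnorm (coords \<omega> 1) \<le> infnorm (coords \<omega> (denom Y h u))"
    "infnorm (coords \<omega> (denom Y h u)) \<le> 3 * real (kappa Y h) / 2 * infnorm (coords \<omega> 1)"
    "denom Y h u \<noteq> 0"
proof -
  show 1: "real (kappa Y h) / 2 * infnorm (coords \<omega> 1) \<le> infnorm (coords \<omega> (denom Y h u))"
    and "infnorm (coords \<omega> (denom Y h u)) \<le> 3 * real (kappa Y h) / 2 * infnorm (coords \<omega> 1)"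
    using denom_bounds(1,2)[OF assms, of Y "coords \<omega> 1"] coords_mult[of "denom Y h u" 1] by auto
  have "0 < real (kappa Y h) / 2 * infnorm (coords \<omega> 1)"
    using kappa_pos coords_one_pos by simp
  then have "infnorm (coords \<omega> (denom Y h u)) > 0" using 1 by linarith
  then show "denom Y h u \<noteq> 0" by (simp add: infnorm_pos_lt coords_eq_0_iff)
qed

lemma inj_denom: "inj (denom Y h)"
proof (rule injI)
  fix u v assume "denom Y h u = denom Y h v"
  then have "of_coords \<omega> u = of_coords \<omega> v" by (simp add: denom_def)
  then have "real_vec u = real_vec v" using coords_of_coords by metis
  then show "u = v" by simp
qed

text \<open>Every denominator counted divides \<open>\<beta> s\<close>, so at most
  \<open>2 ^ j\<close> ideals occur. Two denominators q = q' z generating the same ideal have sizes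
  within a factor 3, which confines the integer z to a fixed finite set; thus c depends on neither Y
  nor h.\<close>

lemma ex_dual_count:
  "\<exists>C\<ge>1. \<exists>c::nat. c > 0 \<and> (\<forall>Y h j s. s \<noteq> 0 \<longrightarrow> (C * infnorm (real_vec s)) ^ CARD('n) < real (Y + 1) ^ j \<longrightarrow>
     card {u \<in> box h. \<exists>t. real_vec s = transpose (mm (denom Y h u)) *v real_vec t} \<le> c * 2 ^ j)"
proof -
  obtain C0 and \<beta> :: "int ^ 'n \<Rightarrow> 'k" where \<beta>: "C0 \<ge> 1" "\<And>s. \<beta> s \<in> OK" "\<And>s. s \<noteq> 0 \<Longrightarrow> \<beta> s \<noteq> 0"
    "\<And>s. infnorm (coords \<omega> (\<beta> s)) \<le> C0 * infnorm (real_vec s)"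
    "\<And>q s t. real_vec s = transpose (mm q) *v real_vec t \<Longrightarrow> \<beta> s = q * \<beta> t"
  proof (rule ex_dual_embedding)
    fix C \<beta>
    assume "1 \<le> C" "\<And>s. \<beta> s \<in> OK" "\<And>s. s \<noteq> 0 \<Longrightarrow> \<beta> s \<noteq> 0"
      "\<And>s. infnorm (coords \<omega> (\<beta> s)) \<le> C * infnorm (real_vec s)"
      "\<And>q s t. real_vec s = transpose (mm q) *v real_vec t \<Longrightarrow> \<beta> s = q * \<beta> t"
    then show thesis by (rule that)
  qed
  \<comment> \<open>Makes C |s| dominate \<open>2 * res_bound (\<beta> s) + 1\<close>; the final 1
    is absorbed through |s| \<ge> 1.\<close>
  define C where "C = 2 * real CARD('n) * struct_bound * C0 + 1"
  have pos: "0 \<le> 2 * real CARD('n) * struct_bound" using struct_bound_ge_1 by simp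
  have C1: "C \<ge> 1" unfolding C_def using pos \<beta>(1) by (simp add: zero_le_mult_iff)
  define U where "U = OK_ball (nat \<lfloor>3 * infnorm (coords \<omega> 1)\<rfloor>)"
  have U: "finite U" unfolding U_def by (rule OK_ball)
  have key: "card {u \<in> box h. \<exists>t. real_vec s = transpose (mm (denom Y h u)) *v real_vec t} \<le> (card U + 1) * 2 ^ j"
    if s: "s \<noteq> 0" and j: "(C * infnorm (real_vec s)) ^ CARD('n) < real (Y + 1) ^ j" for Y h j s
  proof -
    let ?a = "\<beta> s"
    define F where "F = {u \<in> box h. \<exists>t. real_vec s = transpose (mm (denom Y h u)) *v real_vec t}"
    define Q where "Q = denom Y h ` F"
    have finF: "finite F" using finite_box by (simp add: F_def)
    have cardQ: "card Q = card F" unfolding Q_def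
      by (intro card_image inj_on_subset[OF inj_denom]) auto
    have s1: "infnorm (real_vec s) \<ge> 1"
    proof -
      obtain i where "s $ i \<noteq> 0" using s by (auto simp: vec_eq_iff)
      then have "1 \<le> \<bar>real_vec s $ i\<bar>" by simp
      then show ?thesis using component_le_infnorm_cart[of "real_vec s" i] by linarith
    qed
    have "real ((2 * res_bound ?a + 1) ^ CARD('n)) \<le> (C * infnorm (real_vec s)) ^ CARD('n)"
    proof -
      have "real (res_bound ?a) \<le> real CARD('n) * struct_bound * infnorm (coords \<omega> ?a)"
        unfolding res_bound_def using struct_bound_ge_1 by (intro of_nat_floor mult_nonneg_nonneg infnorm_pos_le) auto
      also have "\<dots> \<le> real CARD('n) * struct_bound * (C0 * infnorm (real_vec s))"
        using pos by (intro mult_left_mono \<beta>(4)) (simp add: mult.commute)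
      finally have "2 * real (res_bound ?a) + 1 \<le> C * infnorm (real_vec s)"
        using s1 by (simp add: C_def algebra_simps)
      then have "(2 * real (res_bound ?a) + 1) ^ CARD('n) \<le> (C * infnorm (real_vec s)) ^ CARD('n)"
        by (intro power_mono) auto
      then show ?thesis by (simp add: add.commute)
    qed
    then have "real ((2 * res_bound ?a + 1) ^ CARD('n)) < real ((Y + 1) ^ j)" using j by simp
    then have Nj: "(2 * res_bound ?a + 1) ^ CARD('n) < (Y + 1) ^ j" by (simp only: of_nat_less_iff)
    have Qp: "q \<in> OK \<and> (\<exists>w\<in>OK. q = 1 + of_nat (fact Y) * w) \<and> ?a \<in> principal q" if q: "q \<in> Q" for q
    proof -
      obtain u t where u: "u \<in> box h" "real_vec s = transpose (mm (denom Y h u)) *v real_vec t" "q = denom Y h u"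
        using q by (auto simp: Q_def F_def)
      have "q = 1 + of_nat (fact Y) * (of_nat (slope * h) + of_coords \<omega> u)"
        by (simp add: u(3) denom_def kappa_def algebra_simps)
      moreover have "of_nat (slope * h) + of_coords \<omega> u \<in> OK"
        by (intro add_mem of_nat_mem of_coords_mem_OK)
      moreover have "?a \<in> principal q"
        unfolding principal_def u(3) using \<beta>(5)[OF u(2)] \<beta>(2)[of t] by (rule image_eqI[where x = "\<beta> t"])
      moreover have "q \<in> OK" unfolding u(3) by (rule denom_mem_OK)
      ultimately show ?thesis by blast
    qed
    have ideals: "finite (principal ` Q) \<and> card (principal ` Q) \<le> 2 ^ j"
      using card_divisor_ideals[OF \<beta>(2) \<beta>(3)[OF s] Nj Qp] by blast
    have fibre: "card {q \<in> Q. principal q = I} \<le> card U" for I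
    proof (cases "{q \<in> Q. principal q = I} = {}")
      case True
      show ?thesis unfolding True by simp
    next
      case False
      then obtain q' where q': "q' \<in> Q" "principal q' = I" by blast
      have "{q \<in> Q. principal q = I} \<subseteq> (\<lambda>z. q' * z) ` U"
      proof
        fix q assume "q \<in> {q \<in> Q. principal q = I}"
        then have q: "q \<in> Q" "principal q = principal q'" using q' by auto
        have "q \<in> principal q'" using self_mem_principal[of q] q by simp
        then obtain z where z: "z \<in> OK" "q = q' * z" by (auto simp: principal_def)
        obtain u u' where u: "u \<in> box h" "q = denom Y h u" "u' \<in> box h" "q' = denom Y h u'"
          using q q' by (auto simp: Q_def F_def)
        have "real (kappa Y h) / 2 * infnorm (coords \<omega> z) \<le> infnorm (coords \<omega> q)"
          unfolding z(2) coords_mult u(4) by (rule denom_bounds(1)[OF u(3)])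
        also have "\<dots> \<le> 3 * real (kappa Y h) / 2 * infnorm (coords \<omega> 1)"
          unfolding u(2) by (rule denom_coords(2)[OF u(1)])
        finally have "infnorm (coords \<omega> z) \<le> 3 * infnorm (coords \<omega> 1)"
          using kappa_pos[of Y h] by simp
        then have "z \<in> U" unfolding U_def infnorm_le_iff
          by (intro mem_OK_ballI[OF z(1)]) auto
        then show "q \<in> (\<lambda>z. q' * z) ` U" using z(2) by blast
      qed
      then have "card {q \<in> Q. principal q = I} \<le> card ((\<lambda>z. q' * z) ` U)"
        using U by (intro card_mono) auto
      also have "\<dots> \<le> card U" by (rule card_image_le[OF U])
      finally show ?thesis .
    qed
    have finQ: "finite Q" using finF by (simp add: Q_def)
    have "card Q = (\<Sum>I\<in>principal ` Q. card {q \<in> Q. principal q = I})"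
      using sum.image_gen[OF finQ, of "\<lambda>_. 1::nat" principal] by simp
    also have "\<dots> \<le> (\<Sum>I\<in>principal ` Q. card U)" by (intro sum_mono fibre)
    also have "\<dots> = card (principal ` Q) * card U" by simp
    also have "\<dots> \<le> 2 ^ j * (card U + 1)" using ideals by (intro mult_mono) auto
    finally show ?thesis using cardQ by (simp add: F_def mult.commute)
  qed
  show ?thesis
    by (intro exI[of _ C] conjI C1 exI[of _ "card U + 1"] allI impI key) auto
qed

end

section \<open>Fourier analysis\<close>

definition ee :: "real \<Rightarrow> complex" where
  "ee x = cis (2 * pi * x)"

lemma ee_add: "ee (x + y) = ee x * ee y"
  by (simp add: ee_def cis_mult distrib_left)

lemma norm_ee [simp]: "norm (ee x) = 1"
  by (simp add: ee_def)

lemma ee_0 [simp]: "ee 0 = 1"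
  by (simp add: ee_def)

lemma cnj_ee: "cnj (ee x) = ee (- x)"
  by (simp add: ee_def cis_cnj)

lemma ee_of_int [simp]: "ee (of_int k) = 1"
  by (simp add: ee_def cis_multiple_2pi)

lemma ee_sum: "ee (\<Sum>i\<in>A. f i) = (\<Prod>i\<in>A. ee (f i))"
  by (induction A rule: infinite_finite_induct) (auto simp: ee_add)

lemma ee_power: "ee x ^ k = ee (real k * x)"
  unfolding ee_def Complex.DeMoivre by (simp add: mult_ac)

lemma ee_frac: "ee (frac x) = ee x"
proof -
  have "ee x = ee (frac x + of_int \<lfloor>x\<rfloor>)" by (simp add: frac_def)
  then show ?thesis unfolding ee_add ee_of_int by simp
qed

lemma ee_eq_1_iff: "ee x = 1 \<longleftrightarrow> x \<in> \<int>"
proof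
  assume "ee x = 1"
  then have "cos (2 * pi * x) = 1" unfolding ee_def by (metis cis.simps(1) one_complex.simps(1))
  then obtain k :: int where "2 * pi * x = of_int k * 2 * pi" using cos_one_2pi_int by auto
  then have "x = of_int k" by simp
  then show "x \<in> \<int>" by simp
qed (auto elim: Ints_cases)

lemma norm_ee_minus_1_le: "norm (ee x - 1) \<le> 2 * pi * \<bar>x\<bar>"
proof -
  have "norm (exp (\<i> * complex_of_real (2 * pi * x)) - 1) \<le> \<bar>2 * pi * x\<bar>"
    using iexp_approx1[of "2 * pi * x" 0] by simp
  then show ?thesis by (simp add: ee_def cis_conv_exp abs_mult)
qed

definition fejer :: "nat \<Rightarrow> real \<Rightarrow> real" where
  "fejer L x = (norm (\<Sum>j<L. ee (real j * x)))\<^sup>2 / real L"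

lemma fejer_nonneg: "fejer L x \<ge> 0"
  by (simp add: fejer_def)

lemma of_real_fejer:
  "complex_of_real (fejer L x) = (\<Sum>j<L. \<Sum>k<L. ee ((real j - real k) * x)) / of_nat L"
proof -
  have "complex_of_real ((norm (\<Sum>j<L. ee (real j * x)))\<^sup>2) = (\<Sum>j<L. ee (real j * x)) * cnj (\<Sum>j<L. ee (real j * x))"
    by (rule complex_norm_square)
  also have "\<dots> = (\<Sum>j<L. \<Sum>k<L. ee (real j * x) * ee (- (real k * x)))"
    by (simp add: cnj_ee sum_product)
  also have "\<dots> = (\<Sum>j<L. \<Sum>k<L. ee ((real j - real k) * x))"
    by (simp add: ee_add[symmetric] algebra_simps)
  finally show ?thesis by (simp add: fejer_def)
qed

text \<open>Orthogonality of the characters of Z / L. As |j - k| < L, only j = k is divisible by L,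
  so the L samples average the Fejer kernel exactly as an integral would.\<close>

lemma sum_roots_of_unity:
  assumes "j < L" "k < L"
  shows "(\<Sum>l<L. ee ((real j - real k) * (y - real l / real L))) = (if j = k then of_nat L else 0)"
proof (cases "j = k")
  case False
  define \<zeta> where "\<zeta> = ee (- ((real j - real k) / real L))"
  have L: "L > 0" using assms by simp
  have "(\<Sum>l<L. ee ((real j - real k) * (y - real l / real L))) = ee ((real j - real k) * y) * (\<Sum>l<L. \<zeta> ^ l)"
    unfolding sum_distrib_left \<zeta>_def ee_power ee_add[symmetric]
    by (intro sum.cong arg_cong[where f = ee]) (auto simp: algebra_simps)
  also have "(\<Sum>l<L. \<zeta> ^ l) = 0"
  proof -
    have "\<zeta> \<noteq> 1"
    proof
      assume "\<zeta> = 1"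
      then have "- ((real j - real k) / real L) \<in> \<int>" by (simp add: \<zeta>_def ee_eq_1_iff del: minus_divide_left)
      then obtain m :: int where "- ((real j - real k) / real L) = of_int m" by (elim Ints_cases)
      then have "real_of_int (int k - int j) = real_of_int (m * int L)" using L by (simp add: field_simps)
      then have m: "int k - int j = m * int L" by (simp only: of_int_eq_iff)
      have "m \<noteq> 0" using m False by auto
      then have "int L \<le> \<bar>m * int L\<bar>" using L by (simp add: abs_mult)
      then show False using m assms by linarith
    qed
    moreover have "\<zeta> ^ L = 1"
    proof -
      have "real L * - ((real j - real k) / real L) = of_int (int k - int j)" using L by simp
      then show ?thesis unfolding \<zeta>_def ee_power by (simp only: ee_of_int)
    qed
    ultimately show ?thesis by (simp add: geometric_sum)
  qed
  finally show ?thesis using False by simp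
qed simp

lemma fejer_average:
  assumes "L > 0"
  shows "(\<Sum>l<L. fejer L (y - real l / real L)) = real L"
proof -
  have "complex_of_real (\<Sum>l<L. fejer L (y - real l / real L))
      = (\<Sum>l<L. (\<Sum>j<L. \<Sum>k<L. ee ((real j - real k) * (y - real l / real L))) / of_nat L)"
    by (simp add: of_real_fejer)
  also have "\<dots> = (\<Sum>l<L. \<Sum>j<L. \<Sum>k<L. ee ((real j - real k) * (y - real l / real L))) / of_nat L"
    by (simp only: sum_divide_distrib)
  also have "(\<Sum>l<L. \<Sum>j<L. \<Sum>k<L. ee ((real j - real k) * (y - real l / real L)))
      = (\<Sum>j<L. \<Sum>k<L. \<Sum>l<L. ee ((real j - real k) * (y - real l / real L)))"
    by (subst sum.swap, rule sum.cong[OF refl], subst sum.swap, rule refl)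
  also have "\<dots> = (\<Sum>j<L. \<Sum>k<L. if j = k then of_nat L else 0)"
    by (intro sum.cong refl sum_roots_of_unity) auto
  also have "\<dots> = of_nat L * of_nat L" by simp
  finally have "complex_of_real (\<Sum>l<L. fejer L (y - real l / real L)) = complex_of_real (real L)"
    using assms by simp
  then show ?thesis by (simp only: of_real_eq_iff)
qed

lemma fejer_bound:
  assumes "norm (ee x - 1) \<ge> \<delta>" "\<delta> > 0" "L > 0"
  shows "fejer L x \<le> 4 / (real L * \<delta>\<^sup>2)"
proof -
  have ne: "ee x \<noteq> 1" using assms by auto
  have "(\<Sum>j<L. ee (real j * x)) = (ee x ^ L - 1) / (ee x - 1)"
    unfolding ee_power[symmetric] by (rule geometric_sum[OF ne])
  then have "norm (\<Sum>j<L. ee (real j * x)) = norm (ee x ^ L - 1) / norm (ee x - 1)"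
    by (simp add: norm_divide)
  also have "\<dots> \<le> 2 / \<delta>"
  proof (rule frac_le)
    have "norm (ee x ^ L - 1) \<le> norm (ee x ^ L) + norm (1 :: complex)" by (rule norm_triangle_ineq4)
    then show "norm (ee x ^ L - 1) \<le> 2" by (simp add: norm_power)
  qed (use assms in auto)
  finally have "(norm (\<Sum>j<L. ee (real j * x)))\<^sup>2 \<le> (2 / \<delta>)\<^sup>2" by (intro power_mono) auto
  then have "fejer L x \<le> (2 / \<delta>)\<^sup>2 / real L" unfolding fejer_def by (intro divide_right_mono) auto
  then show ?thesis by (simp add: power_divide mult.commute)
qed

text \<open>Sampled Fejer means, so that no integrals are needed.\<close>

definition fejer_mean :: "nat \<Rightarrow> (real \<Rightarrow> complex) \<Rightarrow> real \<Rightarrow> complex" where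
  "fejer_mean L G y = (\<Sum>l<L. G (real l / real L) * of_real (fejer L (y - real l / real L))) / of_nat L"

text \<open>The Fejer weight of the frequency t times the discrete Fourier coefficient of the
  samples of G.\<close>

definition fejer_coeff :: "nat \<Rightarrow> (real \<Rightarrow> complex) \<Rightarrow> int \<Rightarrow> complex" where
  "fejer_coeff L G t = of_real (1 - \<bar>real_of_int t\<bar> / real L) *
     ((\<Sum>l<L. G (real l / real L) * ee (- (real_of_int t * (real l / real L)))) / of_nat L)"

lemma sum_pairs_diff:
  fixes f :: "int \<Rightarrow> complex"
  assumes "L > 0"
  shows "(\<Sum>j<L. \<Sum>k<L. f (int j - int k)) = (\<Sum>t\<in>{- int L<..<int L}. of_real (real L - \<bar>real_of_int t\<bar>) * f t)"
proof -
  let ?S = "{..<L} \<times> {..<L}"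
  let ?d = "\<lambda>(j, k). int j - int k"
  have cardt: "card {p \<in> ?S. ?d p = t} = nat (int L - \<bar>t\<bar>)" if t: "t \<in> {- int L<..<int L}" for t
  proof -
    define m where "m = nat (int L - \<bar>t\<bar>)"
    have "bij_betw (\<lambda>i. (i + nat t, i + nat (- t))) {..<m} {p \<in> ?S. ?d p = t}"
    proof (rule bij_betwI[where g = "\<lambda>(j, k). min j k"])
      show "(\<lambda>i. (i + nat t, i + nat (- t))) \<in> {..<m} \<rightarrow> {p \<in> ?S. ?d p = t}"
        using t by (auto simp: m_def)
      show "(\<lambda>(j, k). min j k) \<in> {p \<in> ?S. ?d p = t} \<rightarrow> {..<m}"
        using t by (auto simp: m_def min_def)
    qed (auto simp: min_def)
    then show ?thesis using bij_betw_same_card by (fastforce simp: m_def)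
  qed
  have "(\<Sum>j<L. \<Sum>k<L. f (int j - int k)) = (\<Sum>p\<in>?S. f (?d p))"
    by (simp add: sum.cartesian_product case_prod_unfold)
  also have "\<dots> = (\<Sum>t\<in>{- int L<..<int L}. \<Sum>p\<in>{p \<in> ?S. ?d p = t}. f (?d p))"
    by (rule sum.group[symmetric]) auto
  also have "\<dots> = (\<Sum>t\<in>{- int L<..<int L}. of_nat (card {p \<in> ?S. ?d p = t}) * f t)"
    by (intro sum.cong) auto
  also have "\<dots> = (\<Sum>t\<in>{- int L<..<int L}. of_real (real L - \<bar>real_of_int t\<bar>) * f t)"
  proof (intro sum.cong refl arg_cong2[where f = "(*)"])
    fix t assume t: "t \<in> {- int L<..<int L}"
    then have "real (nat (int L - \<bar>t\<bar>)) = real L - \<bar>real_of_int t\<bar>" by (auto simp: of_nat_nat)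
    then show "(of_nat (card {p \<in> ?S. ?d p = t}) :: complex) = of_real (real L - \<bar>real_of_int t\<bar>)"
      unfolding cardt[OF t] by (metis of_real_of_nat_eq)
  qed
  finally show ?thesis .
qed

text \<open>The mean is a finite trigonometric polynomial, so that integrating it against a measure
  gives a finite combination of shifted Fourier transforms.\<close>

lemma fejer_mean_expand:
  assumes "L > 0"
  shows "fejer_mean L G y = (\<Sum>t\<in>{- int L<..<int L}. fejer_coeff L G t * ee (real_of_int t * y))"
proof -
  define c where "c t = (\<Sum>l<L. G (real l / real L) * ee (- (real_of_int t * (real l / real L)))) / of_nat L" for t
  have "fejer_mean L G y = (\<Sum>l<L. G (real l / real L) * ((\<Sum>j<L. \<Sum>k<L. ee ((real j - real k) * (y - real l / real L))) / of_nat L)) / of_nat L"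
    by (simp only: fejer_mean_def of_real_fejer)
  also have "\<dots> = (\<Sum>l<L. \<Sum>j<L. \<Sum>k<L. G (real l / real L) * ee ((real j - real k) * (y - real l / real L))) / of_nat L / of_nat L"
    by (simp only: sum_divide_distrib[symmetric] sum_distrib_left[symmetric] times_divide_eq_right)
  also have "(\<Sum>l<L. \<Sum>j<L. \<Sum>k<L. G (real l / real L) * ee ((real j - real k) * (y - real l / real L)))
     = (\<Sum>j<L. \<Sum>k<L. \<Sum>l<L. G (real l / real L) * ee ((real j - real k) * (y - real l / real L)))"
    by (subst sum.swap, rule sum.cong[OF refl], subst sum.swap, rule refl)
  also have "\<dots> = (\<Sum>j<L. \<Sum>k<L. of_nat L * (c (int j - int k) * ee (real_of_int (int j - int k) * y)))"
  proof (intro sum.cong refl)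
    fix j k
    have "G (real l / real L) * ee ((real j - real k) * (y - real l / real L)) =
        (G (real l / real L) * ee (- (real_of_int (int j - int k) * (real l / real L)))) * ee (real_of_int (int j - int k) * y)" for l
      unfolding mult.assoc ee_add[symmetric] by (simp add: algebra_simps)
    then have "(\<Sum>l<L. G (real l / real L) * ee ((real j - real k) * (y - real l / real L))) =
       (\<Sum>l<L. G (real l / real L) * ee (- (real_of_int (int j - int k) * (real l / real L)))) * ee (real_of_int (int j - int k) * y)"
      unfolding sum_distrib_right by (intro sum.cong refl)
    then show "(\<Sum>l<L. G (real l / real L) * ee ((real j - real k) * (y - real l / real L))) =
       of_nat L * (c (int j - int k) * ee (real_of_int (int j - int k) * y))"
      using assms unfolding c_def by simp
  qed
  also have "\<dots> = of_nat L * (\<Sum>j<L. \<Sum>k<L. c (int j - int k) * ee (real_of_int (int j - int k) * y))"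
    by (simp only: sum_distrib_left)
  also have "\<dots> = of_nat L * (\<Sum>t\<in>{- int L<..<int L}. of_real (real L - \<bar>real_of_int t\<bar>) * (c t * ee (real_of_int t * y)))"
    using sum_pairs_diff[OF assms, of "\<lambda>t. c t * ee (real_of_int t * y)"] by simp
  also have "\<dots> / of_nat L / of_nat L = (\<Sum>t\<in>{- int L<..<int L}. of_real (real L - \<bar>real_of_int t\<bar>) * (c t * ee (real_of_int t * y)) / of_nat L)"
    using assms by (simp add: sum_divide_distrib)
  also have "\<dots> = (\<Sum>t\<in>{- int L<..<int L}. fejer_coeff L G t * ee (real_of_int t * y))"
  proof (rule sum.cong[OF refl])
    fix t
    have "complex_of_real (real L - \<bar>real_of_int t\<bar>) / of_nat L = of_real (1 - \<bar>real_of_int t\<bar> / real L)"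
      using assms by (simp add: diff_divide_distrib)
    moreover have "fejer_coeff L G t = of_real (1 - \<bar>real_of_int t\<bar> / real L) * c t"
      by (simp only: fejer_coeff_def c_def)
    ultimately show "of_real (real L - \<bar>real_of_int t\<bar>) * (c t * ee (real_of_int t * y)) / of_nat L =
        fejer_coeff L G t * ee (real_of_int t * y)"
      by (metis mult.assoc times_divide_eq_left)
  qed
  finally show ?thesis .
qed

lemma fejer_coeff_bound:
  assumes "L > 0" "\<bar>t\<bar> \<le> int L" "\<And>x. norm (G x) \<le> 1"
  shows "norm (fejer_coeff L G t) \<le> 1"
proof -
  have "norm (\<Sum>l<L. G (real l / real L) * ee (- (real_of_int t * (real l / real L)))) \<le> (\<Sum>l<L. 1)"
    by (rule sum_norm_le) (simp add: norm_mult assms(3))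
  then have "norm ((\<Sum>l<L. G (real l / real L) * ee (- (real_of_int t * (real l / real L)))) / of_nat L) \<le> 1"
    using assms(1) by (simp add: norm_divide)
  moreover have "\<bar>1 - \<bar>real_of_int t\<bar> / real L\<bar> \<le> 1"
  proof -
    have "\<bar>real_of_int t\<bar> \<le> real L" using assms(2) by linarith
    then have "0 \<le> \<bar>real_of_int t\<bar> / real L" "\<bar>real_of_int t\<bar> / real L \<le> 1" using assms(1) by auto
    then show ?thesis by linarith
  qed
  ultimately show ?thesis unfolding fejer_coeff_def norm_mult norm_of_real
    using mult_le_one[OF _ norm_ge_zero] by blast
qed

lemma fejer_coeff_0:
  assumes "L > 0" "\<And>x. norm (G x - 1) \<le> d"
  shows "norm (fejer_coeff L G 0 - 1) \<le> d"
proof -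
  have e: "fejer_coeff L G 0 - 1 = (\<Sum>l<L. G (real l / real L) - 1) / of_nat L"
    using assms(1) by (simp add: fejer_coeff_def sum_subtractf diff_divide_distrib)
  have "norm (\<Sum>l<L. G (real l / real L) - 1) \<le> (\<Sum>l<L. d)"
    by (rule sum_norm_le) (rule assms(2))
  then show ?thesis using assms(1) unfolding e norm_divide norm_of_nat
    by (simp add: pos_divide_le_eq mult.commute)
qed

lemma norm_fejer_mean_le:
  assumes "\<And>x. norm (G x) \<le> 1" "L > 0"
  shows "norm (fejer_mean L G y) \<le> 1"
proof -
  have "norm (\<Sum>l<L. G (real l / real L) * of_real (fejer L (y - real l / real L))) \<le> (\<Sum>l<L. fejer L (y - real l / real L))"
    by (rule sum_norm_le) (auto simp: norm_mult fejer_nonneg intro!: mult_left_le_one_le assms(1))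
  also have "\<dots> = real L" by (rule fejer_average[OF assms(2)])
  finally show ?thesis using assms(2) by (simp add: fejer_mean_def norm_divide)
qed

text \<open>Samples near y on the circle contribute at most \<epsilon> / 2 times the mean 1 of the
  kernel; at the others the kernel is of order 1 / L. Continuity at the one point suffices, which is
  why jumps elsewhere are harmless.\<close>

lemma fejer_mean_tendsto:
  assumes cont: "isCont \<Phi> (ee y)" and bd: "\<And>z. norm (\<Phi> z) \<le> 1"
  shows "(\<lambda>L. fejer_mean L (\<lambda>x. \<Phi> (ee x)) y) \<longlonglongrightarrow> \<Phi> (ee y)"
proof (rule LIMSEQ_I)
  fix \<epsilon> :: real assume \<epsilon>: "\<epsilon> > 0"
  obtain \<delta> where \<delta>: "\<delta> > 0" "\<And>z. norm (z - ee y) < \<delta> \<Longrightarrow> norm (\<Phi> z - \<Phi> (ee y)) < \<epsilon> / 2"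
    using cont[unfolded continuous_at_eps_delta dist_norm] \<epsilon> by (meson half_gt_zero)
  obtain L0 :: nat where L0: "real L0 > 16 / (\<delta>\<^sup>2 * \<epsilon>)" using reals_Archimedean2 by blast
  have "norm (fejer_mean L (\<lambda>x. \<Phi> (ee x)) y - \<Phi> (ee y)) < \<epsilon>" if L: "L \<ge> L0" "L > 0" for L
  proof -
    let ?x = "\<lambda>l. real l / real L"
    have "fejer_mean L (\<lambda>x. \<Phi> (ee x)) y - \<Phi> (ee y) =
        (\<Sum>l<L. (\<Phi> (ee (?x l)) - \<Phi> (ee y)) * of_real (fejer L (y - ?x l))) / of_nat L"
    proof -
      have "(\<Sum>l<L. \<Phi> (ee y) * of_real (fejer L (y - ?x l))) = \<Phi> (ee y) * of_nat L"
        unfolding sum_distrib_left[symmetric] of_real_sum[symmetric] fejer_average[OF L(2)] by simp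
      then show ?thesis using L by (simp add: fejer_mean_def left_diff_distrib sum_subtractf diff_divide_distrib)
    qed
    also have "norm \<dots> \<le> (\<Sum>l<L. \<epsilon> / 2 * fejer L (y - ?x l) + 8 / (real L * \<delta>\<^sup>2)) / real L"
      unfolding norm_divide norm_of_nat
    proof (intro divide_right_mono sum_norm_le)
      fix l
      have d: "norm (ee (?x l) - ee y) = norm (ee (y - ?x l) - 1)"
      proof -
        have "ee y = ee (y - ?x l) * ee (?x l)" by (simp flip: ee_add)
        then have "ee (?x l) - ee y = - (ee (y - ?x l) - 1) * ee (?x l)" by (simp add: algebra_simps)
        then show ?thesis by (simp add: norm_mult norm_minus_commute)
      qed
      show "norm ((\<Phi> (ee (?x l)) - \<Phi> (ee y)) * of_real (fejer L (y - ?x l))) \<le> \<epsilon> / 2 * fejer L (y - ?x l) + 8 / (real L * \<delta>\<^sup>2)"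
      proof (cases "norm (ee (?x l) - ee y) < \<delta>")
        case True
        have "norm ((\<Phi> (ee (?x l)) - \<Phi> (ee y)) * of_real (fejer L (y - ?x l))) \<le> \<epsilon> / 2 * fejer L (y - ?x l)"
          using mult_right_mono[OF less_imp_le[OF \<delta>(2)[OF True]] fejer_nonneg[of L "y - ?x l"]]
          by (simp add: norm_mult fejer_nonneg)
        moreover have "0 \<le> 8 / (real L * \<delta>\<^sup>2)" by simp
        ultimately show ?thesis by linarith
      next
        case False
        have "norm (\<Phi> (ee (?x l)) - \<Phi> (ee y)) \<le> 2"
          using norm_triangle_ineq4[of "\<Phi> (ee (?x l))" "\<Phi> (ee y)"] bd[of "ee (?x l)"] bd[of "ee y"] by linarith
        then have "norm ((\<Phi> (ee (?x l)) - \<Phi> (ee y)) * of_real (fejer L (y - ?x l))) \<le> 2 * (4 / (real L * \<delta>\<^sup>2))"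
          using fejer_bound[of \<delta> "y - ?x l" L] False d \<delta>(1) L fejer_nonneg
          unfolding norm_mult norm_of_real by (intro mult_mono) auto
        moreover have "0 \<le> \<epsilon> / 2 * fejer L (y - ?x l)" using \<epsilon> fejer_nonneg by simp
        ultimately show ?thesis by simp
      qed
    qed simp
    also have "\<dots> = \<epsilon> / 2 + 8 / (real L * \<delta>\<^sup>2)"
      unfolding sum.distrib sum_distrib_left[symmetric] fejer_average[OF L(2)]
      using L by (simp add: add_divide_distrib)
    also have "8 / (real L * \<delta>\<^sup>2) < \<epsilon> / 2"
    proof -
      have "16 / (\<delta>\<^sup>2 * \<epsilon>) < real L" using L L0 by linarith
      then show ?thesis using \<delta>(1) \<epsilon> L by (simp add: field_simps)
    qed
    finally show ?thesis by simp
  qed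
  then show "\<exists>N. \<forall>n\<ge>N. norm (fejer_mean n (\<lambda>x. \<Phi> (ee x)) y - \<Phi> (ee y)) < \<epsilon>"
    by (intro exI[of _ "Suc L0"]) auto
qed

section \<open>The Fourier expansion of rounding\<close>

definition frac_wave :: "real \<Rightarrow> real \<Rightarrow> complex" where
  "frac_wave \<eta> x = ee (\<eta> * frac x)"

text \<open>Moves the fractional part to the circle: continuity of \<open>Arg2pi\<close> off the
  nonnegative reals becomes continuity off the integers.\<close>

lemma frac_eq_Arg2pi: "frac x = Arg2pi (ee x) / (2 * pi)"
proof -
  have "Arg2pi (ee x) = 2 * pi * frac x"
  proof (rule Arg2pi_unique[of 1])
    show "of_real 1 * exp (\<i> * complex_of_real (2 * pi * frac x)) = ee x"
      unfolding ee_frac[of x, symmetric] by (simp add: ee_def cis_conv_exp)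
    show "2 * pi * frac x < 2 * pi" using frac_lt_1[of x] by simp
  qed (auto simp: frac_ge_0)
  then show ?thesis by simp
qed

lemma frac_wave_mean_tendsto:
  assumes "y \<notin> \<int>"
  shows "(\<lambda>L. fejer_mean L (frac_wave \<eta>) y) \<longlonglongrightarrow> frac_wave \<eta> y"
proof -
  define \<Phi> where "\<Phi> z = ee (\<eta> * (Arg2pi z / (2 * pi)))" for z
  have eq: "frac_wave \<eta> = (\<lambda>x. \<Phi> (ee x))"
    by (auto simp: frac_wave_def \<Phi>_def frac_eq_Arg2pi)
  have "ee y \<notin> \<real>\<^sub>\<ge>\<^sub>0"
  proof
    assume "ee y \<in> \<real>\<^sub>\<ge>\<^sub>0"
    then obtain r where "r \<ge> 0" "ee y = of_real r" by (elim nonneg_Reals_cases)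
    moreover from this have "r = 1" using norm_ee[of y] by simp
    ultimately show False using assms ee_eq_1_iff[of y] by simp
  qed
  then have "isCont Arg2pi (ee y)" by (rule continuous_at_Arg2pi)
  then have "isCont \<Phi> (ee y)"
    unfolding \<Phi>_def[abs_def] ee_def cis_conv_exp by (intro continuous_intros) auto
  then show ?thesis unfolding eq by (rule fejer_mean_tendsto) (simp add: \<Phi>_def)
qed

lemma fourier_transform_ee: "fourier_transform \<mu> \<xi> = (LINT x|\<mu>. ee (- (x \<bullet> \<xi>)))"
  unfolding fourier_transform_def ee_def cis_conv_exp by (simp add: mult_ac)

lemma borel_measurable_ee [measurable]: "f \<in> borel_measurable M \<Longrightarrow> (\<lambda>x. ee (f x)) \<in> borel_measurable M"
  unfolding ee_def by (rule measurable_compose[where g = "\<lambda>x. cis (2 * pi * x)"])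
    (auto intro!: borel_measurable_continuous_onI continuous_intros)

lemma (in prob_space) integrable_ee [simp]:
  assumes "f \<in> borel_measurable M"
  shows "integrable M (\<lambda>x. ee (f x))"
  using assms by (intro integrable_const_bound[where B = 1]) auto

lemma (in prob_space) norm_integral_le_1:
  fixes f :: "'a \<Rightarrow> complex"
  assumes "f \<in> borel_measurable M" "\<And>x. norm (f x) \<le> 1"
  shows "norm (LINT x|M. f x) \<le> 1"
proof -
  have "norm (LINT x|M. f x) \<le> (LINT x|M. norm (f x))" by (rule integral_norm_bound)
  also have "\<dots> \<le> (LINT x|M. 1)"
    using assms by (intro integral_mono integrable_norm integrable_const_bound[where B = 1]) auto
  finally show ?thesis by (simp add: prob_space)
qed

definition floor_vec :: "real ^ 'n \<Rightarrow> real ^ 'n" where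
  "floor_vec y = (\<chi> i. of_int \<lfloor>y $ i\<rfloor>)"

lemma inner_transpose_matrix:
  fixes A :: "real ^ 'n::finite ^ 'm::finite"
  shows "(A *v x) \<bullet> \<eta> = x \<bullet> (transpose A *v \<eta>)"
  by (metis dot_lmul_matrix inner_commute transpose_matrix_vector transpose_transpose)

lemma measurable_matrix_vector_nth [measurable]:
  fixes A :: "real ^ 'n::finite ^ 'm::finite"
  shows "(\<lambda>x. (A *v x) $ i) \<in> borel_measurable borel"
  unfolding matrix_vector_mult_def vec_lambda_beta
  by (intro borel_measurable_continuous_onI continuous_intros)

lemma floor_ee_expand:
  fixes y \<eta> :: "real ^ 'n::finite"
  shows "ee (- (floor_vec y \<bullet> \<eta>)) = ee (- (y \<bullet> \<eta>)) * (\<Prod>i\<in>UNIV. frac_wave (\<eta> $ i) (y $ i))"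
proof -
  have "floor_vec y \<bullet> \<eta> = y \<bullet> \<eta> - (\<Sum>i\<in>UNIV. \<eta> $ i * frac (y $ i))"
    by (simp add: inner_vec_def floor_vec_def frac_def algebra_simps sum_subtractf)
  then have "- (floor_vec y \<bullet> \<eta>) = - (y \<bullet> \<eta>) + (\<Sum>i\<in>UNIV. \<eta> $ i * frac (y $ i))" by simp
  then show ?thesis unfolding frac_wave_def ee_sum[symmetric] ee_add[symmetric] by (rule arg_cong)
qed

lemma norm_frac_wave_minus_1: "norm (frac_wave \<eta> x - 1) \<le> 2 * pi * \<bar>\<eta>\<bar>"
proof -
  have "norm (frac_wave \<eta> x - 1) \<le> 2 * pi * \<bar>\<eta> * frac x\<bar>"
    unfolding frac_wave_def by (rule norm_ee_minus_1_le)
  also have "\<bar>\<eta> * frac x\<bar> \<le> \<bar>\<eta>\<bar> * 1"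
    unfolding abs_mult using frac_lt_1[of x] frac_ge_0[of x] by (intro mult_left_mono) auto
  finally show ?thesis by simp
qed

text \<open>The rounded character is a genuine character times n waves in the fractional parts of A
  x. Replacing the waves by Fejer means of large order and integrating yields transforms at \<xi>
  minus points of the lattice dual to A, with weights of modulus at most 1. The almost everywhere
  hypothesis places A x where the means converge; S is finite because \<epsilon> fixes the order
  L.\<close>

lemma fourier_rounding:
  fixes \<mu> :: "(real ^ 'n::finite) measure" and A :: "real ^ 'n ^ 'n"
  assumes \<mu>: "prob_space \<mu>" "sets \<mu> = sets borel"
    and ae: "AE x in \<mu>. \<forall>i. (A *v x) $ i \<notin> \<int>"
    and \<xi>: "\<xi> = transpose A *v \<eta>" and \<epsilon>: "\<epsilon> > 0"
  shows "\<exists>S. finite S \<and> (0 :: int ^ 'n) \<notin> S \<and>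
    norm ((LINT x|\<mu>. ee (- (floor_vec (A *v x) \<bullet> \<eta>))) - fourier_transform \<mu> \<xi>)
     \<le> 2 * pi * (\<Sum>i\<in>UNIV. \<bar>\<eta> $ i\<bar>) * norm (fourier_transform \<mu> \<xi>)
       + (\<Sum>t\<in>S. norm (fourier_transform \<mu> (\<xi> - transpose A *v real_vec t))) + \<epsilon>"
proof -
  interpret prob_space \<mu> by fact
  have [measurable_cong]: "sets \<mu> = sets borel" by fact
  note bm = measurable_cong_sets[OF \<mu>(2) refl]
  define k where "k L i t = fejer_coeff L (frac_wave (\<eta> $ i)) t" for L i t
  define B where "B L = {- int L<..<int L}" for L
  define P where "P L = (UNIV :: 'n set) \<rightarrow>\<^sub>E B L" for L
  define g where "g L x = ee (- (x \<bullet> \<xi>)) * (\<Prod>i\<in>UNIV. fejer_mean L (frac_wave (\<eta> $ i)) ((A *v x) $ i))" for L x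
  have wave: "norm (frac_wave (\<eta> $ i) x) \<le> 1" for i x by (simp add: frac_wave_def)
  have g_expand: "g L x = (\<Sum>p\<in>P L. (\<Prod>i\<in>UNIV. k L i (p i)) * ee (- (x \<bullet> (\<xi> - transpose A *v real_vec (vec_lambda p)))))"
    if "L > 0" for L x
  proof -
    have "g L x = ee (- (x \<bullet> \<xi>)) * (\<Prod>i\<in>UNIV. \<Sum>t\<in>B L. k L i t * ee (real_of_int t * (A *v x) $ i))"
      by (simp only: g_def fejer_mean_expand[OF that] k_def B_def)
    also have "\<dots> = ee (- (x \<bullet> \<xi>)) * (\<Sum>p\<in>P L. \<Prod>i\<in>UNIV. k L i (p i) * ee (real_of_int (p i) * (A *v x) $ i))"
      unfolding P_def by (subst prod_sum_PiE) (auto simp: B_def)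
    also have "\<dots> = (\<Sum>p\<in>P L. (\<Prod>i\<in>UNIV. k L i (p i)) * (ee (- (x \<bullet> \<xi>)) * ee (\<Sum>i\<in>UNIV. real_of_int (p i) * (A *v x) $ i)))"
      by (simp add: sum_distrib_left prod.distrib ee_sum algebra_simps)
    also have "\<dots> = (\<Sum>p\<in>P L. (\<Prod>i\<in>UNIV. k L i (p i)) * ee (- (x \<bullet> (\<xi> - transpose A *v real_vec (vec_lambda p)))))"
    proof (intro sum.cong refl arg_cong2[where f = "(*)"])
      fix p
      have "(\<Sum>i\<in>UNIV. real_of_int (p i) * (A *v x) $ i) = x \<bullet> (transpose A *v real_vec (vec_lambda p))"
        unfolding inner_transpose_matrix[symmetric] by (simp add: inner_vec_def mult.commute)
      then show "ee (- (x \<bullet> \<xi>)) * ee (\<Sum>i\<in>UNIV. real_of_int (p i) * (A *v x) $ i) =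
          ee (- (x \<bullet> (\<xi> - transpose A *v real_vec (vec_lambda p))))"
        by (simp add: ee_add[symmetric] inner_diff_right)
    qed
    finally show ?thesis .
  qed
  have int_g: "(LINT x|\<mu>. g L x) = (\<Sum>p\<in>P L. (\<Prod>i\<in>UNIV. k L i (p i)) * fourier_transform \<mu> (\<xi> - transpose A *v real_vec (vec_lambda p)))"
    if "L > 0" for L
    unfolding g_expand[OF that] fourier_transform_ee
    by (subst Bochner_Integration.integral_sum) (auto simp: bm)
  have meas_g: "g L \<in> borel_measurable \<mu>" if "L > 0" for L
    unfolding g_expand[OF that, abs_def] by measurable
  have norm_g: "norm (g L x) \<le> 1" if "L > 0" for L x
    unfolding g_def norm_mult norm_ee prod_norm[symmetric]
    using prod_mono[of UNIV "\<lambda>i. norm (fejer_mean L (frac_wave (\<eta> $ i)) ((A *v x) $ i))" "\<lambda>_. 1"]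
      norm_fejer_mean_le[OF wave that] by simp
  have lim: "(\<lambda>L. LINT x|\<mu>. g (Suc L) x) \<longlonglongrightarrow> (LINT x|\<mu>. ee (- (floor_vec (A *v x) \<bullet> \<eta>)))"
  proof (rule integral_dominated_convergence[where w = "\<lambda>_. 1"])
    show "(\<lambda>x. ee (- (floor_vec (A *v x) \<bullet> \<eta>))) \<in> borel_measurable \<mu>"
      unfolding inner_vec_def floor_vec_def inner_real_def vec_lambda_beta by measurable
    show "AE x in \<mu>. (\<lambda>L. g (Suc L) x) \<longlonglongrightarrow> ee (- (floor_vec (A *v x) \<bullet> \<eta>))"
      using ae
    proof eventually_elim
      case (elim x)
      have "(\<lambda>L. ee (- (x \<bullet> \<xi>)) * (\<Prod>i\<in>UNIV. fejer_mean L (frac_wave (\<eta> $ i)) ((A *v x) $ i)))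
          \<longlonglongrightarrow> ee (- (x \<bullet> \<xi>)) * (\<Prod>i\<in>UNIV. frac_wave (\<eta> $ i) ((A *v x) $ i))"
        using elim by (intro tendsto_intros frac_wave_mean_tendsto) auto
      also have "ee (- (x \<bullet> \<xi>)) * (\<Prod>i\<in>UNIV. frac_wave (\<eta> $ i) ((A *v x) $ i)) = ee (- (floor_vec (A *v x) \<bullet> \<eta>))"
        unfolding floor_ee_expand inner_transpose_matrix \<xi> ..
      finally show ?case unfolding g_def by (rule LIMSEQ_Suc)
    qed
  qed (use meas_g norm_g in auto)
  then obtain L where L: "norm ((LINT x|\<mu>. g L x) - (LINT x|\<mu>. ee (- (floor_vec (A *v x) \<bullet> \<eta>)))) < \<epsilon>" "L > 0"
    using LIMSEQ_D[OF _ \<epsilon>] by (metis le_refl zero_less_Suc)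
  define S where "S = vec_lambda ` (P L - {\<lambda>_. 0})"
  have finP: "finite (P L)" unfolding P_def B_def by (intro finite_PiE) auto
  have inj: "inj_on vec_lambda (P L - {\<lambda>_. 0})" by (auto intro: inj_onI simp: vec_lambda_inject)
  have 0: "(\<lambda>_. 0) \<in> P L" using L by (auto simp: P_def B_def)
  have kb: "norm (\<Prod>i\<in>UNIV. k L i (p i)) \<le> 1" if "p \<in> P L" for p
  proof -
    have "norm (k L i (p i)) \<le> 1" for i
    proof -
      have "p i \<in> B L" using that by (auto simp: P_def)
      then show ?thesis unfolding k_def by (intro fejer_coeff_bound[OF L(2) _ wave]) (auto simp: B_def)
    qed
    then show ?thesis
      unfolding prod_norm[symmetric] using prod_mono[of UNIV "\<lambda>i. norm (k L i (p i))" "\<lambda>_. 1"] by simp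
  qed
  let ?F = "\<lambda>t. fourier_transform \<mu> (\<xi> - transpose A *v real_vec t)"
  have split: "(LINT x|\<mu>. g L x) = (\<Prod>i\<in>UNIV. k L i 0) * fourier_transform \<mu> \<xi>
      + (\<Sum>p\<in>P L - {\<lambda>_. 0}. (\<Prod>i\<in>UNIV. k L i (p i)) * ?F (vec_lambda p))"
  proof -
    have "real_vec (\<chi> i. 0) = (0 :: real ^ 'n)" by (simp add: vec_eq_iff)
    then show ?thesis unfolding int_g[OF L(2)] by (subst sum.remove[OF finP 0]) simp
  qed
  \<comment> \<open>For small \<eta> the waves are close to 1, and so are their means: low
    frequencies do not notice the rounding.\<close>
  have k0: "norm ((\<Prod>i\<in>UNIV. k L i 0) - 1) \<le> 2 * pi * (\<Sum>i\<in>UNIV. \<bar>\<eta> $ i\<bar>)"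
  proof -
    have "norm ((\<Prod>i\<in>UNIV. k L i 0) - (\<Prod>i\<in>(UNIV :: 'n set). 1)) \<le> (\<Sum>i\<in>UNIV. norm (k L i 0 - 1))"
      by (rule norm_prod_diff) (auto simp: k_def intro!: fejer_coeff_bound[OF L(2) _ wave])
    also have "\<dots> \<le> (\<Sum>i\<in>UNIV. 2 * pi * \<bar>\<eta> $ i\<bar>)"
      unfolding k_def by (intro sum_mono fejer_coeff_0[OF L(2)] norm_frac_wave_minus_1)
    finally show ?thesis by (simp add: sum_distrib_left)
  qed
  have "(LINT x|\<mu>. g L x) - fourier_transform \<mu> \<xi> = ((\<Prod>i\<in>UNIV. k L i 0) - 1) * fourier_transform \<mu> \<xi>
      + (\<Sum>p\<in>P L - {\<lambda>_. 0}. (\<Prod>i\<in>UNIV. k L i (p i)) * ?F (vec_lambda p))"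
    unfolding split by (simp add: algebra_simps)
  also have "norm \<dots> \<le> 2 * pi * (\<Sum>i\<in>UNIV. \<bar>\<eta> $ i\<bar>) * norm (fourier_transform \<mu> \<xi>) + (\<Sum>p\<in>P L - {\<lambda>_. 0}. norm (?F (vec_lambda p)))"
  proof (rule norm_triangle_mono)
    show "norm (((\<Prod>i\<in>UNIV. k L i 0) - 1) * fourier_transform \<mu> \<xi>) \<le> 2 * pi * (\<Sum>i\<in>UNIV. \<bar>\<eta> $ i\<bar>) * norm (fourier_transform \<mu> \<xi>)"
      unfolding norm_mult using k0 by (rule mult_right_mono) simp
    show "norm (\<Sum>p\<in>P L - {\<lambda>_. 0}. (\<Prod>i\<in>UNIV. k L i (p i)) * ?F (vec_lambda p)) \<le> (\<Sum>p\<in>P L - {\<lambda>_. 0}. norm (?F (vec_lambda p)))"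
    proof (rule sum_norm_le)
      fix p assume "p \<in> P L - {\<lambda>_. 0}"
      then show "norm ((\<Prod>i\<in>UNIV. k L i (p i)) * ?F (vec_lambda p)) \<le> norm (?F (vec_lambda p))"
        unfolding norm_mult using kb[of p] by (intro mult_left_le_one_le) auto
    qed
  qed
  also have "(\<Sum>p\<in>P L - {\<lambda>_. 0}. norm (?F (vec_lambda p))) = (\<Sum>t\<in>S. norm (?F t))"
    unfolding S_def by (subst sum.reindex[OF inj]) simp
  finally have "norm ((LINT x|\<mu>. g L x) - fourier_transform \<mu> \<xi>)
     \<le> 2 * pi * (\<Sum>i\<in>UNIV. \<bar>\<eta> $ i\<bar>) * norm (fourier_transform \<mu> \<xi>) + (\<Sum>t\<in>S. norm (?F t))" .
  moreover have "norm ((LINT x|\<mu>. ee (- (floor_vec (A *v x) \<bullet> \<eta>))) - fourier_transform \<mu> \<xi>) \<le>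
     norm ((LINT x|\<mu>. g L x) - (LINT x|\<mu>. ee (- (floor_vec (A *v x) \<bullet> \<eta>)))) + norm ((LINT x|\<mu>. g L x) - fourier_transform \<mu> \<xi>)"
    by (metis norm_triangle_sub dist_norm dist_triangle2 dist_commute)
  moreover have "finite S" using finP by (simp add: S_def)
  moreover have "0 \<notin> S"
  proof
    assume "0 \<in> S"
    then obtain p where "p \<in> P L - {\<lambda>_. 0}" "0 = vec_lambda p" unfolding S_def by (elim imageE) (rule that)
    then have p: "p \<noteq> (\<lambda>_. 0)" "0 = vec_lambda p" by auto
    have "p i = 0" for i using arg_cong[OF p(2), of "\<lambda>v. v $ i"] by simp
    then show False using p(1) by auto
  qed
  ultimately show ?thesis using L(1) by (intro exI[of _ S]) linarith
qed

section \<open>Decaying sums over the integer lattice\<close>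

lemma sum_inverse_squares: "(\<Sum>j=1..N. 1 / (real j)\<^sup>2) \<le> 2"
proof (cases "N = 0")
  case False
  then have "N > 0" by simp
  \<comment> \<open>Strengthened so that the induction telescopes.\<close>
  then have "(\<Sum>j=1..N. 1 / (real j)\<^sup>2) \<le> 2 - 1 / real N"
  proof (induction N rule: nat_induct_non_zero)
    case (Suc N)
    have "1 / (real (Suc N))\<^sup>2 \<le> 1 / (real N * real (Suc N))"
      using Suc.hyps unfolding power2_eq_square by (intro divide_left_mono mult_right_mono) auto
    also have "\<dots> = 1 / real N - 1 / real (Suc N)" using Suc.hyps by (simp add: field_simps)
    finally show ?case using Suc.IH by simp
  qed simp
  then show ?thesis by (smt (verit) divide_nonneg_nonneg of_nat_0_le_iff)
qed simp

text \<open>After the shift by the floor of x this is the sum over a symmetric interval, at most 1 +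
  2 * 2 uniformly in x.\<close>

lemma sum_inverse_squares_int:
  fixes B :: "int set"
  assumes "finite B"
  shows "(\<Sum>k\<in>B. 1 / (1 + \<bar>x - real_of_int k\<bar>)\<^sup>2) \<le> 5"
proof -
  define f where "f i = 1 / (max 1 \<bar>real_of_int i\<bar>)\<^sup>2" for i
  define m where "m = \<lfloor>x\<rfloor>"
  have sym: "(\<Sum>i\<in>{- int M..int M}. f i) = 1 + 2 * (\<Sum>j=1..M. 1 / (real j)\<^sup>2)" for M
  proof (induction M)
    case (Suc M)
    have "{- int (Suc M)..int (Suc M)} = insert (int (Suc M)) (insert (- int (Suc M)) {- int M..int M})" by auto
    then show ?case using Suc by (simp add: f_def max_def add.commute)
  qed (simp add: f_def)
  have "1 / (1 + \<bar>x - real_of_int k\<bar>)\<^sup>2 \<le> f (m - k)" for k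
  proof -
    have "\<bar>real_of_int (m - k)\<bar> \<le> 1 + \<bar>x - real_of_int k\<bar>" unfolding m_def by linarith
    then have "max 1 \<bar>real_of_int (m - k)\<bar> \<le> 1 + \<bar>x - real_of_int k\<bar>" by simp
    then show ?thesis unfolding f_def by (intro divide_left_mono power_mono) auto
  qed
  then have "(\<Sum>k\<in>B. 1 / (1 + \<bar>x - real_of_int k\<bar>)\<^sup>2) \<le> (\<Sum>k\<in>B. f (m - k))" by (rule sum_mono)
  also have "\<dots> = (\<Sum>i\<in>(\<lambda>k. m - k) ` B. f i)" by (subst sum.reindex) (auto intro: inj_onI)
  also have "\<dots> \<le> (\<Sum>i\<in>{- int M..int M}. f i)" if M: "\<forall>i\<in>(\<lambda>k. m - k) ` B. \<bar>i\<bar> \<le> int M" for M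
    using M by (intro sum_mono2) (auto simp: f_def abs_le_iff)
  finally have bd: "(\<Sum>k\<in>B. 1 / (1 + \<bar>x - real_of_int k\<bar>)\<^sup>2) \<le> 1 + 2 * (\<Sum>j=1..M. 1 / (real j)\<^sup>2)"
    if "\<forall>i\<in>(\<lambda>k. m - k) ` B. \<bar>i\<bar> \<le> int M" for M
    unfolding sym using that by blast
  have "\<forall>i\<in>(\<lambda>k. m - k) ` B. \<bar>i\<bar> \<le> int (nat (\<Sum>i\<in>(\<lambda>k. m - k) ` B. \<bar>i\<bar>))"
  proof
    fix i assume "i \<in> (\<lambda>k. m - k) ` B"
    then have "\<bar>i\<bar> \<le> (\<Sum>i\<in>(\<lambda>k. m - k) ` B. \<bar>i\<bar>)" using assms by (intro member_le_sum) auto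
    then show "\<bar>i\<bar> \<le> int (nat (\<Sum>i\<in>(\<lambda>k. m - k) ` B. \<bar>i\<bar>))" by linarith
  qed
  from bd[OF this] show ?thesis using sum_inverse_squares[of "nat (\<Sum>i\<in>(\<lambda>k. m - k) ` B. \<bar>i\<bar>)"] by linarith
qed

text \<open>A max-norm to the power 2 n dominates the product of the squared coordinates, so the sum
  over a box factorises.\<close>

lemma sum_lattice_decay:
  fixes S :: "(int ^ 'n::finite) set" and \<zeta> :: "real ^ 'n"
  assumes "finite S"
  shows "(\<Sum>s\<in>S. 1 / (1 + infnorm (\<zeta> - real_vec s)) ^ (2 * CARD('n))) \<le> 5 ^ CARD('n)"
proof -
  define B where "B = (\<Union>i\<in>UNIV. (\<lambda>s. s $ i) ` S)"
  have B: "finite B" using assms by (simp add: B_def)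
  define T :: "(int ^ 'n) set" where "T = {s. \<forall>i. s $ i \<in> B}"
  have bij: "bij_betw (\<lambda>f. \<chi> i. f i) (UNIV \<rightarrow>\<^sub>E B) T"
    unfolding T_def by (rule bij_betwI[where g = vec_nth]) auto
  have "(\<Sum>s\<in>S. 1 / (1 + infnorm (\<zeta> - real_vec s)) ^ (2 * CARD('n))) \<le> (\<Sum>s\<in>S. \<Prod>i\<in>UNIV. 1 / (1 + \<bar>\<zeta> $ i - real_of_int (s $ i)\<bar>)\<^sup>2)"
  proof (rule sum_mono)
    fix s
    have "(\<Prod>i\<in>(UNIV :: 'n set). 1 / (1 + infnorm (\<zeta> - real_vec s))\<^sup>2) \<le> (\<Prod>i\<in>UNIV. 1 / (1 + \<bar>\<zeta> $ i - real_of_int (s $ i)\<bar>)\<^sup>2)"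
    proof (rule prod_mono)
      fix i
      have "\<bar>\<zeta> $ i - real_of_int (s $ i)\<bar> \<le> infnorm (\<zeta> - real_vec s)"
        using component_le_infnorm_cart[of "\<zeta> - real_vec s" i] by simp
      then show "0 \<le> 1 / (1 + infnorm (\<zeta> - real_vec s))\<^sup>2 \<and>
          1 / (1 + infnorm (\<zeta> - real_vec s))\<^sup>2 \<le> 1 / (1 + \<bar>\<zeta> $ i - real_of_int (s $ i)\<bar>)\<^sup>2"
        using infnorm_pos_le[of "\<zeta> - real_vec s"]
        by (auto intro!: divide_left_mono power_mono mult_pos_pos zero_less_power)
    qed
    then show "1 / (1 + infnorm (\<zeta> - real_vec s)) ^ (2 * CARD('n)) \<le> (\<Prod>i\<in>UNIV. 1 / (1 + \<bar>\<zeta> $ i - real_of_int (s $ i)\<bar>)\<^sup>2)"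
      by (simp add: power_mult power_one_over)
  qed
  also have "\<dots> \<le> (\<Sum>s\<in>T. \<Prod>i\<in>UNIV. 1 / (1 + \<bar>\<zeta> $ i - real_of_int (s $ i)\<bar>)\<^sup>2)"
  proof (rule sum_mono2)
    show "finite T" using bij_betw_finite[OF bij] B by (simp add: finite_PiE)
    show "S \<subseteq> T" by (auto simp: T_def B_def)
  qed (auto intro: prod_nonneg)
  also have "\<dots> = (\<Sum>f\<in>UNIV \<rightarrow>\<^sub>E B. \<Prod>i\<in>UNIV. 1 / (1 + \<bar>\<zeta> $ i - real_of_int (f i)\<bar>)\<^sup>2)"
    using sum.reindex_bij_betw[OF bij, of "\<lambda>s. \<Prod>i\<in>UNIV. 1 / (1 + \<bar>\<zeta> $ i - real_of_int (s $ i)\<bar>)\<^sup>2"] by simp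
  also have "\<dots> = (\<Prod>i\<in>UNIV. \<Sum>k\<in>B. 1 / (1 + \<bar>\<zeta> $ i - real_of_int k\<bar>)\<^sup>2)"
    by (rule prod_sum_PiE[symmetric]) (use B in auto)
  also have "\<dots> \<le> (\<Prod>i\<in>(UNIV :: 'n set). 5)"
    by (intro prod_mono conjI sum_nonneg sum_inverse_squares_int[OF B]) auto
  finally show ?thesis by simp
qed

section \<open>Rounding to fractions and averaging over the denominator\<close>

context number_basis
begin

definition round_to :: "nat \<Rightarrow> nat \<Rightarrow> int ^ 'n \<Rightarrow> real ^ 'n \<Rightarrow> real ^ 'n" where
  "round_to Y h u x =
     coords \<omega> (of_coords \<omega> (\<chi> i. \<lfloor>(mm (denom Y h u) *v x) $ i\<rfloor>) / denom Y h u)"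

lemma mm_round_to:
  assumes "u \<in> box h"
  shows "mm (denom Y h u) *v round_to Y h u x = floor_vec (mm (denom Y h u) *v x)"
proof -
  have "mm (denom Y h u) *v round_to Y h u x = coords \<omega> (of_coords \<omega> (\<chi> i. \<lfloor>(mm (denom Y h u) *v x) $ i\<rfloor>))"
    using denom_coords(3)[OF assms] by (simp add: round_to_def coords_mult[symmetric])
  then show ?thesis by (simp add: coords_of_coords floor_vec_def vec_eq_iff)
qed

lemma round_to_dist:
  assumes "u \<in> box h"
  shows "infnorm (round_to Y h u x - x) \<le> 2 / real (kappa Y h)"
proof -
  let ?A = "mm (denom Y h u)"
  have "real (kappa Y h) / 2 * infnorm (round_to Y h u x - x) \<le> infnorm (?A *v (round_to Y h u x - x))"
    by (rule denom_bounds(1)[OF assms])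
  also have "\<dots> = infnorm (floor_vec (?A *v x) - ?A *v x)"
    by (simp add: matrix_vector_mult_diff_distrib mm_round_to[OF assms])
  also have "\<dots> \<le> 1"
    unfolding infnorm_le_iff floor_vec_def by (simp, linarith)
  finally show ?thesis using kappa_pos[of Y h] by (simp add: field_simps)
qed

lemma measurable_floor_vec: "floor_vec \<in> borel_measurable (borel :: (real ^ 'm::finite) measure)"
proof (subst borel_measurable_euclidean_space, rule ballI)
  fix b :: "real ^ 'm" assume "b \<in> Basis"
  then obtain i where b: "b = axis i 1" by (auto simp: Basis_vec_def)
  have [measurable]: "(\<lambda>x :: real ^ 'm. x $ i) \<in> borel_measurable borel"
    by (intro borel_measurable_continuous_onI continuous_intros)
  have "(\<lambda>x :: real ^ 'm. floor_vec x \<bullet> b) = (\<lambda>x. of_int \<lfloor>x $ i\<rfloor>)"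
    by (auto simp: b inner_axis floor_vec_def)
  then show "(\<lambda>x :: real ^ 'm. floor_vec x \<bullet> b) \<in> borel_measurable borel" by simp
qed

lemma measurable_matrix_vector [measurable]:
  fixes A :: "real ^ 'm::finite ^ 'l::finite"
  shows "(\<lambda>x. A *v x) \<in> borel_measurable borel"
  by (intro borel_measurable_continuous_onI matrix_vector_mult_linear_continuous_on)

lemma measurable_round_to [measurable]: "round_to Y h u \<in> borel_measurable borel"
proof -
  \<comment> \<open>Division in the field is again a matrix, so only the floor is not
    linear.\<close>
  have "round_to Y h u = (\<lambda>x. mm (1 / denom Y h u) *v floor_vec (mm (denom Y h u) *v x))"
  proof
    fix x
    have "floor_vec (mm (denom Y h u) *v x) = coords \<omega> (of_coords \<omega> (\<chi> i. \<lfloor>(mm (denom Y h u) *v x) $ i\<rfloor>))"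
      by (simp add: coords_of_coords floor_vec_def vec_eq_iff)
    then show "round_to Y h u x = mm (1 / denom Y h u) *v floor_vec (mm (denom Y h u) *v x)"
      by (simp add: coords_mult[symmetric] round_to_def)
  qed
  then show ?thesis
    using measurable_compose[OF measurable_matrix_vector measurable_compose[OF measurable_floor_vec measurable_matrix_vector]]
    by simp
qed

definition dual_count :: "real \<Rightarrow> nat \<Rightarrow> bool" where
  "dual_count C c \<longleftrightarrow> C \<ge> 1 \<and> c > 0 \<and>
    (\<forall>Y h j s. s \<noteq> 0 \<longrightarrow> (C * infnorm (real_vec s)) ^ CARD('n) < real (Y + 1) ^ j \<longrightarrow>
     card {u \<in> box h. \<exists>t. real_vec s = transpose (mm (denom Y h u)) *v real_vec t} \<le> c * 2 ^ j)"

lemma infnorm_real_vec_ge_1: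
  assumes "t \<noteq> 0"
  shows "1 \<le> infnorm (real_vec t :: real ^ 'm::finite)"
proof -
  obtain i where "t $ i \<noteq> 0" using assms by (auto simp: vec_eq_iff)
  then have "1 \<le> \<bar>real_vec t $ i\<bar>" by simp
  then show ?thesis using component_le_infnorm_cart[of "real_vec t" i] by linarith
qed

text \<open>The shifts produced by all denominators are gathered by their integral frequency s,
  which has size at least \<open>kappa\<close> / 2. If s is far from \<xi>, the trivial count
  \<open>h ^ n\<close> is paid for by half of the decay. If s is near \<xi>, then s has size at most
  2 R and the divisor count applies. The other half of the decay sums over s.\<close>

lemma rounding_average:
  fixes \<mu> :: "(real ^ 'n) measure" and \<xi> :: "real ^ 'n"
  assumes \<mu>: "prob_space \<mu>" "sets \<mu> = sets borel"
    and ae: "\<And>u. u \<in> box h \<Longrightarrow> AE x in \<mu>. \<forall>i. (mm (denom Y h u) *v x) $ i \<notin> \<int>"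
    and decay: "\<And>\<zeta>. norm (fourier_transform \<mu> \<zeta>) \<le> C / (1 + infnorm \<zeta>) ^ (4 * CARD('n))"
    and dc: "dual_count Cd c"
    and h: "h > 0"
    and j: "R \<ge> real (kappa Y h) / 4 \<Longrightarrow> (Cd * (2 * R)) ^ CARD('n) < real (Y + 1) ^ j"
    and R: "R = infnorm \<xi>"
  shows "(\<Sum>u\<in>box h. norm ((LINT x|\<mu>. ee (- (round_to Y h u x \<bullet> \<xi>))) - fourier_transform \<mu> \<xi>)) / real (h ^ CARD('n))
    \<le> 4 * pi * real CARD('n) * R / real (kappa Y h) * norm (fourier_transform \<mu> \<xi>)
      + C * 5 ^ CARD('n) * (1 / max (R / 2) (real (kappa Y h) / 8) ^ (2 * CARD('n))
        + (if R \<ge> real (kappa Y h) / 4 then real (c * 2 ^ j) / real (h ^ CARD('n)) else 0))"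
proof -
  define n where "n = CARD('n)"
  define \<kappa> where "\<kappa> = real (kappa Y h)"
  define A where "A u = mm (denom Y h u)" for u
  \<comment> \<open>The border between near and far: a distance below m from \<xi>, combined with
    |s| \<ge> \<kappa> / 2, forces R \<ge> \<kappa> / 4 and |s| \<le> 2 R.\<close>
  define m where "m = max (R / 2) (\<kappa> / 8)"
  let ?F = "fourier_transform \<mu>"
  define X where "X u = norm ((LINT x|\<mu>. ee (- (round_to Y h u x \<bullet> \<xi>))) - ?F \<xi>)" for u
  define G where "G = real (h ^ n) / m ^ (2 * n) + (if R \<ge> \<kappa> / 4 then real (c * 2 ^ j) else 0)"
  have \<kappa>: "\<kappa> > 0" using kappa_pos[of Y h] by (simp add: \<kappa>_def)
  have m: "m > 0" using \<kappa> by (simp add: m_def)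
  have hn: "real (h ^ n) > 0" using h by simp
  have C: "C \<ge> 0" using order_trans[OF norm_ge_zero decay[of 0]] by (simp add: infnorm_0)
  have AT: "\<kappa> / 2 * infnorm v \<le> infnorm (transpose (A u) *v v)" if "u \<in> box h" for u v
    unfolding A_def \<kappa>_def by (rule denom_bounds(3)[OF that])
  have key: "(\<Sum>u\<in>box h. X u) / real (h ^ n) \<le> 4 * pi * real n * R / \<kappa> * norm (?F \<xi>) + C * 5 ^ n * G / real (h ^ n) + \<epsilon>"
    if \<epsilon>: "\<epsilon> > 0" for \<epsilon>
  proof -
    have ex: "\<exists>S. finite S \<and> (0 :: int ^ 'n) \<notin> S \<and>
        X u \<le> 4 * pi * real n * R / \<kappa> * norm (?F \<xi>) + (\<Sum>t\<in>S. norm (?F (\<xi> - transpose (A u) *v real_vec t))) + \<epsilon>"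
      if u: "u \<in> box h" for u
    proof -
      have "inj ((*v) (transpose (A u)))"
      proof (rule injI)
        fix v w assume "transpose (A u) *v v = transpose (A u) *v w"
        then have "transpose (A u) *v (v - w) = 0" by (simp add: matrix_vector_mult_diff_distrib)
        then have "\<kappa> / 2 * infnorm (v - w) \<le> 0" using AT[OF u, of "v - w"] by (simp add: infnorm_0)
        then have "infnorm (v - w) \<le> 0" using \<kappa> by (simp add: mult_le_0_iff)
        then show "v = w" using infnorm_pos_lt[of "v - w"] by auto
      qed
      then have "surj ((*v) (transpose (A u)))"
        by (intro eucl.linear_inj_imp_surj matrix_vector_mul_linear)
      then obtain \<eta> where \<eta>: "\<xi> = transpose (A u) *v \<eta>" by (metis surjD)
      have e: "round_to Y h u x \<bullet> \<xi> = floor_vec (A u *v x) \<bullet> \<eta>" for x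
        unfolding \<eta> inner_transpose_matrix[symmetric] A_def mm_round_to[OF u] ..
      have "(\<Sum>i\<in>UNIV. \<bar>\<eta> $ i\<bar>) \<le> (\<Sum>i\<in>(UNIV :: 'n set). 2 * R / \<kappa>)"
      proof (rule sum_mono)
        fix i
        have "\<kappa> / 2 * infnorm \<eta> \<le> R" using AT[OF u, of \<eta>] \<eta> R by simp
        then have "infnorm \<eta> \<le> 2 * R / \<kappa>" using \<kappa> by (simp add: field_simps)
        then show "\<bar>\<eta> $ i\<bar> \<le> 2 * R / \<kappa>" using component_le_infnorm_cart[of \<eta> i] by linarith
      qed
      then have "2 * pi * (\<Sum>i\<in>UNIV. \<bar>\<eta> $ i\<bar>) \<le> 2 * pi * (real n * (2 * R / \<kappa>))"
        by (intro mult_left_mono) (auto simp: n_def)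
      then have "2 * pi * (\<Sum>i\<in>UNIV. \<bar>\<eta> $ i\<bar>) \<le> 4 * pi * real n * R / \<kappa>" by simp
      then have le: "2 * pi * (\<Sum>i\<in>UNIV. \<bar>\<eta> $ i\<bar>) * norm (?F \<xi>) \<le> 4 * pi * real n * R / \<kappa> * norm (?F \<xi>)"
        by (rule mult_right_mono) simp
      obtain S where S: "finite S" "(0 :: int ^ 'n) \<notin> S"
        "norm ((LINT x|\<mu>. ee (- (floor_vec (A u *v x) \<bullet> \<eta>))) - ?F \<xi>)
         \<le> 2 * pi * (\<Sum>i\<in>UNIV. \<bar>\<eta> $ i\<bar>) * norm (?F \<xi>)
           + (\<Sum>t\<in>S. norm (?F (\<xi> - transpose (A u) *v real_vec t))) + \<epsilon>"
        using fourier_rounding[OF \<mu> ae[OF u, folded A_def] \<eta> \<epsilon>] by (elim exE conjE) (rule that)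
      show ?thesis
        by (rule exI[of _ S]) (use S le in \<open>simp add: X_def e\<close>)
    qed
    then obtain S where S: "\<And>u. u \<in> box h \<Longrightarrow> finite (S u)" "\<And>u. u \<in> box h \<Longrightarrow> (0 :: int ^ 'n) \<notin> S u"
      "\<And>u. u \<in> box h \<Longrightarrow> X u \<le> 4 * pi * real n * R / \<kappa> * norm (?F \<xi>) + (\<Sum>t\<in>S u. norm (?F (\<xi> - transpose (A u) *v real_vec t))) + \<epsilon>"
      by metis
    \<comment> \<open>The floor only changes the type: \<open>A u\<close> has integer entries
      because the denominator is an algebraic integer.\<close>
    define st where "st u t = (\<chi> i. \<lfloor>(transpose (A u) *v real_vec t) $ i\<rfloor>)" for u and t :: "int ^ 'n"
    have st: "real_vec (st u t) = transpose (A u) *v real_vec t" for u t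
    proof -
      have "A u $ i $ k \<in> \<int>" for i k unfolding A_def by (rule mm_Ints[OF denom_mem_OK])
      then have "(transpose (A u) *v real_vec t) $ i \<in> \<int>" for i
        unfolding matrix_vector_mult_def transpose_def vec_lambda_beta by (intro Ints_sum Ints_mult) auto
      then show ?thesis by (simp add: vec_eq_iff st_def)
    qed
    define V where "V = (\<Union>u\<in>box h. st u ` S u)"
    have V: "finite V" using S(1) finite_box by (auto simp: V_def)
    have V2: "\<kappa> / 2 \<le> infnorm (real_vec s)" if sV: "s \<in> V" for s
    proof -
      obtain u t where ut: "u \<in> box h" "t \<in> S u" "s = st u t" using sV by (auto simp: V_def)
      then have "t \<noteq> 0" using S(2) by auto
      then have "1 \<le> infnorm (real_vec t)" by (rule infnorm_real_vec_ge_1)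
      then have "\<kappa> / 2 * 1 \<le> \<kappa> / 2 * infnorm (real_vec t)" using \<kappa> by (intro mult_left_mono) auto
      also have "\<dots> \<le> infnorm (real_vec s)" unfolding ut(3) st by (rule AT[OF ut(1)])
      finally show ?thesis by simp
    qed
    define f where "f s = norm (?F (\<xi> - real_vec s))" for s
    define D where "D s = {u \<in> box h. \<exists>t. real_vec s = transpose (A u) *v real_vec t}" for s
    have "(\<Sum>u\<in>box h. \<Sum>t\<in>S u. norm (?F (\<xi> - transpose (A u) *v real_vec t))) \<le> (\<Sum>u\<in>box h. \<Sum>s\<in>V. if u \<in> D s then f s else 0)"
    proof (rule sum_mono)
      fix u assume u: "u \<in> box h"
      have inj: "inj_on (st u) (S u)"
      proof (rule inj_onI)
        fix t t' assume "st u t = st u t'"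
        then have "transpose (A u) *v real_vec t = transpose (A u) *v real_vec t'"
          unfolding st[symmetric] by (rule arg_cong)
        then have "transpose (A u) *v (real_vec t - real_vec t') = 0"
          unfolding matrix_vector_mult_diff_distrib by simp
        then have "\<kappa> / 2 * infnorm (real_vec t - real_vec t') \<le> 0"
          using AT[OF u, of "real_vec t - real_vec t'"] by (simp add: infnorm_0)
        then have "infnorm (real_vec t - real_vec t') \<le> 0" using \<kappa> by (simp add: mult_le_0_iff)
        then have "real_vec t = real_vec t'" using infnorm_pos_lt[of "real_vec t - real_vec t'"] by auto
        then show "t = t'" by simp
      qed
      have "(\<Sum>t\<in>S u. norm (?F (\<xi> - transpose (A u) *v real_vec t))) = (\<Sum>s\<in>st u ` S u. f s)"
        by (simp add: sum.reindex[OF inj] f_def st)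
      also have "\<dots> = (\<Sum>s\<in>st u ` S u. if u \<in> D s then f s else 0)"
        using u st by (intro sum.cong) (auto simp: D_def)
      also have "\<dots> \<le> (\<Sum>s\<in>V. if u \<in> D s then f s else 0)"
        using u V by (intro sum_mono2) (auto simp: V_def f_def)
      finally show "(\<Sum>t\<in>S u. norm (?F (\<xi> - transpose (A u) *v real_vec t))) \<le> (\<Sum>s\<in>V. if u \<in> D s then f s else 0)" .
    qed
    also have "\<dots> = (\<Sum>s\<in>V. \<Sum>u\<in>box h. if u \<in> D s then f s else 0)" by (rule sum.swap)
    also have "\<dots> = (\<Sum>s\<in>V. real (card (D s)) * f s)"
    proof (rule sum.cong[OF refl])
      fix s
      have "(\<Sum>u\<in>box h. if u \<in> D s then f s else 0) = (\<Sum>u\<in>box h \<inter> D s. f s)"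
        by (simp only: sum.inter_restrict[OF finite_box])
      moreover have "box h \<inter> D s = D s" by (auto simp: D_def)
      ultimately show "(\<Sum>u\<in>box h. if u \<in> D s then f s else 0) = real (card (D s)) * f s" by simp
    qed
    also have "\<dots> \<le> (\<Sum>s\<in>V. C * G * (1 / (1 + infnorm (\<xi> - real_vec s)) ^ (2 * n)))"
    proof (rule sum_mono)
      fix s assume s: "s \<in> V"
      define d where "d = infnorm (\<xi> - real_vec s)"
      have d: "d \<ge> 0" by (simp add: d_def infnorm_pos_le)
      have G0: "G \<ge> 0" using m by (simp add: G_def)
      have fs: "f s \<le> C / (1 + d) ^ (4 * n)" unfolding f_def d_def n_def by (rule decay)
      have four: "(1 + d) ^ (4 * n) = (1 + d) ^ (2 * n) * (1 + d) ^ (2 * n)"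
        by (simp flip: power_add)
      have cardh: "card (D s) \<le> h ^ n"
        unfolding n_def card_box[symmetric] by (intro card_mono finite_box) (auto simp: D_def)
      show "real (card (D s)) * f s \<le> C * G * (1 / (1 + infnorm (\<xi> - real_vec s)) ^ (2 * n))"
      proof (cases "d \<ge> m")
        case True
        have "f s \<le> C / ((1 + d) ^ (2 * n) * m ^ (2 * n))"
        proof -
          have "m ^ (2 * n) \<le> (1 + d) ^ (2 * n)" using True m by (intro power_mono) auto
          then have "C / (1 + d) ^ (4 * n) \<le> C / ((1 + d) ^ (2 * n) * m ^ (2 * n))"
            unfolding four using C d m by (intro divide_left_mono mult_left_mono) auto
          then show ?thesis using fs by linarith
        qed
        then have "real (card (D s)) * f s \<le> real (h ^ n) * (C / ((1 + d) ^ (2 * n) * m ^ (2 * n)))"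
          using cardh by (intro mult_mono) (auto simp: f_def simp del: of_nat_power)
        also have "\<dots> = C * (real (h ^ n) / m ^ (2 * n)) * (1 / (1 + d) ^ (2 * n))" by (simp add: field_simps)
        also have "\<dots> \<le> C * G * (1 / (1 + d) ^ (2 * n))"
          using C d by (intro mult_right_mono mult_left_mono) (auto simp: G_def)
        finally show ?thesis by (simp add: d_def)
      next
        case False
        have tri: "infnorm (real_vec s) \<le> R + d"
          using infnorm_triangle[of \<xi> "real_vec s - \<xi>"] infnorm_sub[of \<xi> "real_vec s"] by (simp add: R d_def)
        have R4: "R \<ge> \<kappa> / 4" and s2: "infnorm (real_vec s) \<le> 2 * R"
          using False tri V2[OF s] \<kappa> unfolding m_def by (auto simp: max_def split: if_splits)
        have R0: "R \<ge> 0" by (simp add: R infnorm_pos_le)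
        have "s \<noteq> 0"
        proof
          assume "s = 0"
          then have "real_vec s = 0" by (simp add: vec_eq_iff)
          then show False using V2[OF s] \<kappa> by (simp add: infnorm_0)
        qed
        moreover have "(Cd * infnorm (real_vec s)) ^ CARD('n) < real (Y + 1) ^ j"
        proof -
          have "(Cd * infnorm (real_vec s)) ^ CARD('n) \<le> (Cd * (2 * R)) ^ CARD('n)"
            using dc s2 by (intro power_mono mult_left_mono mult_nonneg_nonneg infnorm_pos_le) (auto simp: dual_count_def)
          then show ?thesis using j[OF R4[unfolded \<kappa>_def]] by linarith
        qed
        ultimately have "card (D s) \<le> c * 2 ^ j"
          using dc unfolding dual_count_def D_def A_def by blast
        then have "real (card (D s)) \<le> real (c * 2 ^ j)" by (simp only: of_nat_le_iff)
        also have "\<dots> \<le> G" using R4 m by (simp add: G_def)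
        finally have cG: "real (card (D s)) \<le> G" .
        have "C / (1 + d) ^ (4 * n) \<le> C / (1 + d) ^ (2 * n)"
          using C d by (intro divide_left_mono power_increasing) auto
        then have "f s \<le> C / (1 + d) ^ (2 * n)" using fs by linarith
        then have "real (card (D s)) * f s \<le> G * (C / (1 + d) ^ (2 * n))"
          using cG G0 by (intro mult_mono) (auto simp: f_def)
        then show ?thesis by (simp add: d_def mult_ac)
      qed
    qed
    also have "\<dots> = C * G * (\<Sum>s\<in>V. 1 / (1 + infnorm (\<xi> - real_vec s)) ^ (2 * n))"
      by (simp add: sum_distrib_left)
    also have "\<dots> \<le> C * G * 5 ^ n"
      unfolding n_def by (intro mult_left_mono sum_lattice_decay V mult_nonneg_nonneg C) (use m in \<open>simp add: G_def\<close>)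
    finally have main: "(\<Sum>u\<in>box h. \<Sum>t\<in>S u. norm (?F (\<xi> - transpose (A u) *v real_vec t))) \<le> C * G * 5 ^ n" .
    have "(\<Sum>u\<in>box h. X u) \<le> (\<Sum>u\<in>box h. 4 * pi * real n * R / \<kappa> * norm (?F \<xi>) + (\<Sum>t\<in>S u. norm (?F (\<xi> - transpose (A u) *v real_vec t))) + \<epsilon>)"
      by (intro sum_mono S(3))
    also have "\<dots> = real (h ^ n) * (4 * pi * real n * R / \<kappa> * norm (?F \<xi>)) + (\<Sum>u\<in>box h. \<Sum>t\<in>S u. norm (?F (\<xi> - transpose (A u) *v real_vec t))) + real (h ^ n) * \<epsilon>"
      unfolding sum.distrib by (simp add: card_box n_def)
    also have "\<dots> \<le> real (h ^ n) * (4 * pi * real n * R / \<kappa> * norm (?F \<xi>)) + C * G * 5 ^ n + real (h ^ n) * \<epsilon>"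
      using main by simp
    finally have "(\<Sum>u\<in>box h. X u) / real (h ^ n) \<le> (real (h ^ n) * (4 * pi * real n * R / \<kappa> * norm (?F \<xi>)) + C * G * 5 ^ n + real (h ^ n) * \<epsilon>) / real (h ^ n)"
      using hn by (intro divide_right_mono) auto
    also have "\<dots> = 4 * pi * real n * R / \<kappa> * norm (?F \<xi>) + C * 5 ^ n * G / real (h ^ n) + \<epsilon>"
      using h by (simp add: add_divide_distrib mult_ac)
    finally show ?thesis .
  qed
  have "(\<Sum>u\<in>box h. X u) / real (h ^ n) \<le> 4 * pi * real n * R / \<kappa> * norm (?F \<xi>) + C * 5 ^ n * G / real (h ^ n)"
    by (rule field_le_epsilon) (use key in auto)
  also have "C * 5 ^ n * G / real (h ^ n) = C * 5 ^ n * (1 / m ^ (2 * n) + (if R \<ge> \<kappa> / 4 then real (c * 2 ^ j) / real (h ^ n) else 0))"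
  proof -
    have "G / real (h ^ n) = 1 / m ^ (2 * n) + (if R \<ge> \<kappa> / 4 then real (c * 2 ^ j) / real (h ^ n) else 0)"
      using h by (simp add: G_def add_divide_distrib)
    then show ?thesis by (simp only: times_divide_eq_right[symmetric])
  qed
  finally show ?thesis by (simp only: X_def n_def \<kappa>_def m_def)
qed

end

section \<open>Asymptotic estimates\<close>

text \<open>The exponents of the divisor bound and of the target: since \<open>ln 2 / (9/10) < 78/100 < 1\<close>,
  the number of divisors of a norm is beaten by the exponential factor of the target.\<close>

lemma exponent_comparison:
  fixes B \<tau> :: real
  assumes B: "B \<ge> 0" and \<tau>: "\<tau> > 1"
  shows "\<forall>\<^sub>F H in at_top. \<forall>k r. \<forall>n :: real. n \<ge> 1 \<longrightarrow> H \<le> k \<longrightarrow> k \<le> H + B + H powr (9/10) * ln H \<longrightarrow>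
    k - 2 \<le> r \<longrightarrow> r \<le> (1 + \<tau>) * k \<longrightarrow>
    B + 78/100 * n * (r + B) / ln H - n * H \<le> - (n * r / (1 + \<tau>)) + n * r / ln r"
proof -
  \<comment> \<open>In the application H = ln h, k = ln \<open>kappa\<close> and r = ln R, and the
    power 9/10 comes from ln (Y!). The gain n r / ln r is at least 95/100 of n r / ln H; of this the
    divisor count spends 78/100 and, because r \<ge> H / 2, the errors collected here spend at most
    16/100.\<close>
  have e1: "\<forall>\<^sub>F H in at_top. 2 * B + 78/100 * B / ln H + H powr (9/10) * ln H \<le> 8/100 * H / ln H" by real_asymp
  have e2: "\<forall>\<^sub>F H in at_top. ln (2 * (1 + \<tau>)) + ln H \<le> 105/100 * ln H" by real_asymp
  have e3: "\<forall>\<^sub>F H in at_top. B + H powr (9/10) * ln H \<le> H" by real_asymp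
  have e4: "\<forall>\<^sub>F H :: real in at_top. H \<ge> 6 \<and> ln H \<ge> 1" by (intro eventually_conj; real_asymp)
  show ?thesis using e1 e2 e3 e4
  proof eventually_elim
    case (elim H)
    show ?case
    proof (intro allI impI)
      fix k r n :: real assume a: "1 \<le> n" "H \<le> k" "k \<le> H + B + H powr (9/10) * ln H" "k - 2 \<le> r" "r \<le> (1 + \<tau>) * k"
      have H: "H \<ge> 6" "ln H \<ge> 1" using elim(4) by auto
      have r: "r \<ge> H / 2" "r > 1" using a H by auto
      have "r \<le> (1 + \<tau>) * (2 * H)" using a elim(3) \<tau> by (smt (verit) mult_left_mono)
      then have "ln r \<le> ln (2 * (1 + \<tau>) * H)" using r by (subst ln_le_cancel_iff) (auto simp: mult_ac)
      also have "\<dots> = ln (2 * (1 + \<tau>)) + ln H" using H \<tau> by (simp add: ln_mult)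
      finally have lr: "ln r \<le> 105/100 * ln H" using elim(2) by linarith
      have "n * r / (105/100 * ln H) \<le> n * r / ln r"
        using lr r a H by (intro divide_left_mono mult_pos_pos mult_nonneg_nonneg) (auto simp: ln_gt_zero)
      moreover have "95/100 * (n * r / ln H) \<le> n * r / (105/100 * ln H)"
      proof -
        have "0 \<le> n * r / ln H" using a r H by (intro divide_nonneg_pos mult_nonneg_nonneg) auto
        then have "95/100 * (n * r / ln H) \<le> (100/105) * (n * r / ln H)" by (intro mult_right_mono) auto
        then show ?thesis by (simp add: field_simps)
      qed
      ultimately have A: "95/100 * (n * r / ln H) \<le> n * r / ln r" by linarith
      have "n * r / (1 + \<tau>) \<le> n * k"
        using a(1,5) \<tau> by (simp add: divide_le_eq mult_ac)
      also have "\<dots> \<le> n * (H + B + H powr (9/10) * ln H)" using a by (intro mult_left_mono) auto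
      finally have Bd: "n * r / (1 + \<tau>) \<le> n * (H + B + H powr (9/10) * ln H)" .
      have "n * (2 * B + 78/100 * B / ln H + H powr (9/10) * ln H) \<le> n * (8/100 * H / ln H)"
        using elim(1) a by (intro mult_left_mono) auto
      also have "\<dots> \<le> n * (16/100 * r / ln H)"
        using r H a by (intro mult_left_mono divide_right_mono) auto
      also have "\<dots> = 16/100 * (n * r / ln H)" by simp
      finally have Cd: "n * (2 * B + 78/100 * B / ln H + H powr (9/10) * ln H) \<le> 16/100 * (n * r / ln H)" .
      have nB: "B \<le> n * B" using a(1) B mult_right_mono[of 1 n B] by simp
      have "0 \<le> n * r / ln H" using a r H by (intro divide_nonneg_pos mult_nonneg_nonneg) auto
      moreover have "78/100 * n * (r + B) / ln H = 78/100 * (n * r / ln H) + n * (78/100 * B / ln H)"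
        by (simp add: add_divide_distrib algebra_simps)
      ultimately show "B + 78/100 * n * (r + B) / ln H - n * H \<le> - (n * r / (1 + \<tau>)) + n * r / ln r"
        using A Bd Cd nB by (simp add: algebra_simps)
    qed
  qed
qed

text \<open>The claimed rate without its power of the logarithm; the transform is shown to be
  little-o of this smaller function.\<close>

definition target :: "nat \<Rightarrow> real \<Rightarrow> real \<Rightarrow> real" where
  "target n \<tau> R = R powr (- (real n / (1 + \<tau>))) * exp (real n * ln R / ln (ln R))"

lemma target_eq_exp:
  assumes "R > 0"
  shows "target n \<tau> R = exp (- (real n * ln R / (1 + \<tau>)) + real n * ln R / ln (ln R))"
  using assms by (simp add: target_def powr_def exp_add[symmetric])

lemma ln_2_le: "ln (2 :: real) \<le> 694/1000 + 1/1000"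
  using ln2_le_25_over_36 by simp

lemma target_ge:
  assumes "R \<ge> exp (exp 1)" "\<tau> > 1"
  shows "1 / R ^ n \<le> target n \<tau> R"
proof -
  have R: "R > 0" "ln R \<ge> exp 1" using assms less_le_trans[OF exp_gt_zero] by (auto simp: ln_ge_iff)
  have ll: "ln (ln R) \<ge> 1" using R less_le_trans[OF exp_gt_zero R(2)] by (simp add: ln_ge_iff)
  have R1: "ln R \<ge> 0" using R(2) exp_ge_zero order_trans by blast
  have "1 / R ^ n = exp (- (real n * ln R))" using R by (simp add: exp_minus exp_of_nat_mult inverse_eq_divide)
  also have "\<dots> \<le> target n \<tau> R"
  proof -
    have "real n * ln R / (1 + \<tau>) \<le> real n * ln R / 1"
      using assms(2) R1 by (intro divide_left_mono) auto
    moreover have "0 \<le> real n * ln R / ln (ln R)" using R1 ll by simp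
    ultimately show ?thesis unfolding target_eq_exp[OF R(1)] by simp
  qed
  finally show ?thesis .
qed

text \<open>The exponent must be below 1, so that ln (Y!) is negligible against ln h / ln ln h, and
  above ln 2, so that ln 2 divided by it stays below 1.\<close>

definition sieve_level :: "nat \<Rightarrow> nat" where
  "sieve_level h = nat \<lfloor>ln (real h) powr (9/10)\<rfloor>"

text \<open>Taking logarithms turns the claim into \<open>exponent_comparison\<close> as long as R
  is at most \<open>\<kappa> h\<close> to the power 1 + \<tau>. Beyond that size the noise has begun
  to decay, with 4 n powers in reserve.\<close>

lemma divisor_term_bound:
  fixes n s c :: nat and \<tau> C c5 \<epsilon> :: real
  assumes n: "n \<ge> 1" and \<tau>: "\<tau> > 1" and C: "C \<ge> 1" and c: "c > 0" and s: "s > 0" and c5: "c5 > 0"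
    and \<epsilon>: "\<epsilon> > 0"
  defines "Y \<equiv> sieve_level" and "\<kappa> \<equiv> \<lambda>h. real (1 + fact (sieve_level h) * (s * h))"
  shows "\<forall>\<^sub>F h in sequentially. \<forall>R \<ge> \<kappa> h / 4. \<exists>j. (C * (2 * R)) ^ n < real (Y h + 1) ^ j \<and>
    real (c * 2 ^ j) / real (h ^ n) * min 1 (1 / (c5 * \<kappa> h powr (- (1 + \<tau>)) * R) ^ (4 * n)) \<le> \<epsilon> * target n \<tau> R"
proof -
  \<comment> \<open>All fixed constants on the logarithmic scale, including \<epsilon>; they vanish
    against H / ln H.\<close>
  define B where "B = \<bar>ln (2 * real c / \<epsilon>)\<bar> + \<bar>ln (2 * C)\<bar> + \<bar>ln (2 * real s)\<bar> + 4 * real n * \<bar>ln c5\<bar>"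
  have nn: "0 \<le> 4 * real n * \<bar>ln c5\<bar>" by simp
  have B0: "B \<ge> 0" by (simp add: B_def)
  have Bc: "ln (2 * real c) - 4 * real n * ln c5 \<le> B + ln \<epsilon>" "ln (2 * real c) \<le> B + ln \<epsilon>"
  proof -
    have "ln (2 * real c / \<epsilon>) = ln (2 * real c) - ln \<epsilon>" using c \<epsilon> by (simp add: ln_div)
    moreover have "- (4 * real n * ln c5) \<le> 4 * real n * \<bar>ln c5\<bar>"
      using mult_left_mono[of "- ln c5" "\<bar>ln c5\<bar>" "4 * real n"] by simp
    ultimately show "ln (2 * real c) - 4 * real n * ln c5 \<le> B + ln \<epsilon>" "ln (2 * real c) \<le> B + ln \<epsilon>"
      using nn unfolding B_def by linarith+
  qed
  have BC: "ln (2 * C) \<le> B" and Bs: "ln (2 * real s) \<le> B" using nn unfolding B_def by linarith+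
  have lim: "filterlim (\<lambda>h. ln (real h)) at_top sequentially" by real_asymp
  note core = eventually_compose_filterlim[OF exponent_comparison[OF B0 \<tau>] lim]
  have e1: "\<forall>\<^sub>F h in sequentially. ln (real h) \<ge> 6 \<and> ln (ln (real h)) \<ge> 1 \<and> ln (real h) powr (9/10) \<ge> 1"
    by (intro eventually_conj; real_asymp)
  show ?thesis using core e1 eventually_gt_at_top[of 0]
  proof eventually_elim
    case (elim h)
    define H where "H = ln (real h)"
    define K where "K = \<kappa> h"
    define k where "k = ln K"
    define y where "y = ln (real (Y h + 1))"
    have h: "h > 0" by fact
    have H: "H \<ge> 6" "ln H \<ge> 1" "H powr (9/10) \<ge> 1" using elim(2) by (auto simp: H_def)
    have Yle: "real (Y h) \<le> H powr (9/10)" unfolding Y_def sieve_level_def H_def by (intro of_nat_floor) simp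
    have Yge: "H powr (9/10) \<le> real (Y h + 1)"
      unfolding Y_def sieve_level_def H_def by linarith
    have Y1: "Y h \<ge> 1"
    proof -
      have "1 \<le> \<lfloor>H powr (9/10)\<rfloor>" using H(3) by simp
      then show ?thesis unfolding Y_def sieve_level_def H_def by linarith
    qed
    have y: "9/10 * ln H \<le> y"
    proof -
      have "9/10 * ln H = ln (H powr (9/10))" using H by (simp add: ln_powr)
      also have "\<dots> \<le> y" unfolding y_def using Yge H by (subst ln_le_cancel_iff) auto
      finally show ?thesis .
    qed
    have lnW: "ln (fact (Y h) :: real) \<le> H powr (9/10) * ln H"
    proof -
      have "(fact (Y h) :: real) \<le> real (Y h) ^ Y h"
        using fact_le_power[of "Y h"] by simp
      then have "ln (fact (Y h) :: real) \<le> ln (real (Y h) ^ Y h)"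
        using Y1 by (subst ln_le_cancel_iff) auto
      also have "\<dots> = real (Y h) * ln (real (Y h))" using Y1 by (simp add: ln_realpow)
      also have "\<dots> \<le> H powr (9/10) * ln H"
      proof (rule mult_mono[OF Yle])
        have "ln (real (Y h)) \<le> ln (H powr (9/10))" using Yle Y1 H by (subst ln_le_cancel_iff) auto
        also have "\<dots> = 9/10 * ln H" using H by (simp add: ln_powr)
        finally show "ln (real (Y h)) \<le> ln H" using H by simp
      qed (use Y1 in auto)
      finally show ?thesis .
    qed
    have fact1: "(fact (Y h) :: real) \<ge> 1" by simp
    have K_h: "real h \<le> K"
    proof -
      have "1 \<le> fact (Y h) * s" using s mult_le_mono[of 1 "fact (Y h)" 1 s] by (simp add: Suc_le_eq)
      then have "h * 1 \<le> h * (fact (Y h) * s)" by (intro mult_left_mono) auto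
      moreover have "h * (fact (Y h) * s) = fact (sieve_level h) * (s * h)" by (simp add: Y_def mult_ac)
      ultimately have "h \<le> 1 + fact (sieve_level h) * (s * h)" by linarith
      then show ?thesis unfolding K_def \<kappa>_def by (simp only: of_nat_le_iff)
    qed
    have K0: "K > 0" using K_h h by simp
    have kH: "H \<le> k" unfolding k_def H_def using K_h h K0 by simp
    have kle: "k \<le> H + B + H powr (9/10) * ln H"
    proof -
      have "1 * (1 * 1) \<le> (fact (Y h) :: real) * (real s * real h)"
        using s h fact1 by (intro mult_mono) auto
      then have "K \<le> 2 * real s * (fact (Y h) * real h)"
        by (simp add: K_def \<kappa>_def Y_def mult_ac)
      then have "k \<le> ln (2 * real s * (fact (Y h) * real h))" unfolding k_def using K0 s h by simp
      also have "\<dots> = ln (2 * real s) + (ln (fact (Y h)) + H)" using s h by (simp add: ln_mult H_def)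
      finally show ?thesis using lnW Bs by linarith
    qed
    show ?case
    proof (intro allI impI)
      fix R assume R: "R \<ge> \<kappa> h / 4"
      define r where "r = ln R"
      have R0: "R > 0" using R K0 by (simp add: K_def)
      have Rexp: "R = exp r" using R0 by (simp add: r_def)
      have ln4: "ln (4 :: real) \<le> 2" using ln_2_le ln_realpow[of 2 2] by simp
      have rk: "k - 2 \<le> r"
      proof -
        have "ln (K / 4) \<le> r" unfolding r_def using R K0 by (simp add: K_def)
        then show ?thesis using K0 ln4 by (simp add: ln_div k_def)
      qed
      have r1: "r \<ge> 4" using rk kH H by linarith
      define Z where "Z = r + ln (2 * C)"
      have Z: "0 \<le> Z" "Z \<le> r + B" using r1 C BC by (auto simp: Z_def intro!: add_nonneg_nonneg)
      have CR: "C * (2 * R) = exp Z" using R0 C by (simp add: Z_def exp_add r_def)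
      \<comment> \<open>The least natural number above n ln (2 C R) / ln (Y + 1); strictness is what
        the divisor count requires.\<close>
      define j where "j = nat \<lfloor>real n * Z / y\<rfloor> + 1"
      have y0: "y > 0" using y H by linarith
      have q0: "0 \<le> real n * Z / y" using Z y0 by simp
      have jgt: "real j > real n * Z / y" unfolding j_def by linarith
      have jle: "real j \<le> real n * Z / y + 1" unfolding j_def using of_nat_floor[OF q0] by simp
      have g1: "(C * (2 * R)) ^ n < real (Y h + 1) ^ j"
      proof -
        have "(C * (2 * R)) ^ n = exp (real n * Z)" by (simp add: CR exp_of_nat_mult)
        also have "\<dots> < exp (real j * y)" using jgt y0 by (simp add: divide_less_eq)
        also have "\<dots> = real (Y h + 1) ^ j" by (simp add: exp_of_nat_mult y_def del: of_nat_add of_nat_Suc)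
        finally show ?thesis .
      qed
      have twoj: "(2 :: real) ^ j \<le> 2 * exp (78/100 * real n * (r + B) / ln H)"
      proof -
        have "(2 :: real) ^ j = exp (real j * ln 2)" by (simp add: exp_of_nat_mult)
        also have "\<dots> \<le> exp ((real n * Z / y + 1) * ln 2)" using jle by simp
        also have "\<dots> = 2 * exp (real n * Z / y * ln 2)" by (simp add: distrib_right exp_add)
        also have "real n * Z / y * ln 2 \<le> 78/100 * real n * (r + B) / ln H"
        proof -
          have "real n * Z / y \<le> real n * (r + B) / (9/10 * ln H)"
            using Z y H y0 by (intro frac_le mult_left_mono mult_nonneg_nonneg) auto
          then have "real n * Z / y * ln 2 \<le> real n * (r + B) / (9/10 * ln H) * (694/1000 + 1/1000)"
            using ln_2_le q0 by (intro mult_mono) (auto intro: order_trans)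
          also have "\<dots> = (695/900) * (real n * (r + B) / ln H)" by simp
          also have "\<dots> \<le> 78/100 * (real n * (r + B) / ln H)"
            using r1 B0 H by (intro mult_right_mono divide_nonneg_pos mult_nonneg_nonneg) auto
          finally show ?thesis by simp
        qed
        finally show ?thesis by simp
      qed
      define E where "E = 78/100 * real n * (r + B) / ln H - real n * H"
      have main: "real (c * 2 ^ j) / real (h ^ n) \<le> exp (ln (2 * real c) + E)"
      proof -
        have "real (c * 2 ^ j) \<le> real c * (2 * exp (78/100 * real n * (r + B) / ln H))"
          using twoj by (simp add: mult_left_mono)
        also have "\<dots> = exp (ln (2 * real c) + 78/100 * real n * (r + B) / ln H)" using c by (simp add: exp_add)
        finally have "real (c * 2 ^ j) / real (h ^ n) \<le> exp (ln (2 * real c) + 78/100 * real n * (r + B) / ln H) / real (h ^ n)"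
          by (intro divide_right_mono) auto
        also have "\<dots> = exp (ln (2 * real c) + E)"
        proof -
          have "real (h ^ n) = exp (real n * H)" using h by (simp add: exp_of_nat_mult H_def)
          then show ?thesis unfolding E_def add_diff_eq exp_diff by simp
        qed
        finally show ?thesis .
      qed
      have core': "B + 78/100 * real n * (r' + B) / ln H - real n * H \<le> - (real n * r' / (1 + \<tau>)) + real n * r' / ln r'"
        if "k - 2 \<le> r'" "r' \<le> (1 + \<tau>) * k" for r'
        using elim(1) that kH kle n unfolding H_def by simp
      have tgt: "\<epsilon> * target n \<tau> R = exp (ln \<epsilon> + (- (real n * r / (1 + \<tau>)) + real n * r / ln r))"
        using \<epsilon> unfolding target_eq_exp[OF R0] exp_add[of "ln \<epsilon>"] r_def by simp
      have pos: "0 \<le> real (c * 2 ^ j) / real (h ^ n)" by simp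
      have g2: "real (c * 2 ^ j) / real (h ^ n) * min 1 (1 / (c5 * K powr (- (1 + \<tau>)) * R) ^ (4 * n)) \<le> \<epsilon> * target n \<tau> R"
      proof (cases "r \<le> (1 + \<tau>) * k")
        case True
        have "real (c * 2 ^ j) / real (h ^ n) * min 1 (1 / (c5 * K powr (- (1 + \<tau>)) * R) ^ (4 * n)) \<le> exp (ln (2 * real c) + E) * 1"
          using main pos c5 R0 by (intro mult_mono) auto
        also have "\<dots> \<le> \<epsilon> * target n \<tau> R"
          unfolding tgt using core'[OF rk True] Bc(2) by (simp add: E_def)
        finally show ?thesis .
      next
        case False
        \<comment> \<open>Compare at the end r' of the admissible range. The excess w costs at most
          78/100 n w in the divisor count and at most n w in the target, against 4 n w gained from
          the noise; r / ln r is increasing there.\<close>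
        define r' where "r' = (1 + \<tau>) * k"
        define w where "w = r - r'"
        have w: "w > 0" using False by (simp add: w_def r'_def)
        have k6: "k \<ge> 6" using kH H by linarith
        have "1 * k \<le> (1 + \<tau>) * k" using \<tau> k6 by (intro mult_right_mono) auto
        then have r'k: "r' \<ge> k" by (simp add: r'_def)
        have pw: "c5 * K powr (- (1 + \<tau>)) * R = exp (ln c5 + w)"
          using c5 K0 by (simp add: Rexp powr_def w_def r'_def k_def exp_add exp_diff exp_minus field_simps)
        have "1 / (c5 * K powr (- (1 + \<tau>)) * R) ^ (4 * n) = exp (- (4 * real n * (ln c5 + w)))"
          unfolding pw by (simp add: exp_minus exp_of_nat_mult[symmetric] inverse_eq_divide)
        then have "real (c * 2 ^ j) / real (h ^ n) * min 1 (1 / (c5 * K powr (- (1 + \<tau>)) * R) ^ (4 * n))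
            \<le> exp (ln (2 * real c) + E) * exp (- (4 * real n * (ln c5 + w)))"
          using main pos c5 R0 by (intro mult_mono) auto
        also have "\<dots> = exp (ln (2 * real c) + E - 4 * real n * (ln c5 + w))"
          by (simp add: exp_add[symmetric])
        also have "\<dots> \<le> \<epsilon> * target n \<tau> R"
        proof -
          have c1: "B + 78/100 * real n * (r' + B) / ln H - real n * H \<le> - (real n * r' / (1 + \<tau>)) + real n * r' / ln r'"
            by (rule core') (use r'k in \<open>auto simp: r'_def\<close>)
          have mono: "r' / ln r' \<le> r / ln r"
          proof -
            have e: "exp 1 \<le> r'" using exp_le r'k k6 by linarith
            then have "ln r / r \<le> ln r' / r'" using w by (intro ln_x_over_x_mono) (auto simp: w_def)
            moreover have "ln r' > 0" "ln r > 0" using r'k k6 r1 by (auto simp: ln_gt_zero)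
            ultimately show ?thesis using r'k k6 r1 by (simp add: field_simps)
          qed
          have Er: "E = 78/100 * real n * (r' + B) / ln H - real n * H + 78/100 * (real n * w) / ln H"
            by (simp add: E_def w_def algebra_simps add_divide_distrib diff_divide_distrib)
          have "78/100 * (real n * w) / ln H \<le> 78/100 * (real n * w) / 1"
            using w H by (intro divide_left_mono) auto
          moreover have "real n * w / (1 + \<tau>) \<le> real n * w / 1"
            using w \<tau> by (intro divide_left_mono) auto
          moreover have "real n * (r' / ln r') \<le> real n * (r / ln r)" using mono by (intro mult_left_mono) auto
          moreover have "real n * r / (1 + \<tau>) = real n * r' / (1 + \<tau>) + real n * w / (1 + \<tau>)"
            by (simp add: w_def algebra_simps add_divide_distrib[symmetric])
          moreover have "0 \<le> real n * w" using w by simp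
          moreover have "4 * real n * (ln c5 + w) = 4 * real n * ln c5 + 4 * (real n * w)" by (simp add: algebra_simps)
          ultimately have "ln (2 * real c) + E - 4 * real n * (ln c5 + w)
             \<le> ln \<epsilon> + (- (real n * r / (1 + \<tau>)) + real n * r / ln r)"
            using c1 Bc(1) Er by (simp only: times_divide_eq_right)
          then show ?thesis unfolding tgt by simp
        qed
        finally show ?thesis .
      qed
      show "\<exists>j. (C * (2 * R)) ^ n < real (Y h + 1) ^ j \<and>
         real (c * 2 ^ j) / real (h ^ n) * min 1 (1 / (c5 * \<kappa> h powr (- (1 + \<tau>)) * R) ^ (4 * n)) \<le> \<epsilon> * target n \<tau> R"
        using g1 g2 unfolding K_def by blast
    qed
  qed
qed

section \<open>Random perturbations\<close>

lemma borel_measurable_infnorm [measurable]: "infnorm \<in> borel_measurable borel"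
  by (intro borel_measurable_continuous_onI continuous_on_infnorm continuous_on_id)

lemma infnorm_attained: "\<exists>i. \<bar>(x :: real ^ 'n::finite) $ i\<bar> = infnorm x"
proof -
  let ?S = "range (\<lambda>i. \<bar>x $ i\<bar>)"
  have "Max ?S \<in> ?S" by (intro Max_in) auto
  then obtain i where i: "\<bar>x $ i\<bar> = Max ?S" by (metis imageE)
  have "infnorm x \<le> Max ?S" unfolding infnorm_le_iff by simp
  then show ?thesis using i component_le_infnorm_cart[of x i] by (intro exI[of _ i]) linarith
qed

lemma abs_inner_le_infnorm: "\<bar>(x :: real ^ 'n::finite) \<bullet> \<zeta>\<bar> \<le> real CARD('n) * infnorm x * infnorm \<zeta>"
proof -
  have "\<bar>x \<bullet> \<zeta>\<bar> \<le> (\<Sum>i\<in>UNIV. \<bar>x $ i\<bar> * \<bar>\<zeta> $ i\<bar>)"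
    unfolding inner_vec_def by (rule order_trans[OF sum_abs]) (simp add: abs_mult)
  also have "\<dots> \<le> (\<Sum>i\<in>(UNIV :: 'n set). infnorm x * infnorm \<zeta>)"
    by (intro sum_mono mult_mono component_le_infnorm_cart infnorm_pos_le) auto
  finally show ?thesis by simp
qed

lemma fourier_transform_minus_1:
  fixes M :: "(real ^ 'n::finite) measure"
  assumes "prob_space M" "sets M = sets borel" and ae: "AE x in M. infnorm x \<le> b"
  shows "norm (fourier_transform M \<zeta> - 1) \<le> 2 * pi * (real CARD('n) * b * infnorm \<zeta>)"
proof -
  interpret prob_space M by fact
  have [measurable_cong]: "sets M = sets borel" by fact
  have int: "integrable M (\<lambda>x. ee (- (x \<bullet> \<zeta>)))" by (rule integrable_ee) measurable
  have "fourier_transform M \<zeta> - 1 = (LINT x|M. ee (- (x \<bullet> \<zeta>)) - 1)"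
    unfolding fourier_transform_ee using int by (simp add: prob_space)
  also have "norm \<dots> \<le> (LINT x|M. norm (ee (- (x \<bullet> \<zeta>)) - 1))" by (rule integral_norm_bound)
  also have "\<dots> \<le> (LINT x|M. 2 * pi * (real CARD('n) * b * infnorm \<zeta>))"
  proof (rule integral_mono_AE)
    show "integrable M (\<lambda>x. norm (ee (- (x \<bullet> \<zeta>)) - 1))" using int by simp
    show "AE x in M. norm (ee (- (x \<bullet> \<zeta>)) - 1) \<le> 2 * pi * (real CARD('n) * b * infnorm \<zeta>)"
      using ae
    proof eventually_elim
      case (elim x)
      have "norm (ee (- (x \<bullet> \<zeta>)) - 1) \<le> 2 * pi * \<bar>- (x \<bullet> \<zeta>)\<bar>" by (rule norm_ee_minus_1_le)
      also have "\<bar>- (x \<bullet> \<zeta>)\<bar> \<le> real CARD('n) * b * infnorm \<zeta>"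
        using abs_inner_le_infnorm[of x \<zeta>] elim infnorm_pos_le[of \<zeta>]
        by (simp, meson mult_left_mono mult_right_mono of_nat_0_le_iff order_trans)
      finally show ?case by simp
    qed
  qed simp
  finally show ?thesis by (simp add: prob_space)
qed

section \<open>The uniform measure on the unit cube\<close>

definition unit_cube :: "(real ^ 'n::finite) set" where
  "unit_cube = cbox 0 (\<chi> i. 1)"

definition cube_measure :: "(real ^ 'n::finite) measure" where
  "cube_measure = density lborel (\<lambda>x. ennreal (indicator unit_cube x))"

lemma sets_cube_measure [simp, measurable_cong]: "sets cube_measure = sets borel"
  by (simp add: cube_measure_def)

lemma space_cube_measure [simp]: "space cube_measure = UNIV"
  by (simp add: cube_measure_def)

lemma borel_unit_cube [measurable]: "unit_cube \<in> sets borel"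
  by (simp add: unit_cube_def)

lemma emeasure_unit_cube: "emeasure lborel (unit_cube :: (real ^ 'n::finite) set) = 1"
proof -
  have b: "((\<chi> i. 1) - 0) \<bullet> b = (1 :: real)" if "b \<in> Basis" for b :: "real ^ 'n"
    using that by (auto simp: Basis_vec_def inner_axis)
  show ?thesis unfolding unit_cube_def by (subst emeasure_lborel_cbox_eq) (use b in \<open>auto intro: prod.neutral\<close>)
qed

lemma prob_space_cube_measure: "prob_space (cube_measure :: (real ^ 'n::finite) measure)"
  by (rule prob_spaceI) (simp add: cube_measure_def emeasure_density nn_integral_indicator ennreal_indicator emeasure_unit_cube)

lemma AE_cube_measure_bound: "AE x in (cube_measure :: (real ^ 'n::finite) measure). infnorm x \<le> 1"
  unfolding cube_measure_def
  by (subst AE_density) (auto simp: unit_cube_def mem_box_cart infnorm_le_iff indicator_def)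

text \<open>Rounding is discontinuous where a coordinate of q x is an integer, which happens on
  countably many hyperplanes.\<close>

lemma AE_cube_measure_hyperplane:
  fixes v :: "real ^ 'n::finite"
  assumes "v \<noteq> 0"
  shows "AE x in cube_measure. v \<bullet> x \<noteq> c"
proof -
  have "negligible {x. v \<bullet> x = c}" using assms by (intro negligible_hyperplane) auto
  then have "{x. v \<bullet> x = c} \<in> null_sets lebesgue" by (simp add: negligible_iff_null_sets)
  moreover have "{x. v \<bullet> x = c} \<in> sets borel" by (intro borel_closed closed_hyperplane)
  ultimately have "{x. v \<bullet> x = c} \<in> null_sets lborel"
    by (simp add: null_sets_completion_iff)
  then have "AE x in lborel. v \<bullet> x \<noteq> c" by (rule AE_I') auto
  then show ?thesis unfolding cube_measure_def by (subst AE_density) auto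
qed

text \<open>Translating the cube by half a period in a single coordinate changes the sign of the character
  but hardly the cube; this replaces the computation of the transform.\<close>

lemma fourier_cube_measure:
  fixes \<zeta> :: "real ^ 'n::finite"
  shows "norm (fourier_transform cube_measure \<zeta>) \<le> 2 / (1 + infnorm \<zeta>)"
proof -
  interpret prob_space "cube_measure :: (real ^ 'n) measure" by (rule prob_space_cube_measure)
  have le1: "norm (fourier_transform cube_measure \<zeta>) \<le> 1"
    unfolding fourier_transform_ee by (rule norm_integral_le_1) auto
  show ?thesis
  proof (cases "infnorm \<zeta> \<le> 1")
    case True
    then have "1 \<le> 2 / (1 + infnorm \<zeta>)" using infnorm_pos_le[of \<zeta>] by (simp add: field_simps)
    then show ?thesis using le1 by linarith
  next
    case False
    obtain i where i: "\<bar>\<zeta> $ i\<bar> = infnorm \<zeta>" using infnorm_attained by blast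
    define t where "t = 1 / (2 * \<bar>\<zeta> $ i\<bar>)"
    have t: "0 < t" "t \<le> 1" using i False by (auto simp: t_def field_simps)
    define c :: "real ^ 'n" where "c = t *\<^sub>R axis i 1"
    have half: "ee (- (c \<bullet> \<zeta>)) = - 1"
    proof -
      have "c \<bullet> \<zeta> = t * \<zeta> $ i" by (simp add: c_def inner_axis')
      moreover have "t * \<zeta> $ i = 1 / 2 \<or> t * \<zeta> $ i = - (1 / 2)"
        using i False by (cases "\<zeta> $ i > 0") (auto simp: t_def field_simps)
      moreover have "ee (1 / 2) = - 1" "ee (- (1 / 2)) = - 1" by (auto simp: ee_def complex_eq_iff)
      ultimately show ?thesis by (metis minus_minus)
    qed
    let ?C = "unit_cube :: (real ^ 'n) set"
    \<comment> \<open>The overlap of the cube with its translate, of volume 1 - t. The two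
      indicators differ on volume 2 t, and this bounds twice the transform.\<close>
    define D :: "(real ^ 'n) set" where "D = cbox 0 (\<chi> j. if j = i then 1 - t else 1)"
    let ?g = "\<lambda>x. ee (- (x \<bullet> \<zeta>))"
    have iC: "integrable lborel (indicator ?C :: _ \<Rightarrow> real)"
      by (intro integrable_real_indicator) (auto simp: emeasure_unit_cube)
    have emD: "emeasure lborel D = ennreal (1 - t)"
    proof -
      have "(\<Prod>b\<in>(Basis :: (real ^ 'n) set). ((\<chi> j. if j = i then 1 - t else 1) - 0) \<bullet> b) = (\<Prod>j\<in>(UNIV :: 'n set). if j = i then 1 - t else 1)"
        by (rule prod.reindex_bij_witness[of _ "\<lambda>j. axis j 1" "\<lambda>b. THE j. b = axis j 1"])
          (auto simp: Basis_vec_def inner_axis axis_eq_axis)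
      also have "\<dots> = 1 - t" by (simp add: prod.delta)
      finally show ?thesis
        using t unfolding D_def by (subst emeasure_lborel_cbox_eq) (auto simp: Basis_vec_def inner_axis)
    qed
    have iD: "integrable lborel (indicator D :: _ \<Rightarrow> real)"
      by (intro integrable_real_indicator) (simp_all add: emD, simp add: D_def)
    have trans: "(LINT x|lborel. f (c + x)) = (LINT x|lborel. f x)"
      if "f \<in> borel_measurable borel" for f :: "real ^ 'n \<Rightarrow> 'b::{banach, second_countable_topology}"
      using that lborel_distr_plus[of c] integral_distr[of "(+) c" lborel borel f] by simp
    have iCc: "integrable lborel (\<lambda>x. indicator ?C (c + x) :: real)"
      using integrable_distr_eq[of "(+) c" lborel borel "indicator ?C :: _ \<Rightarrow> real"] iC lborel_distr_plus[of c] by simp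
    have E: "fourier_transform cube_measure \<zeta> = (LINT x|lborel. indicator ?C x *\<^sub>R ?g x)"
      unfolding fourier_transform_ee cube_measure_def by (subst integral_density) auto
    have int1: "integrable lborel (\<lambda>x. indicator ?C x *\<^sub>R ?g x)"
      by (rule Bochner_Integration.integrable_bound[OF iC]) auto
    have int2: "integrable lborel (\<lambda>x. indicator ?C (c + x) *\<^sub>R ?g x)"
      by (rule Bochner_Integration.integrable_bound[OF iCc]) auto
    have "fourier_transform cube_measure \<zeta> = (LINT x|lborel. indicator ?C (c + x) *\<^sub>R ?g (c + x))"
      unfolding E by (rule trans[symmetric]) auto
    also have "\<dots> = (LINT x|lborel. - (indicator ?C (c + x) *\<^sub>R ?g x))"
    proof -
      have "?g (c + x) = - ?g x" for x
      proof -
        have "- ((c + x) \<bullet> \<zeta>) = - (c \<bullet> \<zeta>) + - (x \<bullet> \<zeta>)" by (simp add: inner_add_left)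
        then show ?thesis by (simp only: ee_add half) simp
      qed
      then show ?thesis by (simp only: scaleR_minus_right)
    qed
    finally have "fourier_transform cube_measure \<zeta> + fourier_transform cube_measure \<zeta> =
       (LINT x|lborel. indicator ?C x *\<^sub>R ?g x) + (LINT x|lborel. - (indicator ?C (c + x) *\<^sub>R ?g x))"
      unfolding E by simp
    also have "\<dots> = (LINT x|lborel. (indicator ?C x - indicator ?C (c + x)) *\<^sub>R ?g x)"
      using int1 int2 by (simp add: scaleR_diff_left)
    finally have two: "2 * fourier_transform cube_measure \<zeta> = (LINT x|lborel. (indicator ?C x - indicator ?C (c + x)) *\<^sub>R ?g x)"
      by simp
    have "norm (2 * fourier_transform cube_measure \<zeta>) \<le> (LINT x|lborel. norm ((indicator ?C x - indicator ?C (c + x)) *\<^sub>R ?g x))"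
      unfolding two by (rule integral_norm_bound)
    also have "\<dots> \<le> (LINT x|lborel. indicator ?C x + indicator ?C (c + x) - 2 * indicator D x)"
    proof (rule integral_mono)
      show "integrable lborel (\<lambda>x. norm ((indicator ?C x - indicator ?C (c + x)) *\<^sub>R ?g x))"
        using int1 int2 by (simp add: scaleR_diff_left)
      show "integrable lborel (\<lambda>x. indicator ?C x + indicator ?C (c + x) - 2 * indicator D x :: real)"
        using iC iCc iD by simp
      fix x
      have D: "0 \<le> x $ j \<and> x $ j \<le> (if j = i then 1 - t else 1)" if "x \<in> D" for j
        using that by (simp add: D_def mem_box_cart)
      have cj: "c $ j = (if j = i then t else 0)" for j by (simp add: c_def axis_def)
      have "x \<in> ?C" "c + x \<in> ?C" if "x \<in> D"
      proof -
        have "0 \<le> x $ j \<and> x $ j \<le> 1" "0 \<le> (c + x) $ j \<and> (c + x) $ j \<le> 1" for j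
          using D[OF that, of j] t by (auto simp: cj split: if_splits)
        then show "x \<in> ?C" "c + x \<in> ?C" by (simp_all add: unit_cube_def mem_box_cart)
      qed
      then show "norm ((indicator ?C x - indicator ?C (c + x)) *\<^sub>R ?g x) \<le> indicator ?C x + indicator ?C (c + x) - 2 * indicator D x"
        by (auto simp: indicator_def)
    qed
    also have "\<dots> = 1 + 1 - 2 * (1 - t)"
    proof -
      have "(LINT x|lborel. indicator ?C x :: real) = 1" by (simp add: measure_def emeasure_unit_cube)
      moreover from this have "(LINT x|lborel. indicator ?C (c + x) :: real) = 1"
        using trans[of "indicator ?C :: _ \<Rightarrow> real"] by simp
      moreover have "(LINT x|lborel. indicator D x :: real) = 1 - t" using t by (simp add: measure_def emD)
      ultimately show ?thesis using iC iCc iD by simp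
    qed
    finally have "norm (fourier_transform cube_measure \<zeta>) \<le> t" by (simp add: norm_mult)
    also have "\<dots> \<le> 2 / (1 + infnorm \<zeta>)" using False by (simp add: t_def i field_simps)
    finally show ?thesis .
  qed
qed

lemma AE_pair_prob:
  assumes "prob_space M" "prob_space N" "{x \<in> space (M \<Otimes>\<^sub>M N). P x} \<in> sets (M \<Otimes>\<^sub>M N)"
    "AE x in M. AE y in N. P (x, y)"
  shows "AE x in M \<Otimes>\<^sub>M N. P x"
proof -
  interpret pair_prob_space M N
    using assms(1,2) by (simp add: pair_prob_space_def pair_sigma_finite_def prob_space_imp_sigma_finite)
  show ?thesis using assms(3,4) by (rule AE_pair_measure)
qed

lemma integral_pair_prob:
  fixes f :: "'a \<times> 'b \<Rightarrow> complex"
  assumes "prob_space M" "prob_space N" "f \<in> borel_measurable (M \<Otimes>\<^sub>M N)" "\<And>x. norm (f x) \<le> 1"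
  shows "(LINT x|(M \<Otimes>\<^sub>M N). f x) = (LINT x|M. LINT y|N. f (x, y))"
proof -
  interpret pair_prob_space M N
    using assms(1,2) by (simp add: pair_prob_space_def pair_sigma_finite_def prob_space_imp_sigma_finite)
  have "integrable (M \<Otimes>\<^sub>M N) f" using assms(3,4) by (intro P.integrable_const_bound[where B = 1]) auto
  then show ?thesis using integral_fst'[of f] by simp
qed

lemma prob_space_pair_distr:
  assumes "prob_space M" "prob_space N" "f \<in> measurable (M \<Otimes>\<^sub>M N) L"
  shows "prob_space (distr (M \<Otimes>\<^sub>M N) L f)"
proof -
  interpret pair_prob_space M N
    using assms(1,2) by (simp add: pair_prob_space_def pair_sigma_finite_def prob_space_imp_sigma_finite)
  show ?thesis by (rule P.prob_space_distr[OF assms(3)])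
qed

section \<open>Sums of independent uniform vectors\<close>

primrec noise :: "nat \<Rightarrow> (real ^ 'n::finite) measure" where
  "noise 0 = return borel 0"
| "noise (Suc k) = distr (noise k \<Otimes>\<^sub>M cube_measure) borel (\<lambda>(x, y). x + y)"

lemma sets_noise [simp, measurable_cong]: "sets (noise k) = sets borel"
  by (cases k) auto

lemma space_noise [simp]: "space (noise k) = UNIV"
  by (cases k) auto

lemma prob_space_noise: "prob_space (noise k :: (real ^ 'n::finite) measure)"
  by (induction k) (auto intro!: prob_space_return prob_space_pair_distr prob_space_cube_measure)

lemma fourier_noise: "fourier_transform (noise k) \<zeta> = fourier_transform cube_measure \<zeta> ^ k"
proof (induction k)
  case 0
  show ?case by (simp add: fourier_transform_ee integral_return)
next
  case (Suc k)
  have "fourier_transform (noise (Suc k)) \<zeta> = (LINT x|(noise k \<Otimes>\<^sub>M cube_measure). ee (- ((fst x + snd x) \<bullet> \<zeta>)))"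
    unfolding noise.simps fourier_transform_ee by (subst integral_distr) (auto simp: case_prod_unfold)
  also have "\<dots> = (LINT x|noise k. LINT y|cube_measure. ee (- ((x + y) \<bullet> \<zeta>)))"
    by (subst integral_pair_prob[OF prob_space_noise prob_space_cube_measure]) auto
  also have "\<dots> = (LINT x|noise k. LINT y|cube_measure. ee (- (x \<bullet> \<zeta>)) * ee (- (y \<bullet> \<zeta>)))"
    by (simp add: inner_add_left ee_add[symmetric])
  also have "\<dots> = fourier_transform (noise k) \<zeta> * fourier_transform cube_measure \<zeta>"
    by (simp add: fourier_transform_ee)
  finally show ?case using Suc by simp
qed

lemma AE_noise_bound: "AE x in (noise k :: (real ^ 'n::finite) measure). infnorm x \<le> real k"
proof (induction k)
  case 0
  have "Measurable.pred borel (\<lambda>x :: real ^ 'n. infnorm x \<le> real 0)" by measurable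
  then show ?case unfolding noise.simps by (subst AE_return) (auto simp: infnorm_0)
next
  case (Suc k)
  have "AE x in noise k \<Otimes>\<^sub>M (cube_measure :: (real ^ 'n) measure). infnorm (fst x + snd x) \<le> real (Suc k)"
  proof (rule AE_pair_prob[OF prob_space_noise prob_space_cube_measure])
    show "AE x in noise k. AE y in (cube_measure :: (real ^ 'n) measure). infnorm (fst (x, y) + snd (x, y)) \<le> real (Suc k)"
      using Suc
    proof eventually_elim
      case (elim x)
      show ?case using AE_cube_measure_bound
      proof eventually_elim
        case (elim y)
        then show ?case using infnorm_triangle[of x y] \<open>infnorm x \<le> real k\<close> by simp
      qed
    qed
  qed measurable
  then show ?case unfolding noise.simps by (subst AE_distr_iff) (auto simp: case_prod_unfold)
qed

lemma AE_noise_hyperplane: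
  fixes v :: "real ^ 'n::finite"
  assumes "v \<noteq> 0" "k > 0"
  shows "AE x in noise k. v \<bullet> x \<noteq> c"
proof -
  obtain j where k: "k = Suc j" using assms(2) gr0_implies_Suc by blast
  have "AE x in noise j \<Otimes>\<^sub>M cube_measure. v \<bullet> (fst x + snd x) \<noteq> c"
  proof (rule AE_pair_prob[OF prob_space_noise prob_space_cube_measure])
    show "AE x in noise j. AE y in cube_measure. v \<bullet> (fst (x, y) + snd (x, y)) \<noteq> c"
    proof (rule AE_I2)
      fix x :: "real ^ 'n"
      show "AE y in cube_measure. v \<bullet> (fst (x, y) + snd (x, y)) \<noteq> c"
        using AE_cube_measure_hyperplane[OF assms(1), of "c - v \<bullet> x"]
        by eventually_elim (simp add: inner_add_right)
    qed
  qed measurable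
  then show ?thesis unfolding k noise.simps by (subst AE_distr_iff) (auto simp: case_prod_unfold)
qed

section \<open>One move of the chain\<close>

context number_basis
begin

text \<open>Each summand contributes one power of decay. Of the 4 n powers, 2 n are spent on summing
  over frequencies and 2 n on the distance from \<xi>.\<close>

definition base_noise :: "(real ^ 'n) measure" where
  "base_noise = noise (4 * CARD('n))"

definition scale_const :: real where
  "scale_const = 3 / 2 * infnorm (coords \<omega> 1)"

definition kap :: "nat \<Rightarrow> real" where
  "kap h = real (kappa (sieve_level h) h)"

text \<open>\<open>scale_const * kap h\<close> bounds the size of every denominator of the level, so
  this is at most the tolerance allowed to each of them.\<close>

definition radius :: "real \<Rightarrow> nat \<Rightarrow> real" where
  "radius \<tau> h = (scale_const * kap h) powr (- (1 + \<tau>))"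

text \<open>The noise has size at most 4 n, so a perturbation uses half of the radius. The other
  half is left for all later moves.\<close>

definition spread :: "real \<Rightarrow> nat \<Rightarrow> real" where
  "spread \<tau> h = radius \<tau> h / (8 * real CARD('n))"

definition choice_measure :: "nat \<Rightarrow> ((int ^ 'n) \<times> (real ^ 'n)) measure" where
  "choice_measure h = measure_pmf (pmf_of_set (box h)) \<Otimes>\<^sub>M base_noise"

definition move :: "real \<Rightarrow> nat \<Rightarrow> ((int ^ 'n) \<times> (real ^ 'n)) \<times> (real ^ 'n) \<Rightarrow> real ^ 'n" where
  "move \<tau> h p = round_to (sieve_level h) h (fst (fst p)) (snd p) + spread \<tau> h *\<^sub>R snd (fst p)"

definition step :: "real \<Rightarrow> nat \<Rightarrow> (real ^ 'n) measure \<Rightarrow> (real ^ 'n) measure" where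
  "step \<tau> h \<mu> = distr (choice_measure h \<Otimes>\<^sub>M \<mu>) borel (move \<tau> h)"

text \<open>The invariant of the chain: null hyperplanes make rounding harmless, and the constant of
  the decay may depend on \<mu>.\<close>

definition good :: "(real ^ 'n) measure \<Rightarrow> bool" where
  "good \<mu> \<longleftrightarrow> prob_space \<mu> \<and> sets \<mu> = sets borel \<and> (\<forall>v c. v \<noteq> 0 \<longrightarrow> (AE x in \<mu>. v \<bullet> x \<noteq> c)) \<and>
    (\<exists>C. \<forall>\<zeta>. norm (fourier_transform \<mu> \<zeta>) \<le> C / (1 + infnorm \<zeta>) ^ (4 * CARD('n)))"

lemma sets_base_noise [simp, measurable_cong]: "sets base_noise = sets borel"
  by (simp add: base_noise_def)

lemma prob_space_base_noise: "prob_space base_noise"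
  unfolding base_noise_def by (rule prob_space_noise)

lemma AE_base_noise_hyperplane: "v \<noteq> 0 \<Longrightarrow> AE x in base_noise. v \<bullet> x \<noteq> c"
  unfolding base_noise_def by (rule AE_noise_hyperplane) auto

lemma fourier_base_noise_bound:
  "norm (fourier_transform base_noise \<zeta>) \<le> 2 ^ (4 * CARD('n)) / (1 + infnorm \<zeta>) ^ (4 * CARD('n))"
proof -
  have "norm (fourier_transform base_noise \<zeta>) \<le> (2 / (1 + infnorm \<zeta>)) ^ (4 * CARD('n))"
    unfolding base_noise_def fourier_noise norm_power by (intro power_mono fourier_cube_measure) auto
  then show ?thesis by (simp add: power_divide)
qed

lemma prob_space_choice: "prob_space (choice_measure h)"
proof -
  interpret pair_prob_space "measure_pmf (pmf_of_set (box h :: (int ^ 'n) set))" base_noise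
    by (simp add: pair_prob_space_def pair_sigma_finite_def prob_space_imp_sigma_finite
        prob_space_base_noise measure_pmf.prob_space_axioms)
  show ?thesis unfolding choice_measure_def by (rule P.prob_space_axioms)
qed

lemma countable_int_vec: "countable (UNIV :: (int ^ 'm::finite) set)"
proof -
  have "range (vec_lambda :: ('m \<Rightarrow> int) \<Rightarrow> _) = UNIV" by (metis surj_def vec_nth_inverse)
  then show ?thesis by (metis countableI_type countable_image)
qed

lemma measurable_move_aux:
  "move \<tau> h \<in> measurable ((count_space UNIV \<Otimes>\<^sub>M borel) \<Otimes>\<^sub>M borel) borel"
  unfolding move_def[abs_def]
  by (rule measurable_compose_countable'[where I = UNIV and g = "\<lambda>p. fst (fst p)"
        and f = "\<lambda>u p. round_to (sieve_level h) h u (snd p) + spread \<tau> h *\<^sub>R snd (fst p)"])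
    (auto simp: countable_int_vec)

lemma measurable_move [measurable]:
  assumes "sets \<mu> = sets borel"
  shows "move \<tau> h \<in> measurable (choice_measure h \<Otimes>\<^sub>M \<mu>) borel"
proof -
  have "sets (choice_measure h \<Otimes>\<^sub>M \<mu>) = sets ((count_space UNIV \<Otimes>\<^sub>M borel) \<Otimes>\<^sub>M borel)"
    unfolding choice_measure_def by (intro sets_pair_measure_cong assms) auto
  then show ?thesis using measurable_move_aux measurable_cong_sets by blast
qed

lemma box_nonempty: "h > 0 \<Longrightarrow> box h \<noteq> {}"
  using card_box[of h] by (metis card.empty power_not_zero less_irrefl)

lemma fourier_step:
  assumes \<mu>: "prob_space \<mu>" "sets \<mu> = sets borel" and h: "h > 0"
  shows "fourier_transform (step \<tau> h \<mu>) \<xi> = fourier_transform base_noise (spread \<tau> h *\<^sub>R \<xi>) *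
    ((\<Sum>u\<in>box h. LINT x|\<mu>. ee (- (round_to (sieve_level h) h u x \<bullet> \<xi>))) / of_nat (h ^ CARD('n)))"
proof -
  have [measurable_cong]: "sets \<mu> = sets borel" by fact
  interpret \<mu>: prob_space \<mu> by fact
  interpret N: prob_space base_noise by (rule prob_space_base_noise)
  define P where "P = pmf_of_set (box h :: (int ^ 'n) set)"
  define r where "r = round_to (sieve_level h) h"
  define J where "J u = (LINT x|\<mu>. ee (- (r u x \<bullet> \<xi>)))" for u
  define e where "e z = ee (- (z \<bullet> (spread \<tau> h *\<^sub>R \<xi>)))" for z :: "real ^ 'n"
  have [measurable]: "r u \<in> borel_measurable borel" for u unfolding r_def by measurable
  have [measurable]: "e \<in> borel_measurable borel" unfolding e_def[abs_def] by measurable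
  have [measurable]: "(\<lambda>p. J (fst p)) \<in> borel_measurable (measure_pmf P \<Otimes>\<^sub>M base_noise)"
    by (rule measurable_compose[OF measurable_fst]) simp
  have J1: "norm (J u) \<le> 1" for u unfolding J_def by (rule \<mu>.norm_integral_le_1) auto
  have "fourier_transform (step \<tau> h \<mu>) \<xi> = (LINT p|(choice_measure h \<Otimes>\<^sub>M \<mu>). ee (- (move \<tau> h p \<bullet> \<xi>)))"
    unfolding fourier_transform_ee step_def using measurable_move[OF \<mu>(2)] by (subst integral_distr) auto
  also have "\<dots> = (LINT q|choice_measure h. LINT x|\<mu>. ee (- (move \<tau> h (q, x) \<bullet> \<xi>)))"
    using measurable_move[OF \<mu>(2), of \<tau> h] by (intro integral_pair_prob prob_space_choice \<mu>) auto
  also have "\<dots> = (LINT q|choice_measure h. J (fst q) * e (snd q))"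
  proof (rule Bochner_Integration.integral_cong[OF refl])
    fix q
    have "ee (- (move \<tau> h (q, x) \<bullet> \<xi>)) = ee (- (r (fst q) x \<bullet> \<xi>)) * e (snd q)" for x
      by (simp add: move_def r_def e_def ee_add[symmetric] inner_add_left)
    then show "(LINT x|\<mu>. ee (- (move \<tau> h (q, x) \<bullet> \<xi>))) = J (fst q) * e (snd q)"
      by (simp add: J_def)
  qed
  also have "\<dots> = (LINT u|P. LINT z|base_noise. J u * e z)"
    unfolding choice_measure_def P_def[symmetric]
    by (subst integral_pair_prob[OF measure_pmf.prob_space_axioms prob_space_base_noise])
      (auto simp: norm_mult e_def J1)
  also have "\<dots> = (LINT u|P. J u) * fourier_transform base_noise (spread \<tau> h *\<^sub>R \<xi>)"
  proof -
    have "fourier_transform base_noise (spread \<tau> h *\<^sub>R \<xi>) = (LINT z|base_noise. e z)"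
      unfolding fourier_transform_ee e_def ..
    then show ?thesis by simp
  qed
  also have "(LINT u|P. J u) = (\<Sum>u\<in>box h. pmf P u *\<^sub>R J u)"
    using box_nonempty[OF h] by (intro integral_measure_pmf finite_box) (simp add: P_def finite_box)
  also have "\<dots> = (\<Sum>u\<in>box h. J u) / of_nat (h ^ CARD('n))"
    using box_nonempty[OF h]
    by (simp add: P_def pmf_of_set[OF _ finite_box] card_box sum_divide_distrib scaleR_conv_of_real)
  finally show ?thesis by (simp add: J_def r_def mult.commute)
qed

lemma kap_pos: "kap h > 0"
  using kappa_pos by (simp add: kap_def)

lemma scale_const_pos: "scale_const > 0"
  using coords_one_pos by (simp add: scale_const_def)

lemma radius_pos: "radius \<tau> h > 0"
  using kap_pos[of h] scale_const_pos by (simp add: radius_def)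

lemma spread_pos: "spread \<tau> h > 0"
  using radius_pos by (simp add: spread_def)

lemma good_base_noise: "good base_noise"
  unfolding good_def using fourier_base_noise_bound
  by (auto simp: prob_space_base_noise AE_base_noise_hyperplane)

lemma norm_average_le_1:
  assumes "prob_space \<mu>" "sets \<mu> = sets borel" "h > 0"
  shows "norm ((\<Sum>u\<in>box h. LINT x|\<mu>. ee (- (round_to (sieve_level h) h u x \<bullet> \<xi>))) / of_nat (h ^ CARD('n))) \<le> 1"
proof -
  interpret prob_space \<mu> by fact
  have [measurable_cong]: "sets \<mu> = sets borel" by fact
  have "norm (\<Sum>u\<in>box h. LINT x|\<mu>. ee (- (round_to (sieve_level h) h u x \<bullet> \<xi>))) \<le> (\<Sum>u\<in>(box h :: (int ^ 'n) set). 1)"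
    by (intro sum_norm_le norm_integral_le_1) auto
  then show ?thesis using assms(3) by (simp add: norm_divide norm_power card_box)
qed

text \<open>The fresh noise alone restores both properties: given the denominator and the old point,
  the new point is an affine image of the noise, and the remaining factor of the transform has
  modulus at most 1. The constant deteriorates with the spread.\<close>

lemma good_step:
  assumes g: "good \<mu>" and h: "h > 0"
  shows "good (step \<tau> h \<mu>)"
proof -
  have \<mu>: "prob_space \<mu>" "sets \<mu> = sets borel" using g by (auto simp: good_def)
  have [measurable_cong]: "sets \<mu> = sets borel" by fact
  note mv = measurable_move[OF \<mu>(2), of \<tau> h]
  have prob: "prob_space (step \<tau> h \<mu>)"
    unfolding step_def by (rule prob_space_pair_distr[OF prob_space_choice \<mu>(1) mv])
  have hyp: "AE x in step \<tau> h \<mu>. v \<bullet> x \<noteq> c" if v: "v \<noteq> 0" for v c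
  proof -
    have "AE p in choice_measure h \<Otimes>\<^sub>M \<mu>. v \<bullet> move \<tau> h p \<noteq> c"
    proof -
      interpret pair_prob_space "choice_measure h" \<mu>
        using prob_space_choice \<mu>(1) by (simp add: pair_prob_space_def pair_sigma_finite_def prob_space_imp_sigma_finite)
      interpret C: pair_prob_space "measure_pmf (pmf_of_set (box h :: (int ^ 'n) set))" base_noise
        by (simp add: pair_prob_space_def pair_sigma_finite_def prob_space_imp_sigma_finite
            prob_space_base_noise measure_pmf.prob_space_axioms)
      have 1: "AE q in choice_measure h. v \<bullet> move \<tau> h (q, x) \<noteq> c" for x
      proof -
        have mvx: "(\<lambda>q. move \<tau> h (q, x)) \<in> borel_measurable (choice_measure h)"
          using measurable_compose[OF measurable_Pair2' mv, of x] \<mu>(2) by (simp add: sets_eq_imp_space_eq)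
        then have [measurable]: "(\<lambda>q. move \<tau> h (q, x)) \<in> borel_measurable (measure_pmf (pmf_of_set (box h)) \<Otimes>\<^sub>M base_noise)"
          by (simp add: choice_measure_def)
        show ?thesis unfolding choice_measure_def
        proof (rule AE_pair_prob[OF measure_pmf.prob_space_axioms prob_space_base_noise])
          show "AE u in measure_pmf (pmf_of_set (box h)). AE z in base_noise. v \<bullet> move \<tau> h ((u, z), x) \<noteq> c"
          proof (rule AE_I2)
            fix u
            have "spread \<tau> h *\<^sub>R v \<noteq> 0" using spread_pos[of \<tau> h] v by simp
            from AE_base_noise_hyperplane[OF this, of "c - v \<bullet> round_to (sieve_level h) h u x"]
            show "AE z in base_noise. v \<bullet> move \<tau> h ((u, z), x) \<noteq> c"
              by eventually_elim (auto simp: move_def inner_add_right)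
          qed
        qed measurable
      qed
      have "AE x in \<mu>. AE q in choice_measure h. v \<bullet> move \<tau> h (q, x) \<noteq> c" using 1 by simp
      \<comment> \<open>The null set is found for a fixed old point, while the product integrates
        that point last; Fubini exchanges the order.\<close>
      then have "AE q in choice_measure h. AE x in \<mu>. v \<bullet> move \<tau> h (q, x) \<noteq> c"
        using mv by (subst AE_commute) (auto simp: case_prod_unfold)
      then show ?thesis
        using mv by (intro AE_pair_measure) auto
    qed
    then show ?thesis unfolding step_def using mv by (subst AE_distr_iff) auto
  qed
  have dec: "norm (fourier_transform (step \<tau> h \<mu>) \<zeta>) \<le> (2 / min 1 (spread \<tau> h)) ^ (4 * CARD('n)) / (1 + infnorm \<zeta>) ^ (4 * CARD('n))" for \<zeta>
  proof -
    define m where "m = min 1 (spread \<tau> h)"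
    have m: "0 < m" using spread_pos[of \<tau> h] by (simp add: m_def)
    have "m * (1 + infnorm \<zeta>) \<le> 1 + spread \<tau> h * infnorm \<zeta>"
      unfolding distrib_left using infnorm_pos_le[of \<zeta>] by (intro add_mono mult_right_mono) (auto simp: m_def)
    then have le: "m * (1 + infnorm \<zeta>) \<le> 1 + infnorm (spread \<tau> h *\<^sub>R \<zeta>)"
      using spread_pos[of \<tau> h] by (simp add: infnorm_mul)
    have "norm (fourier_transform (step \<tau> h \<mu>) \<zeta>) \<le> norm (fourier_transform base_noise (spread \<tau> h *\<^sub>R \<zeta>)) * 1"
      unfolding fourier_step[OF \<mu> h] norm_mult
      by (intro mult_left_mono norm_average_le_1[OF \<mu> h]) simp
    also have "\<dots> \<le> 2 ^ (4 * CARD('n)) / (1 + infnorm (spread \<tau> h *\<^sub>R \<zeta>)) ^ (4 * CARD('n))"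
      using fourier_base_noise_bound by simp
    also have "\<dots> \<le> 2 ^ (4 * CARD('n)) / (m * (1 + infnorm \<zeta>)) ^ (4 * CARD('n))"
      using m infnorm_pos_le[of \<zeta>] le infnorm_pos_le[of "spread \<tau> h *\<^sub>R \<zeta>"]
      by (intro divide_left_mono power_mono mult_pos_pos zero_less_power mult_nonneg_nonneg) auto
    also have "\<dots> = (2 / m) ^ (4 * CARD('n)) / (1 + infnorm \<zeta>) ^ (4 * CARD('n))"
      by (simp add: power_divide power_mult_distrib)
    finally show ?thesis by (simp add: m_def)
  qed
  show ?thesis unfolding good_def using prob hyp dec by (auto simp: step_def)
qed

text \<open>Coordinate i of q x is the scalar product with row i of the matrix. The row is nonzero
  by the lower bound for the transpose, and countably many hyperplanes are null.\<close>

lemma AE_not_Ints: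
  assumes g: "good \<mu>" and u: "u \<in> box h"
  shows "AE x in \<mu>. \<forall>i. (mm (denom Y h u) *v x) $ i \<notin> \<int>"
proof -
  let ?A = "mm (denom Y h u)"
  have "AE x in \<mu>. \<forall>i. \<forall>k::int. ?A $ i \<bullet> x \<noteq> of_int k"
  proof (intro AE_finite_all[of UNIV, simplified] allI iffD2[OF AE_all_countable])
    fix i :: 'n and k :: int
    have "?A $ i \<noteq> 0"
    proof
      assume 0: "?A $ i = 0"
      have e: "transpose ?A *v axis i 1 = ?A $ i"
        by (simp add: vec_eq_iff matrix_vector_mult_def transpose_def axis_def if_distrib cong: if_cong)
      have "0 < real (kappa Y h) / 2 * infnorm (axis i 1 :: real ^ 'n)"
        using kappa_pos[of Y h] by (simp add: infnorm_pos_lt axis_eq_0_iff)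
      also have "\<dots> \<le> infnorm (?A $ i)" using denom_bounds(3)[OF u, of Y "axis i 1"] e by simp
      finally show False using 0 by (simp add: infnorm_0)
    qed
    then show "AE x in \<mu>. ?A $ i \<bullet> x \<noteq> of_int k" using g by (simp add: good_def)
  qed
  then show ?thesis
  proof eventually_elim
    case (elim x)
    have "(?A *v x) $ i = ?A $ i \<bullet> x" for i by (simp add: matrix_vector_mult_def inner_vec_def)
    then show ?case using elim by (auto elim!: Ints_cases)
  qed
qed

lemma kap_ge: "real h \<le> kap h"
proof -
  have "1 \<le> fact (sieve_level h) * slope"
    using slope_pos mult_le_mono[of 1 "fact (sieve_level h)" 1 slope] by (simp add: Suc_le_eq)
  then have "1 * h \<le> (fact (sieve_level h) * slope) * h" by (rule mult_right_mono) simp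
  moreover have "(fact (sieve_level h) * slope) * h = fact (sieve_level h) * (slope * h)" by (simp add: mult_ac)
  ultimately have "h \<le> kappa (sieve_level h) h" unfolding kappa_def by linarith
  then show ?thesis by (simp add: kap_def)
qed

lemma kap_at_top: "filterlim kap at_top sequentially"
  by (rule filterlim_at_top_mono[OF filterlim_real_sequentially]) (simp add: kap_ge)

lemma radius_tendsto: "\<tau> > 0 \<Longrightarrow> (radius \<tau> \<longlongrightarrow> 0) sequentially"
proof -
  assume \<tau>: "\<tau> > 0"
  have "filterlim (\<lambda>h. scale_const * kap h) at_top sequentially"
    by (rule filterlim_tendsto_pos_mult_at_top[OF tendsto_const scale_const_pos kap_at_top])
  then show ?thesis unfolding radius_def[abs_def]
    using \<tau> by (intro tendsto_neg_powr) auto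
qed

lemma fourier_base_noise_le:
  assumes "R = infnorm \<xi>" "R > 0"
  shows "norm (fourier_transform base_noise (spread \<tau> h *\<^sub>R \<xi>)) \<le> min 1 (1 / (spread \<tau> h / 2 * R) ^ (4 * CARD('n)))"
proof -
  interpret prob_space base_noise by (rule prob_space_base_noise)
  have "norm (fourier_transform base_noise (spread \<tau> h *\<^sub>R \<xi>)) \<le> 1"
    unfolding fourier_transform_ee by (rule norm_integral_le_1) auto
  moreover have "norm (fourier_transform base_noise (spread \<tau> h *\<^sub>R \<xi>)) \<le> 1 / (spread \<tau> h / 2 * R) ^ (4 * CARD('n))"
  proof -
    have e: "infnorm (spread \<tau> h *\<^sub>R \<xi>) = spread \<tau> h * R" using spread_pos[of \<tau> h] by (simp add: infnorm_mul assms)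
    have p: "0 < spread \<tau> h * R" using spread_pos assms by simp
    have "norm (fourier_transform base_noise (spread \<tau> h *\<^sub>R \<xi>)) \<le> 2 ^ (4 * CARD('n)) / (1 + spread \<tau> h * R) ^ (4 * CARD('n))"
      using fourier_base_noise_bound[of "spread \<tau> h *\<^sub>R \<xi>"] unfolding e .
    also have "\<dots> \<le> 2 ^ (4 * CARD('n)) / (spread \<tau> h * R) ^ (4 * CARD('n))"
      using p by (intro divide_left_mono power_mono mult_pos_pos[OF zero_less_power zero_less_power]) auto
    also have "\<dots> = 1 / (spread \<tau> h / 2 * R) ^ (4 * CARD('n))" by (simp add: power_divide power_mult_distrib)
    finally show ?thesis .
  qed
  ultimately show ?thesis by simp
qed

lemma fourier_base_noise_minus_1:
  "norm (fourier_transform base_noise (spread \<tau> h *\<^sub>R \<xi>) - 1) \<le> pi * real CARD('n) * radius \<tau> h * infnorm \<xi>"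
proof -
  have "norm (fourier_transform base_noise (spread \<tau> h *\<^sub>R \<xi>) - 1)
      \<le> 2 * pi * (real CARD('n) * real (4 * CARD('n)) * infnorm (spread \<tau> h *\<^sub>R \<xi>))"
    by (rule fourier_transform_minus_1[OF prob_space_base_noise sets_base_noise])
      (unfold base_noise_def, rule AE_noise_bound)
  also have "\<dots> = pi * real CARD('n) * radius \<tau> h * infnorm \<xi>"
    using spread_pos[of \<tau> h] radius_pos[of \<tau> h] by (simp add: infnorm_mul spread_def)
  finally show ?thesis .
qed

lemma decay_term_le_target:
  fixes C R \<tau> :: real
  assumes "R \<ge> exp (exp 1)" "\<tau> > 1" "C \<ge> 0"
  shows "R * (C / (1 + R) ^ (4 * CARD('n))) \<le> C * target CARD('n) \<tau> R"
proof -
  have R: "R \<ge> 1" using assms(1) by (meson exp_ge_zero one_le_exp_iff order_trans)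
  have "R ^ CARD('n) * R \<le> (1 + R) ^ (4 * CARD('n))"
  proof -
    have "R ^ CARD('n) * R \<le> R ^ CARD('n) * R ^ CARD('n)"
      using R by (intro mult_left_mono self_le_power) auto
    also have "\<dots> = R ^ (2 * CARD('n))" by (simp flip: power_add add: mult_2)
    also have "\<dots> \<le> R ^ (4 * CARD('n))" using R by (intro power_increasing) auto
    also have "\<dots> \<le> (1 + R) ^ (4 * CARD('n))" using R by (intro power_mono) auto
    finally show ?thesis .
  qed
  then have "R / (1 + R) ^ (4 * CARD('n)) \<le> 1 / R ^ CARD('n)"
    using R by (simp add: field_simps)
  then have "R / (1 + R) ^ (4 * CARD('n)) \<le> target CARD('n) \<tau> R"
    using target_ge[OF assms(1,2), of "CARD('n)"] by linarith
  then have "C * (R / (1 + R) ^ (4 * CARD('n))) \<le> C * target CARD('n) \<tau> R"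
    using assms(3) by (rule mult_left_mono)
  then show ?thesis by (simp add: mult_ac)
qed

text \<open>The square of a maximum dominates the product of both entries: n powers give R to the
  power -n, which is below the target, and the other n tend to 0 with 1 / \<kappa>.\<close>

lemma far_term_le:
  fixes \<kappa> R :: real
  assumes "\<kappa> \<ge> 1" "R > 0"
  shows "1 / max (R / 2) (\<kappa> / 8) ^ (2 * n) \<le> (16 / \<kappa>) ^ n * (1 / R ^ n)"
proof -
  define m where "m = max (R / 2) (\<kappa> / 8)"
  have "R / 2 * (\<kappa> / 8) \<le> m * m" using assms by (intro mult_mono) (auto simp: m_def)
  then have "(R / 2 * (\<kappa> / 8)) ^ n \<le> (m * m) ^ n" using assms by (intro power_mono) auto
  moreover have "(m * m) ^ n = m ^ (2 * n)" by (simp add: power_mult power2_eq_square)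
  ultimately have le: "(R / 2 * (\<kappa> / 8)) ^ n \<le> m ^ (2 * n)" by simp
  have "1 / m ^ (2 * n) \<le> 1 / (R / 2 * (\<kappa> / 8)) ^ n"
    using assms le by (intro divide_left_mono mult_pos_pos zero_less_power) (auto simp: m_def)
  also have "\<dots> = (16 / \<kappa>) ^ n * (1 / R ^ n)"
    by (simp add: power_divide power_mult_distrib)
  finally show ?thesis by (simp add: m_def)
qed

text \<open>Four errors, each at most a quarter of \<epsilon> times the target. The rounding error
  at the zero frequency, the far frequencies and the deviation of the noise from 1 carry a constant
  of \<mu> times a quantity vanishing as h grows, because \<mu> is fixed first. The near frequencies
  are the arithmetic term.\<close>

lemma step_close:
  assumes g: "good \<mu>" and \<tau>: "\<tau> > 1" and \<epsilon>: "\<epsilon> > 0"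
  shows "\<forall>\<^sub>F h in sequentially. \<forall>\<xi>. infnorm \<xi> \<ge> exp (exp 1) \<longrightarrow>
    norm (fourier_transform (step \<tau> h \<mu>) \<xi> - fourier_transform \<mu> \<xi>) \<le> \<epsilon> * target CARD('n) \<tau> (infnorm \<xi>)"
proof -
  define n where "n = CARD('n)"
  have n: "n \<ge> 1" by (simp add: n_def Suc_le_eq)
  have \<mu>: "prob_space \<mu>" "sets \<mu> = sets borel" using g by (auto simp: good_def)
  obtain C where C: "\<And>\<zeta>. norm (fourier_transform \<mu> \<zeta>) \<le> C / (1 + infnorm \<zeta>) ^ (4 * n)"
    using g unfolding good_def n_def by blast
  have C0: "C \<ge> 0" using order_trans[OF norm_ge_zero C[of 0]] by (simp add: infnorm_0)
  obtain Cd c where dc: "dual_count Cd c" using ex_dual_count unfolding dual_count_def by blast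
  have Cd: "Cd \<ge> 1" "c > 0" using dc by (auto simp: dual_count_def)
  define c5 where "c5 = scale_const powr (- (1 + \<tau>)) / (16 * real n)"
  have c5: "c5 > 0" using scale_const_pos n by (simp add: c5_def)
  have spread_eq: "spread \<tau> h / 2 = c5 * kap h powr (- (1 + \<tau>))" for h
    using scale_const_pos kap_pos[of h] by (simp add: spread_def radius_def c5_def n_def powr_mult)
  define K where "K = C * 5 ^ n"
  have K0: "K \<ge> 0" using C0 by (simp add: K_def)
  define \<epsilon>' where "\<epsilon>' = \<epsilon> / (4 * (K + 1))"
  have \<epsilon>': "\<epsilon>' > 0" using \<epsilon> K0 by (simp add: \<epsilon>'_def)
  have K\<epsilon>: "K * \<epsilon>' \<le> \<epsilon> / 4"
  proof -
    have "K * \<epsilon>' \<le> (K + 1) * \<epsilon>'" using \<epsilon>' by (intro mult_right_mono) auto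
    moreover have "(K + 1) * \<epsilon>' = \<epsilon> / 4" unfolding \<epsilon>'_def using K0 by (simp add: field_simps)
    ultimately show ?thesis by simp
  qed
  have ev1: "\<forall>\<^sub>F h in sequentially. \<forall>R \<ge> kap h / 4. \<exists>j. (Cd * (2 * R)) ^ n < real (sieve_level h + 1) ^ j \<and>
    real (c * 2 ^ j) / real (h ^ n) * min 1 (1 / (c5 * kap h powr (- (1 + \<tau>)) * R) ^ (4 * n)) \<le> \<epsilon>' * target n \<tau> R"
    using divisor_term_bound[OF n \<tau> Cd(1,2) slope_pos c5 \<epsilon>'] by (simp only: kap_def kappa_def)
  have inv: "((\<lambda>h. 1 / kap h) \<longlongrightarrow> 0) sequentially"
    by (rule tendsto_divide_0[OF tendsto_const filterlim_at_top_imp_at_infinity[OF kap_at_top]])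
  have "((\<lambda>h. 4 * pi * real n * C * (1 / kap h)) \<longlongrightarrow> 4 * pi * real n * C * 0) sequentially"
    by (intro tendsto_intros inv)
  then have ev2: "\<forall>\<^sub>F h in sequentially. 4 * pi * real n * C * (1 / kap h) < \<epsilon> / 4"
    using \<epsilon> by (intro order_tendstoD(2)[where y = "4 * pi * real n * C * 0"]) auto
  have "((\<lambda>h. pi * real n * C * radius \<tau> h) \<longlongrightarrow> pi * real n * C * 0) sequentially"
    using \<tau> by (intro tendsto_intros radius_tendsto) auto
  then have ev3: "\<forall>\<^sub>F h in sequentially. pi * real n * C * radius \<tau> h < \<epsilon> / 4"
    using \<epsilon> by (intro order_tendstoD(2)[where y = "pi * real n * C * 0"]) auto
  have "((\<lambda>h. K * (16 * (1 / kap h)) ^ n) \<longlongrightarrow> K * (16 * 0) ^ n) sequentially"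
    by (intro tendsto_intros inv)
  then have ev4: "\<forall>\<^sub>F h in sequentially. K * (16 * (1 / kap h)) ^ n < \<epsilon> / 4"
    using \<epsilon> n by (intro order_tendstoD(2)[where y = "K * (16 * 0) ^ n"]) (auto simp: zero_power)
  show ?thesis using ev1 ev2 ev3 ev4 eventually_gt_at_top[of 0]
  proof eventually_elim
    case (elim h)
    have h: "h > 0" by fact
    show ?case
    proof (intro allI impI)
      fix \<xi> :: "real ^ 'n" assume R0: "infnorm \<xi> \<ge> exp (exp 1)"
      define R where "R = infnorm \<xi>"
      have Rpos: "R > 0" using R0 less_le_trans[OF exp_gt_zero] by (simp add: R_def)
      have \<kappa>1: "kap h \<ge> 1" using kap_ge[of h] h by linarith
      let ?F = "fourier_transform \<mu> \<xi>"
      let ?N = "fourier_transform base_noise (spread \<tau> h *\<^sub>R \<xi>)"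
      let ?I = "\<lambda>u. LINT x|\<mu>. ee (- (round_to (sieve_level h) h u x \<bullet> \<xi>))"
      let ?T = "target n \<tau> R"
      define avg where "avg = (\<Sum>u\<in>box h. ?I u) / of_nat (h ^ n)"
      have T1: "1 / R ^ n \<le> ?T" using target_ge[of R \<tau> n] R0 \<tau> by (simp add: R_def)
      have T0: "?T \<ge> 0" by (simp add: target_def)
      have F: "norm ?F \<le> C / (1 + R) ^ (4 * n)" unfolding R_def by (rule C)
      have RF: "R * norm ?F \<le> C * ?T"
        using decay_term_le_target[of R \<tau> C] R0 \<tau> C0 mult_left_mono[OF F, of R] Rpos
        by (simp add: R_def n_def)
      define N1 where "N1 = min 1 (1 / (c5 * kap h powr (- (1 + \<tau>)) * R) ^ (4 * n))"
      have N1: "norm ?N \<le> N1" "N1 \<le> 1" "N1 \<ge> 0"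
        using fourier_base_noise_le[of R \<xi> \<tau> h] Rpos c5 unfolding N1_def spread_eq n_def[symmetric]
        by (auto simp: R_def)
      obtain j where j: "R \<ge> kap h / 4 \<Longrightarrow> (Cd * (2 * R)) ^ n < real (sieve_level h + 1) ^ j"
        "R \<ge> kap h / 4 \<Longrightarrow> real (c * 2 ^ j) / real (h ^ n) * N1 \<le> \<epsilon>' * ?T"
        using elim(1) unfolding N1_def by (cases "R \<ge> kap h / 4") blast+
      \<comment> \<open>Only the arithmetic term needs the decay of the noise factor; for the others
        the bound 1 suffices.\<close>
      define X where "X = (if R \<ge> kap h / 4 then real (c * 2 ^ j) / real (h ^ n) else 0)"
      have X: "X * N1 \<le> \<epsilon>' * ?T" using j(2) \<epsilon>' T0 by (simp add: X_def)
      have "norm (avg - ?F) \<le> (\<Sum>u\<in>box h. norm (?I u - ?F)) / real (h ^ n)"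
      proof -
        have "avg - ?F = (\<Sum>u\<in>box h. ?I u - ?F) / of_nat (h ^ n)"
          using h by (simp add: avg_def sum_subtractf card_box n_def diff_divide_distrib)
        then have "norm (avg - ?F) = norm (\<Sum>u\<in>box h. ?I u - ?F) / real (h ^ n)"
          by (simp add: norm_divide norm_power)
        also have "\<dots> \<le> (\<Sum>u\<in>box h. norm (?I u - ?F)) / real (h ^ n)"
          by (intro divide_right_mono norm_sum) simp
        finally show ?thesis .
      qed
      also have "\<dots> \<le> 4 * pi * real n * R / kap h * norm ?F + K * (1 / max (R / 2) (kap h / 8) ^ (2 * n) + X)"
        using rounding_average[OF \<mu> AE_not_Ints[OF g] C[unfolded n_def] dc h j(1)[unfolded kap_def n_def] R_def]
        unfolding X_def K_def n_def kap_def .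
      finally have "norm (avg - ?F) \<le> 4 * pi * real n * R / kap h * norm ?F + K * (1 / max (R / 2) (kap h / 8) ^ (2 * n)) + K * X"
        by (simp add: distrib_left)
      moreover have "4 * pi * real n * R / kap h * norm ?F \<le> \<epsilon> / 4 * ?T"
      proof -
        have "4 * pi * real n * R / kap h * norm ?F = 4 * pi * real n * (1 / kap h) * (R * norm ?F)" by simp
        also have "\<dots> \<le> 4 * pi * real n * (1 / kap h) * (C * ?T)"
          using RF \<kappa>1 by (intro mult_left_mono) auto
        also have "\<dots> = 4 * pi * real n * C * (1 / kap h) * ?T" by simp
        also have "\<dots> \<le> \<epsilon> / 4 * ?T" using elim(2) T0 by (intro mult_right_mono) auto
        finally show ?thesis .
      qed
      moreover have "K * (1 / max (R / 2) (kap h / 8) ^ (2 * n)) \<le> \<epsilon> / 4 * ?T"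
      proof -
        have "K * (1 / max (R / 2) (kap h / 8) ^ (2 * n)) \<le> K * ((16 / kap h) ^ n * ?T)"
          using far_term_le[OF \<kappa>1 Rpos, of n] T1 K0 \<kappa>1
          by (intro mult_left_mono) (auto intro: order_trans[OF _ mult_left_mono[OF T1]])
        also have "\<dots> = K * (16 * (1 / kap h)) ^ n * ?T" by simp
        also have "\<dots> \<le> \<epsilon> / 4 * ?T" using elim(4) T0 by (intro mult_right_mono) auto
        finally show ?thesis .
      qed
      moreover have "\<epsilon> / 4 * ?T + \<epsilon> / 4 * ?T = \<epsilon> / 2 * ?T" by simp
      ultimately have A: "norm (avg - ?F) \<le> \<epsilon> / 2 * ?T + K * X" by linarith
      have B: "norm (?N - 1) * norm ?F \<le> \<epsilon> / 4 * ?T"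
      proof -
        have "norm (?N - 1) * norm ?F \<le> pi * real n * radius \<tau> h * R * norm ?F"
          using fourier_base_noise_minus_1[of \<tau> h \<xi>] by (intro mult_right_mono) (auto simp: n_def R_def)
        also have "\<dots> = pi * real n * radius \<tau> h * (R * norm ?F)" by simp
        also have "\<dots> \<le> pi * real n * radius \<tau> h * (C * ?T)"
          using RF radius_pos[of \<tau> h] by (intro mult_left_mono) auto
        also have "\<dots> = pi * real n * C * radius \<tau> h * ?T" by simp
        also have "\<dots> \<le> \<epsilon> / 4 * ?T" using elim(3) T0 by (intro mult_right_mono) auto
        finally show ?thesis .
      qed
      have "fourier_transform (step \<tau> h \<mu>) \<xi> = ?N * avg"
        unfolding avg_def n_def by (rule fourier_step[OF \<mu> h])
      then have "fourier_transform (step \<tau> h \<mu>) \<xi> - ?F = ?N * (avg - ?F) + (?N - 1) * ?F"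
        by (simp add: algebra_simps)
      then have "norm (fourier_transform (step \<tau> h \<mu>) \<xi> - ?F) \<le> norm ?N * norm (avg - ?F) + norm (?N - 1) * norm ?F"
        by (metis norm_mult norm_triangle_ineq)
      also have "norm ?N * norm (avg - ?F) \<le> N1 * (\<epsilon> / 2 * ?T + K * X)"
        using N1 A by (intro mult_mono) auto
      also have "N1 * (\<epsilon> / 2 * ?T + K * X) \<le> \<epsilon> / 2 * ?T + \<epsilon> / 4 * ?T"
      proof -
        have "N1 * (\<epsilon> / 2 * ?T) \<le> 1 * (\<epsilon> / 2 * ?T)" using N1 T0 \<epsilon> by (intro mult_right_mono) auto
        moreover have "K * (X * N1) \<le> K * (\<epsilon>' * ?T)" using X K0 by (rule mult_left_mono)
        moreover have "K * \<epsilon>' * ?T \<le> \<epsilon> / 4 * ?T" using K\<epsilon> T0 by (rule mult_right_mono)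
        ultimately show ?thesis by (simp add: algebra_simps)
      qed
      finally have "norm (fourier_transform (step \<tau> h \<mu>) \<xi> - ?F) \<le> \<epsilon> * ?T" using B by (simp add: field_simps)
      then show "norm (fourier_transform (step \<tau> h \<mu>) \<xi> - ?F) \<le> \<epsilon> * target CARD('n) \<tau> (infnorm \<xi>)"
        by (simp add: n_def R_def)
    qed
  qed
qed

end

section \<open>The limit measure\<close>

context number_basis
begin

definition jump :: "real \<Rightarrow> nat \<Rightarrow> real" where
  "jump \<tau> h = 2 / kap h + radius \<tau> h / 2"

text \<open>Halving the radii and bounding a jump by a quarter makes each jump at most half the
  decrease of the radius. The moves after level k then telescope to at most half of its radius. The
  errors 1 / 2 ^ k are summable, and k \<le> \<open>h (Suc k)\<close> makes the denominators
  unbounded.\<close>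

definition admissible :: "real \<Rightarrow> (nat \<Rightarrow> (real ^ 'n) measure) \<Rightarrow> (nat \<Rightarrow> nat) \<Rightarrow> bool" where
  "admissible \<tau> \<mu> h \<longleftrightarrow> \<mu> 0 = base_noise \<and> (\<forall>k. good (\<mu> k) \<and> h k > 0 \<and>
    \<mu> (Suc k) = step \<tau> (h (Suc k)) (\<mu> k) \<and>
    (\<forall>\<xi>. infnorm \<xi> \<ge> exp (exp 1) \<longrightarrow>
      norm (fourier_transform (\<mu> (Suc k)) \<xi> - fourier_transform (\<mu> k) \<xi>) \<le> 1 / 2 ^ k * target CARD('n) \<tau> (infnorm \<xi>)) \<and>
    jump \<tau> (h (Suc k)) \<le> radius \<tau> (h k) / 4 \<and> radius \<tau> (h (Suc k)) \<le> radius \<tau> (h k) / 2 \<and> k \<le> h (Suc k))"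

lemma admissibleD:
  assumes "admissible \<tau> \<mu> h"
  shows "\<mu> 0 = base_noise" "good (\<mu> k)" "h k > 0" "\<mu> (Suc k) = step \<tau> (h (Suc k)) (\<mu> k)"
    "infnorm \<xi> \<ge> exp (exp 1) \<Longrightarrow>
      norm (fourier_transform (\<mu> (Suc k)) \<xi> - fourier_transform (\<mu> k) \<xi>) \<le> 1 / 2 ^ k * target CARD('n) \<tau> (infnorm \<xi>)"
    "jump \<tau> (h (Suc k)) \<le> radius \<tau> (h k) / 4" "radius \<tau> (h (Suc k)) \<le> radius \<tau> (h k) / 2" "k \<le> h (Suc k)"
  using assms unfolding admissible_def by blast+

lemma ex_admissible:
  assumes \<tau>: "\<tau> > 1"
  shows "\<exists>\<mu> h. admissible \<tau> \<mu> h"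
proof -
  define P where "P k x \<longleftrightarrow> good (fst x) \<and> snd x > 0 \<and> (k = 0 \<longrightarrow> fst x = base_noise)"
    for k :: nat and x :: "(real ^ 'n) measure \<times> nat"
  define Q where "Q k x y \<longleftrightarrow> fst y = step \<tau> (snd y) (fst x) \<and>
    (\<forall>\<xi>. infnorm \<xi> \<ge> exp (exp 1) \<longrightarrow>
      norm (fourier_transform (fst y) \<xi> - fourier_transform (fst x) \<xi>) \<le> 1 / 2 ^ k * target CARD('n) \<tau> (infnorm \<xi>)) \<and>
    jump \<tau> (snd y) \<le> radius \<tau> (snd x) / 4 \<and> radius \<tau> (snd y) \<le> radius \<tau> (snd x) / 2 \<and> k \<le> snd y"
    for k :: nat and x y :: "(real ^ 'n) measure \<times> nat"
  have "\<exists>f. \<forall>k. P k (f k) \<and> Q k (f k) (f (Suc k))"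
  proof (rule dependent_nat_choice)
    show "\<exists>x. P 0 x" by (rule exI[of _ "(base_noise, 1)"]) (simp add: P_def good_base_noise)
    fix x :: "(real ^ 'n) measure \<times> nat" and k assume x: "P k x"
    obtain \<nu> h where xe: "x = (\<nu>, h)" by fastforce
    have g: "good \<nu>" and h: "h > 0" using x by (auto simp: P_def xe)
    have rp: "radius \<tau> h > 0" by (rule radius_pos)
    have "((\<lambda>h. 1 / kap h) \<longlongrightarrow> 0) sequentially"
      by (rule tendsto_divide_0[OF tendsto_const filterlim_at_top_imp_at_infinity[OF kap_at_top]])
    then have "((\<lambda>h. 2 * (1 / kap h) + radius \<tau> h / 2) \<longlongrightarrow> 2 * 0 + 0 / 2) sequentially"
      using \<tau> by (intro tendsto_intros radius_tendsto) auto
    then have "\<forall>\<^sub>F h' in sequentially. 2 * (1 / kap h') + radius \<tau> h' / 2 < radius \<tau> h / 4"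
      using rp by (intro order_tendstoD(2)[where y = "2 * 0 + 0 / 2"]) auto
    moreover have "\<forall>\<^sub>F h' in sequentially. radius \<tau> h' < radius \<tau> h / 2"
      using radius_tendsto[of \<tau>] \<tau> rp by (intro order_tendstoD(2)[where y = 0]) auto
    moreover have "\<forall>\<^sub>F h' in sequentially. \<forall>\<xi>. infnorm \<xi> \<ge> exp (exp 1) \<longrightarrow>
      norm (fourier_transform (step \<tau> h' \<nu>) \<xi> - fourier_transform \<nu> \<xi>) \<le> 1 / 2 ^ k * target CARD('n) \<tau> (infnorm \<xi>)"
      by (rule step_close[OF g \<tau>]) simp
    ultimately have "\<forall>\<^sub>F h' in sequentially. Q k x (step \<tau> h' \<nu>, h') \<and> h' > 0"
      using eventually_ge_at_top[of k] eventually_gt_at_top[of 0]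
      by eventually_elim (simp add: Q_def xe jump_def)
    then obtain h' where h': "Q k x (step \<tau> h' \<nu>, h')" "h' > 0"
      by (metis (mono_tags, lifting) eventually_happens' sequentially_bot)
    then show "\<exists>y. P (Suc k) y \<and> Q k x y"
      using good_step[OF g h'(2)] by (intro exI[of _ "(step \<tau> h' \<nu>, h')"]) (simp add: P_def)
  qed
  then obtain f where f: "\<And>k. P k (f k)" "\<And>k. Q k (f k) (f (Suc k))" by blast
  have "admissible \<tau> (\<lambda>k. fst (f k)) (\<lambda>k. snd (f k))"
    unfolding admissible_def using f(1)[unfolded P_def] f(2)[unfolded Q_def] by blast
  then show ?thesis by blast
qed

text \<open>Couples all the laws on one product space, so that the limit is taken pointwise.\<close>

primrec chain :: "real \<Rightarrow> (nat \<Rightarrow> nat) \<Rightarrow> nat \<Rightarrow> (nat \<Rightarrow> (int ^ 'n) \<times> (real ^ 'n)) \<Rightarrow> real ^ 'n" where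
  "chain \<tau> h 0 w = snd (w 0)"
| "chain \<tau> h (Suc k) w = move \<tau> (h (Suc k)) (w (Suc k), chain \<tau> h k w)"

abbreviation path_measure :: "(nat \<Rightarrow> nat) \<Rightarrow> nat set \<Rightarrow> (nat \<Rightarrow> (int ^ 'n) \<times> (real ^ 'n)) measure" where
  "path_measure h J \<equiv> PiM J (\<lambda>k. choice_measure (h k))"

lemma chain_cong: "(\<And>j. j \<le> k \<Longrightarrow> w j = w' j) \<Longrightarrow> chain \<tau> h k w = chain \<tau> h k w'"
  by (induction k) auto

lemma measurable_snd_choice: "snd \<in> borel_measurable (choice_measure h)"
proof -
  have "snd \<in> measurable (choice_measure h) base_noise" unfolding choice_measure_def by measurable
  then show ?thesis by (simp add: measurable_cong_sets[OF refl sets_base_noise])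
qed

lemma measurable_chain:
  assumes "{..k} \<subseteq> J"
  shows "chain \<tau> h k \<in> borel_measurable (path_measure h J)"
  using assms
proof (induction k)
  case 0
  have "(\<lambda>w. w 0) \<in> measurable (path_measure h J) (choice_measure (h 0))"
    using 0 by (intro measurable_component_singleton) auto
  then have "(\<lambda>w. snd (w 0)) \<in> borel_measurable (path_measure h J)"
    by (rule measurable_compose) (rule measurable_snd_choice)
  then show ?case by (simp add: fun_eq_iff cong: measurable_cong)
next
  case (Suc k)
  have 1: "(\<lambda>w. w (Suc k)) \<in> measurable (path_measure h J) (choice_measure (h (Suc k)))"
    using Suc.prems by (intro measurable_component_singleton) auto
  have 2: "chain \<tau> h k \<in> borel_measurable (path_measure h J)"
    using Suc.prems by (intro Suc.IH) auto
  have "(\<lambda>w. move \<tau> (h (Suc k)) (w (Suc k), chain \<tau> h k w)) \<in> borel_measurable (path_measure h J)"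
    by (rule measurable_compose[OF measurable_Pair[OF 1 2] measurable_move[OF refl]])
  then show ?case by simp
qed

lemma distr_snd_choice: "distr (choice_measure h) borel snd = base_noise"
proof (rule measure_eqI)
  fix A assume "A \<in> sets (distr (choice_measure h) borel snd)"
  then have A: "A \<in> sets borel" by simp
  interpret N: prob_space base_noise by (rule prob_space_base_noise)
  have sp: "space base_noise = UNIV" using sets_eq_imp_space_eq[OF sets_base_noise] by simp
  have "emeasure (distr (choice_measure h) borel snd) A = emeasure (choice_measure h) (snd -` A \<inter> space (choice_measure h))"
    by (rule emeasure_distr[OF measurable_snd_choice A])
  also have "snd -` A \<inter> space (choice_measure h) = UNIV \<times> A"
    by (auto simp: choice_measure_def space_pair_measure sp)
  also have "emeasure (choice_measure h) (UNIV \<times> A) = emeasure base_noise A"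
    unfolding choice_measure_def using A measure_pmf.emeasure_space_1
    by (subst N.emeasure_pair_measure_Times) auto
  finally show "emeasure (distr (choice_measure h) borel snd) A = emeasure base_noise A" .
qed simp

text \<open>The chain up to k depends on the coordinates up to k, so the next coordinate is
  independent of it; splitting that coordinate off turns the law into one
  \<open>step\<close>.\<close>

lemma distr_chain_finite:
  assumes ad: "admissible \<tau> \<mu> h"
  shows "distr (path_measure h {..k}) borel (chain \<tau> h k) = \<mu> k"
proof (induction k)
  case 0
  have "distr (path_measure h {..0}) borel (chain \<tau> h 0) = distr (distr (path_measure h {..0}) (choice_measure (h 0)) (\<lambda>w. w 0)) borel snd"
    using measurable_snd_choice
    by (subst distr_distr) (auto simp: o_def fun_eq_iff intro!: measurable_component_singleton arg_cong[where f = "distr _ _"])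
  also have "\<dots> = base_noise"
    by (subst distr_PiM_component) (auto simp: prob_space_choice distr_snd_choice)
  finally show ?case by (simp only: admissibleD(1)[OF ad])
next
  case (Suc k)
  let ?S = "choice_measure (h (Suc k))"
  have mX: "chain \<tau> h k \<in> borel_measurable (path_measure h {..k})" by (rule measurable_chain) simp
  have mX': "chain \<tau> h (Suc k) \<in> borel_measurable (path_measure h {..Suc k})" by (rule measurable_chain) simp
  have ins: "insert (Suc k) {..k} = {..Suc k}" by auto
  have upd: "(\<lambda>(x, w). w(Suc k := x)) \<in> measurable (?S \<Otimes>\<^sub>M path_measure h {..k}) (path_measure h {..Suc k})"
    unfolding ins[symmetric] by measurable
  have mv: "move \<tau> (h (Suc k)) \<in> borel_measurable (?S \<Otimes>\<^sub>M borel)" by (rule measurable_move) simp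
  have pr: "(\<lambda>(x, w). (x, chain \<tau> h k w)) \<in> measurable (?S \<Otimes>\<^sub>M path_measure h {..k}) (?S \<Otimes>\<^sub>M borel)"
    unfolding case_prod_unfold
    by (intro measurable_Pair measurable_fst measurable_compose[OF measurable_snd mX])
  have "distr (path_measure h {..Suc k}) borel (chain \<tau> h (Suc k)) =
      distr (distr (?S \<Otimes>\<^sub>M path_measure h {..k}) (path_measure h {..Suc k}) (\<lambda>(x, w). w(Suc k := x))) borel (chain \<tau> h (Suc k))"
    using distr_pair_PiM_eq_PiM[of "{..k}" "\<lambda>k. choice_measure (h k)" "Suc k"] prob_space_choice
    unfolding ins by simp
  also have "\<dots> = distr (?S \<Otimes>\<^sub>M path_measure h {..k}) borel (chain \<tau> h (Suc k) \<circ> (\<lambda>(x, w). w(Suc k := x)))"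
    by (rule distr_distr[OF mX' upd])
  also have "chain \<tau> h (Suc k) \<circ> (\<lambda>(x, w). w(Suc k := x)) = move \<tau> (h (Suc k)) \<circ> (\<lambda>(x, w). (x, chain \<tau> h k w))"
    by (auto simp: fun_eq_iff intro!: arg_cong[where f = "move _ _"] chain_cong)
  also have "distr (?S \<Otimes>\<^sub>M path_measure h {..k}) borel \<dots> =
      distr (distr (?S \<Otimes>\<^sub>M path_measure h {..k}) (?S \<Otimes>\<^sub>M borel) (\<lambda>(x, w). (x, chain \<tau> h k w))) borel (move \<tau> (h (Suc k)))"
    by (rule distr_distr[OF mv pr, symmetric])
  also have "distr (?S \<Otimes>\<^sub>M path_measure h {..k}) (?S \<Otimes>\<^sub>M borel) (\<lambda>(x, w). (x, chain \<tau> h k w)) =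
      distr ?S ?S (\<lambda>x. x) \<Otimes>\<^sub>M distr (path_measure h {..k}) borel (chain \<tau> h k)"
  proof (rule pair_measure_distr[symmetric])
    show "sigma_finite_measure (distr (path_measure h {..k}) borel (chain \<tau> h k))"
      unfolding Suc using admissibleD(2)[OF ad, of k] by (intro prob_space_imp_sigma_finite) (simp add: good_def)
  qed (use mX in auto)
  also have "distr ?S ?S (\<lambda>x. x) = ?S" by (rule distr_id)
  finally show ?case unfolding Suc admissibleD(4)[OF ad] step_def .
qed

lemma distr_chain:
  assumes ad: "admissible \<tau> \<mu> h"
  shows "distr (path_measure h UNIV) borel (chain \<tau> h k) = \<mu> k"
proof -
  interpret product_prob_space "\<lambda>k. choice_measure (h k)" UNIV
    by (rule product_prob_spaceI) (rule prob_space_choice)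
  have mX: "chain \<tau> h k \<in> borel_measurable (path_measure h {..k})" by (rule measurable_chain) simp
  have "\<mu> k = distr (distr (path_measure h UNIV) (path_measure h {..k}) (\<lambda>x. restrict x {..k})) borel (chain \<tau> h k)"
    unfolding distr_chain_finite[OF ad, symmetric] by (subst distr_PiM_restrict_finite) auto
  also have "\<dots> = distr (path_measure h UNIV) borel (chain \<tau> h k \<circ> (\<lambda>x. restrict x {..k}))"
    by (rule distr_distr[OF mX]) (rule measurable_restrict_subset, simp)
  also have "chain \<tau> h k \<circ> (\<lambda>x. restrict x {..k}) = chain \<tau> h k"
    by (auto simp: fun_eq_iff intro!: chain_cong)
  finally show ?thesis ..
qed

section \<open>Typical paths and their limits\<close>

definition typical :: "(nat \<Rightarrow> nat) \<Rightarrow> (nat \<Rightarrow> (int ^ 'n) \<times> (real ^ 'n)) \<Rightarrow> bool" where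
  "typical h w \<longleftrightarrow> (\<forall>k. fst (w k) \<in> box (h k) \<and> infnorm (snd (w k)) \<le> real (4 * CARD('n)))"

lemma AE_base_noise_bound: "AE z in base_noise. infnorm z \<le> real (4 * CARD('n))"
  unfolding base_noise_def by (rule AE_noise_bound)

lemma AE_typical:
  assumes "\<And>k. h k > 0"
  shows "AE w in path_measure h UNIV. typical h w"
  unfolding typical_def AE_all_countable
proof
  fix k
  have "AE q in choice_measure (h k). fst q \<in> box (h k) \<and> infnorm (snd q) \<le> real (4 * CARD('n))"
    unfolding choice_measure_def
  proof (rule AE_pair_prob[OF measure_pmf.prob_space_axioms prob_space_base_noise])
    have "AE u in measure_pmf (pmf_of_set (box (h k))). u \<in> box (h k)"
      using box_nonempty[OF assms] finite_box by (simp add: AE_measure_pmf_iff)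
    then show "AE u in measure_pmf (pmf_of_set (box (h k))). AE z in base_noise.
        fst (u, z) \<in> box (h k) \<and> infnorm (snd (u, z)) \<le> real (4 * CARD('n))"
    proof eventually_elim
      case (elim u)
      show ?case using AE_base_noise_bound by eventually_elim (use elim in simp)
    qed
  qed measurable
  then show "AE w in path_measure h UNIV. fst (w k) \<in> box (h k) \<and> infnorm (snd (w k)) \<le> real (4 * CARD('n))"
    by (intro AE_PiM_component[where P = "\<lambda>q. fst q \<in> box (h k) \<and> infnorm (snd q) \<le> real (4 * CARD('n))"] prob_space_choice) auto
qed

lemma infnorm_spread_le:
  assumes "infnorm z \<le> real (4 * CARD('n))"
  shows "infnorm (spread \<tau> h *\<^sub>R z) \<le> radius \<tau> h / 2"
proof -
  have "infnorm (spread \<tau> h *\<^sub>R z) \<le> spread \<tau> h * real (4 * CARD('n))"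
    using spread_pos[of \<tau> h] assms by (simp add: infnorm_mul)
  also have "\<dots> = radius \<tau> h / 2" by (simp add: spread_def)
  finally show ?thesis .
qed

lemma chain_dist:
  assumes ad: "admissible \<tau> \<mu> h" and w: "typical h w" and "k \<le> j"
  shows "infnorm (chain \<tau> h j w - chain \<tau> h k w) \<le> (radius \<tau> (h k) - radius \<tau> (h j)) / 2"
  using \<open>k \<le> j\<close>
proof (induction j rule: dec_induct)
  case base
  then show ?case by (simp add: infnorm_0)
next
  case (step j)
  let ?u = "fst (w (Suc j))" and ?z = "snd (w (Suc j))" and ?X = "chain \<tau> h j w"
  have "chain \<tau> h (Suc j) w - ?X = (round_to (sieve_level (h (Suc j))) (h (Suc j)) ?u ?X - ?X) + spread \<tau> (h (Suc j)) *\<^sub>R ?z"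
    by (simp add: move_def)
  then have "infnorm (chain \<tau> h (Suc j) w - ?X) \<le> infnorm (round_to (sieve_level (h (Suc j))) (h (Suc j)) ?u ?X - ?X) + infnorm (spread \<tau> (h (Suc j)) *\<^sub>R ?z)"
    by (metis infnorm_triangle)
  also have "\<dots> \<le> 2 / kap (h (Suc j)) + radius \<tau> (h (Suc j)) / 2"
    using w unfolding kap_def by (intro add_mono round_to_dist infnorm_spread_le) (auto simp: typical_def)
  also have "\<dots> \<le> radius \<tau> (h j) / 4" using admissibleD(6)[OF ad, of j] by (simp only: jump_def)
  also have "\<dots> \<le> (radius \<tau> (h j) - radius \<tau> (h (Suc j))) / 2"
  proof -
    have "radius \<tau> (h (Suc j)) \<le> radius \<tau> (h j) / 2" by (rule admissibleD(7)[OF ad])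
    then show ?thesis by simp
  qed
  finally have 1: "infnorm (chain \<tau> h (Suc j) w - ?X) \<le> (radius \<tau> (h j) - radius \<tau> (h (Suc j))) / 2" .
  have "chain \<tau> h (Suc j) w - chain \<tau> h k w = (chain \<tau> h (Suc j) w - ?X) + (?X - chain \<tau> h k w)" by simp
  then have "infnorm (chain \<tau> h (Suc j) w - chain \<tau> h k w) \<le> infnorm (chain \<tau> h (Suc j) w - ?X) + infnorm (?X - chain \<tau> h k w)"
    by (metis infnorm_triangle)
  then show ?case using 1 step.IH by simp
qed

lemma radius_bound:
  assumes ad: "admissible \<tau> \<mu> h"
  shows "radius \<tau> (h k) \<le> radius \<tau> (h 0) / 2 ^ k"
proof (induction k)
  case (Suc k)
  have "radius \<tau> (h (Suc k)) \<le> radius \<tau> (h k) / 2" by (rule admissibleD(7)[OF ad])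
  then show ?case using Suc by simp
qed simp

definition limit_point :: "real \<Rightarrow> (nat \<Rightarrow> nat) \<Rightarrow> (nat \<Rightarrow> (int ^ 'n) \<times> (real ^ 'n)) \<Rightarrow> real ^ 'n" where
  "limit_point \<tau> h w = lim (\<lambda>k. chain \<tau> h k w)"

lemma chain_tendsto:
  assumes ad: "admissible \<tau> \<mu> h" and w: "typical h w"
  shows "(\<lambda>k. chain \<tau> h k w) \<longlonglongrightarrow> limit_point \<tau> h w"
    and "infnorm (limit_point \<tau> h w - chain \<tau> h k w) \<le> radius \<tau> (h k) / 2"
proof -
  let ?X = "\<lambda>k. chain \<tau> h k w"
  have d: "infnorm (?X j - ?X k) \<le> radius \<tau> (h k) / 2" if "k \<le> j" for j k
    using chain_dist[OF ad w that] radius_pos[of \<tau> "h j"] by simp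
  have "Cauchy ?X"
  proof (rule CauchyI')
    fix e :: real assume e: "e > 0"
    define D where "D = sqrt DIM(real ^ 'n)"
    have D: "D > 0" by (simp add: D_def)
    have "(\<lambda>k. D * (radius \<tau> (h 0) / 2 ^ k)) \<longlonglongrightarrow> D * 0"
      by (intro tendsto_intros LIMSEQ_divide_realpow_zero) simp
    then have "\<forall>\<^sub>F k in sequentially. D * (radius \<tau> (h 0) / 2 ^ k) < e"
      using e by (intro order_tendstoD(2)[where y = "D * 0"]) auto
    then obtain k where k: "D * (radius \<tau> (h 0) / 2 ^ k) < e"
      by (metis (mono_tags, lifting) eventually_happens' sequentially_bot)
    show "\<exists>M. \<forall>m\<ge>M. \<forall>n>m. dist (?X m) (?X n) < e"
    proof (intro exI[of _ k] allI impI)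
      fix m n assume mn: "k \<le> m" "m < n"
      have "?X n - ?X m = (?X n - ?X k) + - (?X m - ?X k)" by simp
      then have "infnorm (?X n - ?X m) \<le> infnorm (?X n - ?X k) + infnorm (- (?X m - ?X k))"
        by (metis infnorm_triangle)
      also have "\<dots> \<le> radius \<tau> (h k)" using d[of k n] d[of k m] mn unfolding infnorm_neg by simp
      also have "\<dots> \<le> radius \<tau> (h 0) / 2 ^ k" by (rule radius_bound[OF ad])
      finally have i: "infnorm (?X n - ?X m) \<le> radius \<tau> (h 0) / 2 ^ k" .
      have "norm (?X n - ?X m) \<le> D * infnorm (?X n - ?X m)" unfolding D_def by (rule norm_le_infnorm)
      also have "\<dots> \<le> D * (radius \<tau> (h 0) / 2 ^ k)" using i D by (intro mult_left_mono) auto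
      finally show "dist (?X m) (?X n) < e" using k by (simp add: dist_norm norm_minus_commute)
    qed
  qed
  then show conv: "?X \<longlonglongrightarrow> limit_point \<tau> h w"
    unfolding limit_point_def by (simp add: Cauchy_convergent_iff convergent_LIMSEQ_iff)
  have "(\<lambda>j. infnorm (?X j - ?X k)) \<longlonglongrightarrow> infnorm (limit_point \<tau> h w - ?X k)"
    by (intro tendsto_intros conv)
  then show "infnorm (limit_point \<tau> h w - ?X k) \<le> radius \<tau> (h k) / 2"
    by (rule LIMSEQ_le_const2) (use d in blast)
qed

definition limit_measure :: "real \<Rightarrow> (nat \<Rightarrow> nat) \<Rightarrow> (real ^ 'n) measure" where
  "limit_measure \<tau> h = distr (path_measure h UNIV) borel (limit_point \<tau> h)"

lemma measurable_limit_point: "limit_point \<tau> h \<in> borel_measurable (path_measure h UNIV)"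
  unfolding limit_point_def[abs_def] by (rule borel_measurable_lim_metric) (rule measurable_chain, simp)

lemma prob_space_path: "prob_space (path_measure h UNIV)"
  by (rule prob_space_PiM) (rule prob_space_choice)

lemma prob_space_limit_measure: "prob_space (limit_measure \<tau> h)"
  unfolding limit_measure_def by (rule prob_space.prob_space_distr[OF prob_space_path measurable_limit_point])

text \<open>The steps from k on sum to a geometric series, and the transforms converge by dominated
  convergence along typical paths.\<close>

lemma fourier_limit_close:
  assumes ad: "admissible \<tau> \<mu> h" and \<xi>: "infnorm \<xi> \<ge> exp (exp 1)"
  shows "norm (fourier_transform (limit_measure \<tau> h) \<xi> - fourier_transform (\<mu> k) \<xi>) \<le> 2 / 2 ^ k * target CARD('n) \<tau> (infnorm \<xi>)"
proof -
  interpret prob_space "path_measure h UNIV" by (rule prob_space_path)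
  let ?T = "target CARD('n) \<tau> (infnorm \<xi>)"
  have T: "?T \<ge> 0" by (simp add: target_def)
  have mX: "chain \<tau> h k \<in> borel_measurable (path_measure h UNIV)" for k by (rule measurable_chain) simp
  note hpos = admissibleD(3)[OF ad]
  have Fk: "fourier_transform (\<mu> k) \<xi> = (LINT w|path_measure h UNIV. ee (- (chain \<tau> h k w \<bullet> \<xi>)))" for k
    unfolding fourier_transform_ee distr_chain[OF ad, symmetric] by (rule integral_distr[OF mX]) measurable
  have F: "fourier_transform (limit_measure \<tau> h) \<xi> = (LINT w|path_measure h UNIV. ee (- (limit_point \<tau> h w \<bullet> \<xi>)))"
    unfolding fourier_transform_ee limit_measure_def by (rule integral_distr[OF measurable_limit_point]) measurable
  have lim: "(\<lambda>k. fourier_transform (\<mu> k) \<xi>) \<longlonglongrightarrow> fourier_transform (limit_measure \<tau> h) \<xi>"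
    unfolding Fk F
  proof (rule integral_dominated_convergence[where w = "\<lambda>_. 1"])
    show "(\<lambda>w. ee (- (limit_point \<tau> h w \<bullet> \<xi>))) \<in> borel_measurable (path_measure h UNIV)"
      using measurable_limit_point[of \<tau> h] by measurable
    show "(\<lambda>w. ee (- (chain \<tau> h k w \<bullet> \<xi>))) \<in> borel_measurable (path_measure h UNIV)" for k
      using mX[of k] by measurable
    show "AE w in path_measure h UNIV. (\<lambda>k. ee (- (chain \<tau> h k w \<bullet> \<xi>))) \<longlonglongrightarrow> ee (- (limit_point \<tau> h w \<bullet> \<xi>))"
      using AE_typical[OF hpos]
    proof eventually_elim
      case (elim w)
      show ?case unfolding ee_def cis_conv_exp by (intro tendsto_intros chain_tendsto(1)[OF ad elim])
    qed
  qed auto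
  have d: "norm (fourier_transform (\<mu> j) \<xi> - fourier_transform (\<mu> k) \<xi>) \<le> (2 / 2 ^ k - 2 / 2 ^ j) * ?T" if "k \<le> j" for j
    using that
  proof (induction j rule: dec_induct)
    case (step j)
    have "norm (fourier_transform (\<mu> (Suc j)) \<xi> - fourier_transform (\<mu> j) \<xi>) \<le> 1 / 2 ^ j * ?T"
      by (rule admissibleD(5)[OF ad \<xi>])
    then have "norm (fourier_transform (\<mu> (Suc j)) \<xi> - fourier_transform (\<mu> k) \<xi>) \<le> 1 / 2 ^ j * ?T + (2 / 2 ^ k - 2 / 2 ^ j) * ?T"
      using step.IH norm_triangle_le[of "fourier_transform (\<mu> (Suc j)) \<xi> - fourier_transform (\<mu> j) \<xi>" "fourier_transform (\<mu> j) \<xi> - fourier_transform (\<mu> k) \<xi>"]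
      by simp
    also have "\<dots> = (2 / 2 ^ k - 2 / 2 ^ Suc j) * ?T" by (simp add: algebra_simps)
    finally show ?case .
  qed simp
  have "norm (fourier_transform (\<mu> j) \<xi> - fourier_transform (\<mu> k) \<xi>) \<le> 2 / 2 ^ k * ?T" if "k \<le> j" for j
  proof -
    have "(2 / 2 ^ k - 2 / 2 ^ j) * ?T \<le> 2 / 2 ^ k * ?T" using T by (intro mult_right_mono) auto
    then show ?thesis using d[OF that] by linarith
  qed
  moreover have "(\<lambda>j. norm (fourier_transform (\<mu> j) \<xi> - fourier_transform (\<mu> k) \<xi>)) \<longlonglongrightarrow> norm (fourier_transform (limit_measure \<tau> h) \<xi> - fourier_transform (\<mu> k) \<xi>)"
    by (intro tendsto_intros lim)
  ultimately show ?thesis by (intro LIMSEQ_le_const2) auto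
qed

text \<open>First k is chosen so that the tail of the series is below c / 2. Then the rapid decay of
  \<mu> k, whose constant is now fixed, wins at large frequencies; the threshold M lets one factor R
  absorb that constant.\<close>

lemma fourier_limit_smallo:
  assumes ad: "admissible \<tau> \<mu> h" and \<tau>: "\<tau> > 1" and c: "c > 0"
  shows "\<exists>M \<ge> exp (exp 1). \<forall>\<xi>. infnorm \<xi> \<ge> M \<longrightarrow>
    norm (fourier_transform (limit_measure \<tau> h) \<xi>) \<le> c * target CARD('n) \<tau> (infnorm \<xi>)"
proof -
  have "(\<lambda>k. 2 / 2 ^ k :: real) \<longlonglongrightarrow> 0" by (rule LIMSEQ_divide_realpow_zero) simp
  then have "\<forall>\<^sub>F k in sequentially. 2 / 2 ^ k < c / 2" using c by (intro order_tendstoD(2)) auto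
  then obtain k where k: "2 / 2 ^ k < c / 2" by (metis (mono_tags, lifting) eventually_happens' sequentially_bot)
  have "good (\<mu> k)" by (rule admissibleD(2)[OF ad])
  then obtain C where C: "\<And>\<zeta>. norm (fourier_transform (\<mu> k) \<zeta>) \<le> C / (1 + infnorm \<zeta>) ^ (4 * CARD('n))"
    unfolding good_def by blast
  have C0: "C \<ge> 0" using order_trans[OF norm_ge_zero C[of 0]] by (simp add: infnorm_0)
  define M where "M = exp (exp 1) + 2 * C / c"
  have "M \<ge> exp (exp 1)" using C0 c by (simp add: M_def)
  moreover have "norm (fourier_transform (limit_measure \<tau> h) \<xi>) \<le> c * target CARD('n) \<tau> (infnorm \<xi>)" if \<xi>: "infnorm \<xi> \<ge> M" for \<xi>
  proof -
    let ?R = "infnorm \<xi>"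
    let ?T = "target CARD('n) \<tau> ?R"
    have T: "?T \<ge> 0" by (simp add: target_def)
    have R: "?R \<ge> exp (exp 1)" using \<xi> C0 c by (simp add: M_def) (smt (verit) divide_nonneg_pos)
    have Rp: "?R > 0" using R less_le_trans[OF exp_gt_zero] by blast
    have R2: "2 * C / c \<le> ?R" using \<xi> exp_gt_zero[of "exp 1 :: real"] unfolding M_def by linarith
    have "?R * norm (fourier_transform (\<mu> k) \<xi>) \<le> C * ?T"
      using decay_term_le_target[OF R \<tau> C0] mult_left_mono[OF C[of \<xi>], of ?R] Rp by simp
    also have "\<dots> \<le> ?R * (c / 2) * ?T"
      using R2 c T by (intro mult_right_mono) (auto simp: field_simps)
    finally have "norm (fourier_transform (\<mu> k) \<xi>) \<le> c / 2 * ?T" using Rp by (simp add: mult.assoc)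
    moreover have "norm (fourier_transform (limit_measure \<tau> h) \<xi> - fourier_transform (\<mu> k) \<xi>) \<le> c / 2 * ?T"
      using fourier_limit_close[OF ad R, of k] mult_right_mono[OF less_imp_le[OF k] T] by linarith
    ultimately have "norm (fourier_transform (limit_measure \<tau> h) \<xi>) \<le> c / 2 * ?T + c / 2 * ?T"
      using norm_triangle_sub[of "fourier_transform (limit_measure \<tau> h) \<xi>" "fourier_transform (\<mu> k) \<xi>"] by linarith
    then show ?thesis by simp
  qed
  ultimately show ?thesis by blast
qed

text \<open>The closed trap of one level. The bound on r makes the union finite, and hence
  closed.\<close>

definition net :: "real \<Rightarrow> real \<Rightarrow> nat \<Rightarrow> (real ^ 'n) set" where
  "net \<tau> B h = (\<Union>u\<in>box h. \<Union>r\<in>{r. infnorm (real_vec r) \<le> B * kap h}.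
     {x. infnorm (x - coords \<omega> (of_coords \<omega> r / denom (sieve_level h) h u)) \<le> radius \<tau> h})"

lemma finite_int_ball: "finite {r :: int ^ 'n. infnorm (real_vec r) \<le> b}"
proof -
  have "r $ i \<in> {- \<lceil>b\<rceil>..\<lceil>b\<rceil>}" if "infnorm (real_vec r) \<le> b" for r :: "int ^ 'n" and i
  proof -
    have "\<bar>real_of_int (r $ i)\<bar> \<le> b" using that component_le_infnorm_cart[of "real_vec r" i] by simp
    then show ?thesis by (simp, linarith)
  qed
  then have "{r :: int ^ 'n. infnorm (real_vec r) \<le> b} \<subseteq> {r. \<forall>i. r $ i \<in> {- \<lceil>b\<rceil>..\<lceil>b\<rceil>}}" by blast
  then show ?thesis by (rule finite_subset) (rule card_int_box, simp)
qed

lemma closed_net: "closed (net \<tau> B h)"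
  unfolding net_def by (intro closed_UN finite_box finite_int_ball ballI closed_Collect_le continuous_intros)

lemma limit_point_bounded:
  assumes ad: "admissible \<tau> \<mu> h" and w: "typical h w"
  shows "infnorm (limit_point \<tau> h w) \<le> real (4 * CARD('n)) + radius \<tau> (h 0)"
    "infnorm (chain \<tau> h k w) \<le> real (4 * CARD('n)) + radius \<tau> (h 0)"
proof -
  have 0: "infnorm (chain \<tau> h 0 w) \<le> real (4 * CARD('n))" using w by (simp add: typical_def)
  have p: "radius \<tau> (h 0) > 0" "radius \<tau> (h k) > 0" by (rule radius_pos)+
  have tri: "infnorm x \<le> infnorm (x - chain \<tau> h 0 w) + infnorm (chain \<tau> h 0 w)" for x
    using infnorm_triangle[of "x - chain \<tau> h 0 w" "chain \<tau> h 0 w"] by simp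
  show "infnorm (limit_point \<tau> h w) \<le> real (4 * CARD('n)) + radius \<tau> (h 0)"
    using tri[of "limit_point \<tau> h w"] chain_tendsto(2)[OF ad w, of 0] 0 p by linarith
  show "infnorm (chain \<tau> h k w) \<le> real (4 * CARD('n)) + radius \<tau> (h 0)"
  proof -
    have "infnorm (chain \<tau> h k w - chain \<tau> h 0 w) \<le> (radius \<tau> (h 0) - radius \<tau> (h k)) / 2"
      by (rule chain_dist[OF ad w le0])
    also have "\<dots> \<le> radius \<tau> (h 0)" using p by simp
    finally show ?thesis using tri[of "chain \<tau> h k w"] 0 by linarith
  qed
qed

text \<open>Half of the radius is used by the perturbation at this level, the other half by all
  later moves. The size of r is bounded because the paths stay bounded and q stretches by at most
  3/2 of \<open>kap\<close>.\<close>

lemma limit_point_in_net: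
  assumes ad: "admissible \<tau> \<mu> h" and w: "typical h w"
  defines "B \<equiv> 3 / 2 * (real (4 * CARD('n)) + radius \<tau> (h 0) + 2)"
  shows "limit_point \<tau> h w \<in> net \<tau> B (h (Suc k))"
proof -
  let ?h = "h (Suc k)"
  let ?X = "chain \<tau> h k w" and ?u = "fst (w (Suc k))" and ?z = "snd (w (Suc k))"
  let ?q = "denom (sieve_level ?h) ?h ?u"
  define r where "r = (\<chi> i. \<lfloor>(mm ?q *v ?X) $ i\<rfloor>)"
  have u: "?u \<in> box ?h" using w by (simp add: typical_def)
  have z: "infnorm ?z \<le> real (4 * CARD('n))" using w by (simp add: typical_def)
  have rt: "round_to (sieve_level ?h) ?h ?u ?X = coords \<omega> (of_coords \<omega> r / ?q)"
    by (simp add: round_to_def r_def)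
  have "limit_point \<tau> h w - coords \<omega> (of_coords \<omega> r / ?q) = (limit_point \<tau> h w - chain \<tau> h (Suc k) w) + spread \<tau> ?h *\<^sub>R ?z"
    by (simp add: move_def rt)
  then have "infnorm (limit_point \<tau> h w - coords \<omega> (of_coords \<omega> r / ?q)) \<le> infnorm (limit_point \<tau> h w - chain \<tau> h (Suc k) w) + infnorm (spread \<tau> ?h *\<^sub>R ?z)"
    by (metis infnorm_triangle)
  also have "\<dots> \<le> radius \<tau> ?h / 2 + radius \<tau> ?h / 2"
    by (intro add_mono chain_tendsto(2)[OF ad w] infnorm_spread_le z)
  finally have 1: "infnorm (limit_point \<tau> h w - coords \<omega> (of_coords \<omega> r / ?q)) \<le> radius \<tau> ?h" by simp
  have "infnorm (coords \<omega> (of_coords \<omega> r / ?q)) \<le> infnorm (coords \<omega> (of_coords \<omega> r / ?q) - ?X) + infnorm ?X"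
    using infnorm_triangle[of "coords \<omega> (of_coords \<omega> r / ?q) - ?X" ?X] by simp
  also have "\<dots> \<le> 2 / kap ?h + (real (4 * CARD('n)) + radius \<tau> (h 0))"
    unfolding rt[symmetric] kap_def by (intro add_mono round_to_dist u limit_point_bounded(2)[OF ad w])
  also have "2 / kap ?h \<le> 2"
  proof -
    have "real ?h \<ge> 1" using admissibleD(3)[OF ad, of "Suc k"] by simp
    then have "kap ?h \<ge> 1" using kap_ge[of ?h] by linarith
    then show ?thesis by (simp add: divide_le_eq)
  qed
  finally have 2: "infnorm (coords \<omega> (of_coords \<omega> r / ?q)) \<le> real (4 * CARD('n)) + radius \<tau> (h 0) + 2" by simp
  have "real_vec r = mm ?q *v coords \<omega> (of_coords \<omega> r / ?q)"
    using denom_coords(3)[OF u, of "sieve_level ?h"] by (simp add: coords_mult[symmetric] coords_of_coords)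
  then have "infnorm (real_vec r) \<le> 3 * kap ?h / 2 * infnorm (coords \<omega> (of_coords \<omega> r / ?q))"
    using denom_bounds(2)[OF u, of "sieve_level ?h"] by (simp add: kap_def)
  also have "\<dots> \<le> 3 * kap ?h / 2 * (real (4 * CARD('n)) + radius \<tau> (h 0) + 2)"
    using 2 kap_pos[of ?h] by (intro mult_left_mono) auto
  also have "\<dots> = B * kap ?h" by (simp add: B_def algebra_simps)
  finally have "infnorm (real_vec r) \<le> B * kap ?h" .
  then show ?thesis using 1 u unfolding net_def by blast
qed

text \<open>Turns almost sure membership in a closed set into membership of every point of the
  support.\<close>

lemma support_subset:
  assumes "closed E" "AE w in path_measure h UNIV. limit_point \<tau> h w \<in> E"
  shows "measure_support (limit_measure \<tau> h) \<subseteq> E"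
proof
  fix x assume x: "x \<in> measure_support (limit_measure \<tau> h)"
  show "x \<in> E"
  proof (rule ccontr)
    assume "x \<notin> E"
    then have "emeasure (limit_measure \<tau> h) (- E) > 0"
      using x assms(1) by (auto simp: measure_support_def open_Compl)
    moreover have "AE y in limit_measure \<tau> h. y \<in> E"
      unfolding limit_measure_def using assms measurable_limit_point by (subst AE_distr_iff) auto
    then have "emeasure (limit_measure \<tau> h) (- E) = 0"
      using assms(1) by (subst (asm) AE_iff_measurable[of "- E"]) (auto simp: limit_measure_def)
    ultimately show False by simp
  qed
qed

lemma closed_measure_support: "closed (measure_support (\<nu> :: (real ^ 'm::finite) measure))"
proof -
  have "- measure_support \<nu> = \<Union>{U. open U \<and> emeasure \<nu> U = 0}"
    by (auto simp: measure_support_def)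
  then show ?thesis unfolding closed_def by (simp add: open_Union)
qed

lemma compact_support_limit:
  assumes ad: "admissible \<tau> \<mu> h"
  shows "compact (measure_support (limit_measure \<tau> h))"
proof -
  let ?b = "real (4 * CARD('n)) + radius \<tau> (h 0)"
  note hpos = admissibleD(3)[OF ad]
  have "measure_support (limit_measure \<tau> h) \<subseteq> {x. infnorm x \<le> ?b}"
  proof (rule support_subset)
    show "closed {x :: real ^ 'n. infnorm x \<le> ?b}" by (intro closed_Collect_le continuous_intros)
    show "AE w in path_measure h UNIV. limit_point \<tau> h w \<in> {x. infnorm x \<le> ?b}"
      using AE_typical[OF hpos] by eventually_elim (use limit_point_bounded(1)[OF ad] in simp)
  qed
  moreover have "bounded {x :: real ^ 'n. infnorm x \<le> ?b}"
  proof (rule boundedI)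
    fix x :: "real ^ 'n" assume "x \<in> {x. infnorm x \<le> ?b}"
    then have "sqrt DIM(real ^ 'n) * infnorm x \<le> sqrt DIM(real ^ 'n) * ?b" by (intro mult_left_mono) auto
    then show "norm x \<le> sqrt DIM(real ^ 'n) * ?b" using norm_le_infnorm[of x] by linarith
  qed
  ultimately show ?thesis
    using closed_measure_support bounded_subset by (auto simp: compact_eq_bounded_closed)
qed

lemma net_approximation:
  assumes "x \<in> net \<tau> B h" "\<tau> > 1"
  shows "\<exists>q r. q \<noteq> 0 \<and> infnorm (x - coords \<omega> (of_coords \<omega> r / of_coords \<omega> q)) \<le> infnorm (real_vec q) powr (- (\<tau> + 1)) \<and>
    kap h / 2 * infnorm (coords \<omega> 1) \<le> infnorm (real_vec q)"
proof -
  obtain u r where u: "u \<in> box h" and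
    r: "infnorm (x - coords \<omega> (of_coords \<omega> r / denom (sieve_level h) h u)) \<le> radius \<tau> h"
    using assms(1) unfolding net_def by blast
  obtain q where q: "denom (sieve_level h) h u = of_coords \<omega> q" using denom_mem_OK OK_eq by blast
  have qn: "infnorm (real_vec q) = infnorm (coords \<omega> (denom (sieve_level h) h u))"
    by (simp add: q coords_of_coords)
  have lo: "kap h / 2 * infnorm (coords \<omega> 1) \<le> infnorm (real_vec q)"
    using denom_coords(1)[OF u, of "sieve_level h"] by (simp add: qn kap_def)
  have up: "infnorm (real_vec q) \<le> scale_const * kap h"
    using denom_coords(2)[OF u, of "sieve_level h"] by (simp add: qn kap_def scale_const_def mult_ac)
  have pos: "0 < kap h / 2 * infnorm (coords \<omega> 1)" using kap_pos coords_one_pos by simp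
  have "radius \<tau> h \<le> infnorm (real_vec q) powr (- (\<tau> + 1))"
    unfolding radius_def add.commute[of \<tau>] using lo up pos assms(2) by (intro powr_mono2') auto
  moreover have "q \<noteq> 0"
  proof
    assume "q = 0"
    then have "real_vec q = 0" by (simp add: vec_eq_iff)
    then show False using lo pos by (simp add: infnorm_0)
  qed
  ultimately show ?thesis using r lo unfolding q by (intro exI[of _ q] exI[of _ r]) linarith
qed

text \<open>A point of the support lies in the nets of all levels, which yields approximations with
  arbitrarily large q; a finite set of pairs would bound their size.\<close>

lemma support_well_approximable:
  assumes ad: "admissible \<tau> \<mu> h" and \<tau>: "\<tau> > 1"
  shows "measure_support (limit_measure \<tau> h) \<subseteq> well_approximable \<omega> \<tau>"
proof
  fix x assume x: "x \<in> measure_support (limit_measure \<tau> h)"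
  define B where "B = 3 / 2 * (real (4 * CARD('n)) + radius \<tau> (h 0) + 2)"
  note hpos = admissibleD(3)[OF ad]
  have net: "x \<in> net \<tau> B (h (Suc k))" for k
  proof -
    have "AE w in path_measure h UNIV. limit_point \<tau> h w \<in> net \<tau> B (h (Suc k))"
      using AE_typical[OF hpos] by eventually_elim (unfold B_def, rule limit_point_in_net[OF ad])
    then show ?thesis using support_subset[OF closed_net] x by blast
  qed
  let ?P = "{(q, r). q \<noteq> 0 \<and> infnorm (x - coords \<omega> (of_coords \<omega> r / of_coords \<omega> q)) \<le> infnorm (real_vec q) powr (- (\<tau> + 1))}"
  have "infinite ?P"
  proof
    assume fin: "finite ?P"
    define M where "M = (\<Sum>p\<in>?P. infnorm (real_vec (fst p)))"
    have M: "infnorm (real_vec (fst p)) \<le> M" if "p \<in> ?P" for p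
      unfolding M_def using fin that by (intro member_le_sum infnorm_pos_le) auto
    obtain k :: nat where k: "real k > 2 * M / infnorm (coords \<omega> 1)" using reals_Archimedean2 by blast
    obtain q r where qr: "q \<noteq> 0" "infnorm (x - coords \<omega> (of_coords \<omega> r / of_coords \<omega> q)) \<le> infnorm (real_vec q) powr (- (\<tau> + 1))"
      "kap (h (Suc k)) / 2 * infnorm (coords \<omega> 1) \<le> infnorm (real_vec q)"
      using net_approximation[OF net \<tau>] by blast
    have "k \<le> h (Suc k)" by (rule admissibleD(8)[OF ad])
    then have "real k \<le> kap (h (Suc k))" using kap_ge[of "h (Suc k)"] by linarith
    then have "real k / 2 * infnorm (coords \<omega> 1) \<le> kap (h (Suc k)) / 2 * infnorm (coords \<omega> 1)"
      by (intro mult_right_mono) (auto simp: infnorm_pos_le)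
    also have "\<dots> \<le> M" using qr M[of "(q, r)"] by simp
    finally show False using k coords_one_pos by (simp add: field_simps)
  qed
  then show "x \<in> well_approximable \<omega> \<tau>" by (simp add: well_approximable_def)
qed

end

theorem theorem1p2:
  fixes \<omega> :: "'n::finite \<Rightarrow> 'k::field_char_0" and \<tau> :: real
  assumes "number_field TYPE('k)"
    and "field_degree TYPE('k) = CARD('n)"
    and "integral_basis \<omega>"
    and "\<tau> > 1"
  shows "\<exists>\<mu> :: (real ^ 'n) measure.
    prob_space \<mu> \<and> sets \<mu> = sets borel \<and>
    compact (measure_support \<mu>) \<and> measure_support \<mu> \<subseteq> well_approximable \<omega> \<tau> \<and>
    fourier_transform \<mu> \<in> o[at_infinity](\<lambda>\<xi>. complex_of_real
      (infnorm \<xi> powr (- (real CARD('n) / (1 + \<tau>)))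
       * exp (real CARD('n) * ln (infnorm \<xi>) / ln (ln (infnorm \<xi>)))
       * ln (infnorm \<xi>) ^ (num_real_embeddings TYPE('k)
           + num_complex_embedding_pairs TYPE('k) + 1)))"
proof -
  interpret number_basis \<omega>
    using assms(3) by (simp add: number_basis_def)
  obtain \<mu> h where ad: "admissible \<tau> \<mu> h"
    using ex_admissible[OF assms(4)] by blast
  define K where "K = num_real_embeddings TYPE('k) + num_complex_embedding_pairs TYPE('k) + 1"
  have "fourier_transform (limit_measure \<tau> h) \<in> o[at_infinity](\<lambda>\<xi>. complex_of_real
      (infnorm \<xi> powr (- (real CARD('n) / (1 + \<tau>)))
       * exp (real CARD('n) * ln (infnorm \<xi>) / ln (ln (infnorm \<xi>))) * ln (infnorm \<xi>) ^ K))"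
  proof (rule landau_o.smallI)
    fix c :: real assume "c > 0"
    then obtain M where M: "M \<ge> exp (exp 1)" "\<And>\<xi>. infnorm \<xi> \<ge> M \<Longrightarrow>
        norm (fourier_transform (limit_measure \<tau> h) \<xi>) \<le> c * target CARD('n) \<tau> (infnorm \<xi>)"
      using fourier_limit_smallo[OF ad assms(4)] by blast
    show "\<forall>\<^sub>F \<xi> in at_infinity. norm (fourier_transform (limit_measure \<tau> h) \<xi>) \<le> c * norm (complex_of_real
      (infnorm \<xi> powr (- (real CARD('n) / (1 + \<tau>)))
       * exp (real CARD('n) * ln (infnorm \<xi>) / ln (ln (infnorm \<xi>))) * ln (infnorm \<xi>) ^ K))"
      unfolding eventually_at_infinity
    proof (intro exI allI impI)
      fix \<xi> :: "real ^ 'n" assume \<xi>: "sqrt DIM(real ^ 'n) * M \<le> norm \<xi>"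
      let ?R = "infnorm \<xi>"
      \<comment> \<open>The filter at infinity uses the Euclidean norm, which is at most the square
        root of n times the max-norm.\<close>
      have "sqrt DIM(real ^ 'n) * M \<le> sqrt DIM(real ^ 'n) * ?R"
        using \<xi> norm_le_infnorm[of \<xi>] by linarith
      then have R: "?R \<ge> M" by simp
      then have "?R \<ge> exp (exp 1)" using M(1) by linarith
      then have "ln ?R \<ge> exp 1" using less_le_trans[OF exp_gt_zero] by (simp add: ln_ge_iff)
      then have l1: "ln ?R \<ge> 1" using exp_ge_add_one_self[of 1] by linarith
      have T: "target CARD('n) \<tau> ?R \<ge> 0" by (simp add: target_def)
      \<comment> \<open>From here on ln R \<ge> 1, so the bound by the target implies the bound with
        the power of the logarithm.\<close>
      have "target CARD('n) \<tau> ?R * 1 \<le> target CARD('n) \<tau> ?R * ln ?R ^ K"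
        using T l1 by (intro mult_left_mono one_le_power)
      then have "c * target CARD('n) \<tau> ?R \<le> c * (target CARD('n) \<tau> ?R * ln ?R ^ K)"
        using \<open>c > 0\<close> by simp
      also have "target CARD('n) \<tau> ?R * ln ?R ^ K = norm (complex_of_real (target CARD('n) \<tau> ?R * ln ?R ^ K))"
        using T l1 by (simp only: norm_of_real abs_of_nonneg mult_nonneg_nonneg zero_le_power)
      finally show "norm (fourier_transform (limit_measure \<tau> h) \<xi>) \<le> c * norm (complex_of_real
        (?R powr (- (real CARD('n) / (1 + \<tau>))) * exp (real CARD('n) * ln ?R / ln (ln ?R)) * ln ?R ^ K))"
        using M(2)[OF R] unfolding target_def by linarith
    qed
  qed
  then show ?thesis
    using prob_space_limit_measure[of \<tau> h] compact_support_limit[OF ad] support_well_approximable[OF ad assms(4)]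
    unfolding K_def by (intro exI[of _ "limit_measure \<tau> h"]) (simp add: limit_measure_def)
qed

end
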